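(* Let $\alpha,\beta$ be nonnegative integers and let $k$ be given by $2k=\alpha+\beta$ (so $k$ is an integer or a half-integer). Let $\mu$ be a regular complex measure on the unit disk $\mathbb{D}$ that is $k$-Carleson, and let $\Phi=\partial^\alpha\bar\partial^\beta\mu$. If $$\int_{\mathbb{D}}(1-|w|^2)^{-2k-2}\,d|\mu|(w)<\infty,$$ then the Toeplitz operator $\mathbf{T}_\Phi=\mathbf{T}_{\alpha,\beta,\mu}$ on the Bergman space $\mathcal{A}^2(\mathbb{D})$ belongs to the trace class, and $$\operatorname{tr}\mathbf{T}_\Phi=\left(\Phi,\frac{1}{(1-|w|^2)^2}\right),$$ that is, $\operatorname{tr}\mathbf{T}_\Phi=(-1)^{\alpha+\beta}\int_{\mathbb{D}}\partial_w^\alpha\partial_{\overline w}^\beta\left[(1-w\overline w)^{-2}\right]d\mu(w)$.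
   Context: $\mathcal{A}^2(\mathbb{D})$ is the Bergman space: the closed subspace of $L_2(\mathbb{D},dA)$ consisting of functions analytic in the open unit disk $\mathbb{D}$, where $dA=\frac1\pi dx\,dy$. Its inner product $\langle\cdot,\cdot\rangle$ is linear in the first argument, and its reproducing kernel is $K_z(w)=(1-\overline z w)^{-2}$. Here $\partial=\partial_w$ and $\bar\partial=\partial_{\overline w}$ are the Wirtinger derivatives; on analytic functions $\partial$ is the complex derivative. $|\mu|$ denotes the total variation measure of $\mu$. For integer $k\ge 0$, a measure $\mu$ on $\mathbb{D}$ is called $k$-Carleson if there is a constant $C$ such that $\left|\int_{\mathbb{D}}|f^{(k)}(z)|^2\,d\mu(z)\right|\le C\|f\|^2_{\mathcal{A}^2(\mathbb{D})}$ for all $f\in\mathcal{A}^2(\mathbb{D})$. For half-integer $k$ (odd $\alpha+\beta$), $k$-Carleson is understood to mean that $d\mu=(1-|z|)^{2k}d\nu$ with $|\nu|$ a Carleson measure for $\mathcal{A}^2(\mathbb{D})$, i.e. $\int_{\mathbb{D}}|f|^2d|\nu|\le C\|f\|^2_{\mathcal{A}^2(\mathbb{D})}$ for all $f\in\mathcal{A}^2(\mathbb{D})$. For nonnegative integers $\alpha,\beta$ define the sesquilinear form $$\mathbf{F}_{\alpha,\beta,\mu}[f,g]=(-1)^{\alpha+\beta}\int_{\mathbb{D}}\partial^\alpha f(z)\,\overline{\partial^\beta g(z)}\,d\mu(z),\qquad f,g\in\mathcal{A}^2(\mathbb{D}).$$ This is the form associated with the distribution $\partial^\alpha\bar\partial^\beta\mu$,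 namely $(\partial^\alpha\bar\partial^\beta\mu,f\overline g)$. The Toeplitz operator $\mathbf{T}_{\alpha,\beta,\mu}$ with distributional symbol $\partial^\alpha\bar\partial^\beta\mu$ is the operator $(\mathbf{T}f)(z)=\mathbf{F}_{\alpha,\beta,\mu}[f,K_z]$; equivalently, $\langle\mathbf{T}f,g\rangle=\mathbf{F}_{\alpha,\beta,\mu}[f,g]$ for all $f,g\in\mathcal{A}^2(\mathbb{D})$. For a smooth function $h$ on $\mathbb{D}$, the pairing is understood as $(\partial^\alpha\bar\partial^\beta\mu,h)=(-1)^{\alpha+\beta}\int_{\mathbb{D}}\partial^\alpha\bar\partial^\beta h\,d\mu$. *)

theory Defs
  imports "HOL-Complex_Analysis.Complex_Analysis"
begin

section \<open>Complex measures\<close>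

text \<open>
  A complex (or signed) measure on the measurable space underlying \<open>M\<close> is a countably additive
  set function on \<open>sets M\<close>; the measure carried by \<open>M\<close> itself plays no role.
  Countable additivity applied to the constant family \<open>{}\<close> gives \<open>\<mu> {} = 0\<close>.
\<close>

definition complex_measure :: "'a measure \<Rightarrow> ('a set \<Rightarrow> complex) \<Rightarrow> bool" where
  "complex_measure M \<mu> \<longleftrightarrow>
     (\<forall>A :: nat \<Rightarrow> 'a set. range A \<subseteq> sets M \<longrightarrow> disjoint_family A \<longrightarrow>
        (\<lambda>i. \<mu> (A i)) sums \<mu> (\<Union>i. A i))"

definition total_variation :: "'a measure \<Rightarrow> ('a set \<Rightarrow> 'b::real_normed_vector) \<Rightarrow> 'a measure" where
  "total_variation M \<mu> = measure_of (space M) (sets M)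
     (\<lambda>E. SUP A \<in> {A :: nat \<Rightarrow> 'a set. range A \<subseteq> sets M \<and> disjoint_family A \<and> (\<Union>i. A i) = E}.
            (\<Sum>i. ennreal (norm (\<mu> (A i)))))"

text \<open>Jordan decomposition: the positive variation of a finite signed measure is
  \<open>(|\<nu>| + \<nu>) / 2\<close>; the negative variation of \<open>\<nu>\<close> is the positive variation of \<open>-\<nu>\<close>.\<close>

definition positive_variation :: "'a measure \<Rightarrow> ('a set \<Rightarrow> real) \<Rightarrow> 'a measure" where
  "positive_variation M \<nu> = measure_of (space M) (sets M)
     (\<lambda>E. ennreal ((measure (total_variation M \<nu>) E + \<nu> E) / 2))"

definition signed_integral :: "'a measure \<Rightarrow> ('a set \<Rightarrow> real) \<Rightarrow> ('a \<Rightarrow> complex) \<Rightarrow> complex" where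
  "signed_integral M \<nu> f =
     (\<integral>x. f x \<partial>positive_variation M \<nu>) - (\<integral>x. f x \<partial>positive_variation M (\<lambda>E. - \<nu> E))"

text \<open>Meaningful for \<open>f\<close> integrable with respect to \<open>total_variation M \<mu>\<close>.\<close>

definition complex_integral :: "'a measure \<Rightarrow> ('a set \<Rightarrow> complex) \<Rightarrow> ('a \<Rightarrow> complex) \<Rightarrow> complex" where
  "complex_integral M \<mu> f =
     signed_integral M (\<lambda>E. Re (\<mu> E)) f + \<i> * signed_integral M (\<lambda>E. Im (\<mu> E)) f"

section \<open>The unit disk and the Bergman space\<close>

abbreviation unit_disk :: "complex set" where
  "unit_disk \<equiv> ball 0 1"

definition disk_borel :: "complex measure" where
  "disk_borel = restrict_space borel unit_disk"

definition disk_area :: "complex measure" where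
  "disk_area = scale_measure (ennreal (1 / pi)) (restrict_space lborel unit_disk)"

text \<open>Elements of the Bergman space are functions on the disk; they are represented by total
  functions that vanish off the disk, so that equality in the space is equality in HOL.\<close>

definition bergman :: "(complex \<Rightarrow> complex) set" where
  "bergman = {f. f holomorphic_on unit_disk \<and> integrable disk_area (\<lambda>z. (cmod (f z))\<^sup>2) \<and>
                 (\<forall>z. z \<notin> unit_disk \<longrightarrow> f z = 0)}"

definition bergman_inner :: "(complex \<Rightarrow> complex) \<Rightarrow> (complex \<Rightarrow> complex) \<Rightarrow> complex" where
  "bergman_inner f g = (\<integral>z. f z * cnj (g z) \<partial>disk_area)"

definition bergman_norm :: "(complex \<Rightarrow> complex) \<Rightarrow> real" where
  "bergman_norm f = sqrt (\<integral>z. (cmod (f z))\<^sup>2 \<partial>disk_area)"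

definition bergman_kernel :: "complex \<Rightarrow> complex \<Rightarrow> complex" where
  "bergman_kernel z w = (if w \<in> unit_disk then 1 / (1 - cnj z * w)\<^sup>2 else 0)"

section \<open>Trace class operators on the Bergman space\<close>

definition bergman_operator :: "((complex \<Rightarrow> complex) \<Rightarrow> (complex \<Rightarrow> complex)) \<Rightarrow> bool" where
  "bergman_operator T \<longleftrightarrow>
     (\<forall>f\<in>bergman. T f \<in> bergman) \<and>
     (\<forall>f\<in>bergman. \<forall>g\<in>bergman. \<forall>a b.
        T (\<lambda>z. a * f z + b * g z) = (\<lambda>z. a * T f z + b * T g z)) \<and>
     (\<exists>C. \<forall>f\<in>bergman. bergman_norm (T f) \<le> C * bergman_norm f)"

definition bergman_onb :: "(complex \<Rightarrow> complex) set \<Rightarrow> bool" where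
  "bergman_onb E \<longleftrightarrow>
     E \<subseteq> bergman \<and>
     (\<forall>e\<in>E. \<forall>e'\<in>E. bergman_inner e e' = (if e = e' then 1 else 0)) \<and>
     (\<forall>f\<in>bergman. (\<forall>e\<in>E. bergman_inner f e = 0) \<longrightarrow> f = (\<lambda>_. 0))"

text \<open>\<open>P = |T|\<close>, the positive square root of \<open>T\<^sup>* T\<close>.\<close>

definition bergman_modulus ::
    "((complex \<Rightarrow> complex) \<Rightarrow> (complex \<Rightarrow> complex)) \<Rightarrow>
     ((complex \<Rightarrow> complex) \<Rightarrow> (complex \<Rightarrow> complex)) \<Rightarrow> bool" where
  "bergman_modulus T P \<longleftrightarrow>
     bergman_operator P \<and>
     (\<forall>f\<in>bergman. bergman_inner (P f) f \<in> \<real>\<^sub>\<ge>\<^sub>0) \<and>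
     (\<forall>f\<in>bergman. \<forall>g\<in>bergman. bergman_inner (P (P f)) g = bergman_inner (T f) (T g))"

definition bergman_trace_class :: "((complex \<Rightarrow> complex) \<Rightarrow> (complex \<Rightarrow> complex)) \<Rightarrow> bool" where
  "bergman_trace_class T \<longleftrightarrow>
     bergman_operator T \<and>
     (\<exists>P. bergman_modulus T P \<and>
          (\<exists>E. bergman_onb E \<and> (\<lambda>e. bergman_inner (P e) e) summable_on E))"

definition bergman_trace :: "((complex \<Rightarrow> complex) \<Rightarrow> (complex \<Rightarrow> complex)) \<Rightarrow> complex" where
  "bergman_trace T =
     (THE t. \<forall>E. bergman_onb E \<longrightarrow> ((\<lambda>e. bergman_inner (T e) e) has_sum t) E)"

section \<open>Regular and Carleson measures on the disk\<close>

definition regular_complex_measure :: "(complex set \<Rightarrow> complex) \<Rightarrow> bool" where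
  "regular_complex_measure \<mu> \<longleftrightarrow>
     complex_measure disk_borel \<mu> \<and>
     (\<forall>E\<in>sets disk_borel.
        emeasure (total_variation disk_borel \<mu>) E =
          (INF U\<in>{U. open U \<and> E \<subseteq> U \<and> U \<subseteq> unit_disk}. emeasure (total_variation disk_borel \<mu>) U) \<and>
        emeasure (total_variation disk_borel \<mu>) E =
          (SUP K\<in>{K. compact K \<and> K \<subseteq> E}. emeasure (total_variation disk_borel \<mu>) K))"

definition carleson_measure :: "complex measure \<Rightarrow> bool" where
  "carleson_measure M \<longleftrightarrow>
     (\<exists>C::real. \<forall>f\<in>bergman.
        (\<integral>\<^sup>+ z. ennreal ((cmod (f z))\<^sup>2) \<partial>M) \<le> ennreal (C * (bergman_norm f)\<^sup>2))"

text \<open>The parameter is \<open>m = 2k\<close>, so that half-integer \<open>k\<close> correspond to odd \<open>m\<close>. For even \<open>m\<close>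
  the integrability clause says that the integral in the Carleson inequality exists.
  For odd \<open>m\<close>, taking \<open>\<nu>\<close> to be a (finite) complex measure is no restriction: testing the Carleson
  inequality on the constant function \<open>1\<close> shows that \<open>|\<nu>|\<close> is finite.\<close>

definition k_carleson :: "nat \<Rightarrow> (complex set \<Rightarrow> complex) \<Rightarrow> bool" where
  "k_carleson m \<mu> \<longleftrightarrow>
     (if even m then
        (\<exists>C::real. \<forall>f\<in>bergman.
           integrable (total_variation disk_borel \<mu>) (\<lambda>z. (cmod ((deriv ^^ (m div 2)) f z))\<^sup>2) \<and>
           cmod (complex_integral disk_borel \<mu>
                   (\<lambda>z. complex_of_real ((cmod ((deriv ^^ (m div 2)) f z))\<^sup>2)))
             \<le> C * (bergman_norm f)\<^sup>2)
      else
        (\<exists>\<nu>. complex_measure disk_borel \<nu> \<and>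
           carleson_measure (total_variation disk_borel \<nu>) \<and>
           (\<forall>E\<in>sets disk_borel.
              \<mu> E = complex_integral disk_borel \<nu>
                      (\<lambda>z. indicator E z * complex_of_real ((1 - cmod z) ^ m)))))"

section \<open>Toeplitz operators with distributional symbols\<close>

definition toeplitz_form ::
    "nat \<Rightarrow> nat \<Rightarrow> (complex set \<Rightarrow> complex) \<Rightarrow>
     (complex \<Rightarrow> complex) \<Rightarrow> (complex \<Rightarrow> complex) \<Rightarrow> complex" where
  "toeplitz_form \<alpha> \<beta> \<mu> f g =
     (-1) ^ (\<alpha> + \<beta>) *
     complex_integral disk_borel \<mu> (\<lambda>z. (deriv ^^ \<alpha>) f z * cnj ((deriv ^^ \<beta>) g z))"

definition toeplitz_operator ::
    "nat \<Rightarrow> nat \<Rightarrow> (complex set \<Rightarrow> complex) \<Rightarrow> (complex \<Rightarrow> complex) \<Rightarrow> complex \<Rightarrow> complex" where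
  "toeplitz_operator \<alpha> \<beta> \<mu> f z =
     (if z \<in> unit_disk then toeplitz_form \<alpha> \<beta> \<mu> f (bergman_kernel z) else 0)"

definition wirtinger :: "(complex \<Rightarrow> complex) \<Rightarrow> complex \<Rightarrow> complex" where
  "wirtinger h w =
     (frechet_derivative h (at w) 1 - \<i> * frechet_derivative h (at w) \<i>) / 2"

definition wirtinger_bar :: "(complex \<Rightarrow> complex) \<Rightarrow> complex \<Rightarrow> complex" where
  "wirtinger_bar h w =
     (frechet_derivative h (at w) 1 + \<i> * frechet_derivative h (at w) \<i>) / 2"

text \<open>The pairing of the distribution obtained from \<open>\<mu>\<close> by \<open>\<alpha>\<close> holomorphic and \<open>\<beta>\<close>
  antiholomorphic Wirtinger derivatives with a function \<open>h\<close> that is smooth on the disk.\<close>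

definition symbol_pairing ::
    "nat \<Rightarrow> nat \<Rightarrow> (complex set \<Rightarrow> complex) \<Rightarrow> (complex \<Rightarrow> complex) \<Rightarrow> complex" where
  "symbol_pairing \<alpha> \<beta> \<mu> h =
     (-1) ^ (\<alpha> + \<beta>) *
     complex_integral disk_borel \<mu> ((wirtinger ^^ \<alpha>) ((wirtinger_bar ^^ \<beta>) h))"

end

theory Submission
  imports Defs
begin

text \<open>
  Polar decomposition of \<open>\<mu>\<close> turns the form into \<open>\<integral> f\<^bsup>(\<alpha>)\<^esup> cnj (g\<^bsup>(\<beta>)\<^esup>) h d|\<mu>|\<close>.
  Point evaluation of the \<open>n\<close>-th derivative at \<open>w\<close> is a bounded functional on the Bergman space of norm
  \<open>O((1 - |w|\<^sup>2)\<^bsup>-n-1\<^esup>)\<close>, so the integrability hypothesis presents \<open>T\<close> as an absolutely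
  convergent integral of operators of rank one.

  By Montel's theorem and dominated convergence \<open>T\<close> maps bounded weakly convergent sequences to norm
  convergent ones, hence \<open>\<parallel>T f\<parallel>\<close> attains its maximum on unit balls of closed subspaces, and \<open>T\<^sup>*T\<close> has
  an orthonormal eigenbasis \<open>e\<close>. The modulus is diagonal in it with entries \<open>s\<^sub>e = \<parallel>T e\<parallel>\<close>. As
  \<open>s\<^sub>e = \<langle>T e, u\<^sub>e\<rangle>\<close> for the orthonormal family \<open>u\<^sub>e = T e / s\<^sub>e\<close>, Bessel's inequality under the
  integral sign bounds the sum of the \<open>s\<^sub>e\<close>.

  For any orthonormal basis, Parseval's identity gives
  \<open>\<Sum>\<^sub>e e\<^bsup>(\<alpha>)\<^esup>(w) cnj (e\<^bsup>(\<beta>)\<^esup>(w)) = \<langle>\<kappa>\<^sub>\<beta>, \<kappa>\<^sub>\<alpha>\<rangle>\<close>, where \<open>\<kappa>\<^sub>n\<close> represents the \<open>n\<close>-th derivative at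
  \<open>w\<close>; the right-hand side is the mixed Wirtinger derivative of \<open>(1 - w cnj w)\<^bsup>-2\<^esup>\<close>.
\<close>

section \<open>Total variation and densities of complex measures\<close>

text \<open>The exponent of the weight is (\<alpha> + 1) + (\<beta> + 1): evaluating a derivative
  costs one power of 1 / (1 - |w|^2) more than its order. The weight is at least 1, so its
  integrability makes |\<mu>| finite. Integrals against \<mu> are defined through the Jordan parts
  of Re \<mu> and Im \<mu>; each part is dominated by |\<mu>| and gets a Radon-Nikodym density, and
  \<open>h\<close> combines the four. What is used of \<open>h\<close> is that weight times
  \<open>h\<close> is integrable. Bergman functions form a set, not a Hilbert space type. Parseval's
  identity in Taylor coefficients, norm^2 = sum of |c_n|^2 / (n + 1), carries the geometry:
  membership, density of polynomials and completeness become statements about weighted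
  square-summable sequences, and completeness enters as Riesz representation. An operator is a
  bounded sesquilinear form evaluated at kernels, as in the definition of the Toeplitz operator;
  adjoint and modulus arise the same way. The eigenbasis serves twice: it diagonalizes the modulus,
  and it shows that an orthonormal basis exists, without which the trace would not be uniquely
  determined.\<close>

definition vector_measure :: "'a measure \<Rightarrow> ('a set \<Rightarrow> 'b::real_normed_vector) \<Rightarrow> bool" where
  "vector_measure M \<mu> \<longleftrightarrow>
     (\<forall>A :: nat \<Rightarrow> 'a set. range A \<subseteq> sets M \<longrightarrow> disjoint_family A \<longrightarrow>
        (\<lambda>i. \<mu> (A i)) sums \<mu> (\<Union>i. A i))"

definition measurable_partitions :: "'a measure \<Rightarrow> 'a set \<Rightarrow> (nat \<Rightarrow> 'a set) set" where
  "measurable_partitions M E =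
     {A. range A \<subseteq> sets M \<and> disjoint_family A \<and> (\<Union>i. A i) = E}"

text \<open>The supremum inside \<open>total_variation\<close>, kept as a plain set function for
  values in any normed space, so that one theory covers \<mu> and the real measures Re \<mu> and Im
  \<mu>.\<close>

definition variation :: "'a measure \<Rightarrow> ('a set \<Rightarrow> 'b::real_normed_vector) \<Rightarrow> 'a set \<Rightarrow> ennreal" where
  "variation M \<mu> E = (SUP A\<in>measurable_partitions M E. \<Sum>i. ennreal (norm (\<mu> (A i))))"

lemma vector_measureD:
  "vector_measure M \<mu> \<Longrightarrow> range A \<subseteq> sets M \<Longrightarrow> disjoint_family A \<Longrightarrow> (\<lambda>i. \<mu> (A i)) sums \<mu> (\<Union>i. A i)"
  for A :: "nat \<Rightarrow> 'a set"
  by (auto simp: vector_measure_def)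

lemma vector_measure_empty: "vector_measure M \<mu> \<Longrightarrow> \<mu> {} = 0"
proof -
  assume *: "vector_measure M \<mu>"
  have "(\<lambda>i::nat. \<mu> {}) sums \<mu> {}"
    using vector_measureD[OF *, of "\<lambda>_. {}"] by (simp add: disjoint_family_on_def)
  then have "(\<lambda>i::nat. \<mu> {}) \<longlonglongrightarrow> 0" by (auto dest: sums_summable summable_LIMSEQ_zero)
  then show ?thesis by (simp add: LIMSEQ_const_iff)
qed

lemma variation_upper:
  "A \<in> measurable_partitions M E \<Longrightarrow> (\<Sum>i. ennreal (norm (\<mu> (A i)))) \<le> variation M \<mu> E"
  unfolding variation_def by (rule SUP_upper)

lemma trivial_partition:
  "E \<in> sets M \<Longrightarrow> (\<lambda>i::nat. if i = 0 then E else {}) \<in> measurable_partitions M E"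
  by (auto simp: measurable_partitions_def disjoint_family_on_def split: if_splits)

lemma norm_le_variation:
  assumes "vector_measure M \<mu>" "E \<in> sets M"
  shows "ennreal (norm (\<mu> E)) \<le> variation M \<mu> E"
proof -
  let ?A = "\<lambda>i::nat. if i = 0 then E else {}"
  have "(\<Sum>i. ennreal (norm (\<mu> (?A i)))) = (\<Sum>i\<in>{0}. ennreal (norm (\<mu> (?A i))))"
    by (rule suminf_finite) (auto simp: vector_measure_empty[OF assms(1)])
  with variation_upper[OF trivial_partition[OF assms(2)], of \<mu>] show ?thesis by simp
qed

text \<open>Merges two countable partitions into one indexed by \<open>nat\<close>: even positions
  carry the first, odd positions the second. The partial sums of even length converge to both
  sides.\<close>

lemma suminf_interleave_ennreal:
  fixes f g :: "nat \<Rightarrow> ennreal"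
  shows "(\<Sum>i. if even i then f (i div 2) else g (i div 2)) = (\<Sum>i. f i) + (\<Sum>i. g i)"
proof -
  let ?h = "\<lambda>i. if even i then f (i div 2) else g (i div 2)"
  have "(\<lambda>n. \<Sum>i<n. ?h i) \<longlonglongrightarrow> (\<Sum>i. ?h i)" by (intro summable_LIMSEQ) auto
  then have "(\<lambda>n. \<Sum>i<2*n. ?h i) \<longlonglongrightarrow> (\<Sum>i. ?h i)"
    by (rule LIMSEQ_subseq_LIMSEQ[of _ _ "\<lambda>n. 2 * n", unfolded comp_def]) (auto simp: strict_mono_def)
  moreover have "(\<Sum>i<2*n. ?h i) = (\<Sum>i<n. f i) + (\<Sum>i<n. g i)" for n
    by (induction n) (auto simp: ac_simps)
  moreover have "(\<lambda>n. (\<Sum>i<n. f i) + (\<Sum>i<n. g i)) \<longlonglongrightarrow> (\<Sum>i. f i) + (\<Sum>i. g i)"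
    by (intro tendsto_add summable_LIMSEQ) auto
  ultimately show ?thesis by (intro LIMSEQ_unique[where X = "\<lambda>n. (\<Sum>i<n. f i) + (\<Sum>i<n. g i)"]) simp_all
qed

text \<open>Partitions of the two sets, interleaved, partition the union. The two suprema are then
  taken one after the other, which needs both sets of partitions to be nonempty.\<close>

lemma variation_superadditive:
  assumes "A \<in> sets M" "B \<in> sets M" "A \<inter> B = {}"
  shows "variation M \<mu> A + variation M \<mu> B \<le> variation M \<mu> (A \<union> B)"
proof -
  have ne: "measurable_partitions M E \<noteq> {}" if "E \<in> sets M" for E
    using trivial_partition[OF that] by blast
  have "(\<Sum>i. ennreal (norm (\<mu> (P i)))) + (\<Sum>i. ennreal (norm (\<mu> (Q i)))) \<le> variation M \<mu> (A \<union> B)"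
    if P: "P \<in> measurable_partitions M A" and Q: "Q \<in> measurable_partitions M B" for P Q
  proof -
    let ?R = "\<lambda>i. if even i then P (i div 2) else Q (i div 2)"
    have un: "(\<Union>i. ?R i) = (\<Union>i. P i) \<union> (\<Union>i. Q i)"
    proof (intro equalityI subsetI)
      fix x assume "x \<in> (\<Union>i. P i) \<union> (\<Union>i. Q i)"
      then obtain i where "x \<in> P i \<or> x \<in> Q i" by auto
      then have "x \<in> ?R (2 * i) \<or> x \<in> ?R (2 * i + 1)" by auto
      then show "x \<in> (\<Union>i. ?R i)" by blast
    qed (auto split: if_splits)
    have "disjoint_family ?R"
    proof (unfold disjoint_family_on_def, intro ballI impI)
      fix m n :: nat assume mn: "m \<noteq> n"
      have PA: "P i \<subseteq> A" "Q i \<subseteq> B" for i using P Q by (auto simp: measurable_partitions_def)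
      have d: "i \<noteq> j \<Longrightarrow> P i \<inter> P j = {}" "i \<noteq> j \<Longrightarrow> Q i \<inter> Q j = {}" for i j
        using P Q by (auto simp: measurable_partitions_def disjoint_family_on_def)
      show "?R m \<inter> ?R n = {}"
      proof (cases "even m = even n")
        case True
        then have "m div 2 \<noteq> n div 2" using mn
          by (metis div_mult_mod_eq even_iff_mod_2_eq_zero not_mod_2_eq_0_eq_1)
        then show ?thesis using True d by auto
      next
        case False
        then show ?thesis
          using PA[of "m div 2"] PA[of "n div 2"] assms(3) by (auto split: if_splits)
      qed
    qed
    then have "?R \<in> measurable_partitions M (A \<union> B)"
      using P Q un by (auto simp: measurable_partitions_def)
    then have "(\<Sum>i. ennreal (norm (\<mu> (?R i)))) \<le> variation M \<mu> (A \<union> B)" by (rule variation_upper)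
    also have "(\<lambda>i. ennreal (norm (\<mu> (?R i)))) =
        (\<lambda>i. if even i then ennreal (norm (\<mu> (P (i div 2)))) else ennreal (norm (\<mu> (Q (i div 2)))))"
      by auto
    finally show ?thesis
      using suminf_interleave_ennreal[of "\<lambda>i. ennreal (norm (\<mu> (P i)))" "\<lambda>i. ennreal (norm (\<mu> (Q i)))"] by metis
  qed
  then have "(SUP P\<in>measurable_partitions M A. (\<Sum>i. ennreal (norm (\<mu> (P i)))) + (\<Sum>i. ennreal (norm (\<mu> (Q i)))))
      \<le> variation M \<mu> (A \<union> B)" if "Q \<in> measurable_partitions M B" for Q
    using that by (intro SUP_least)
  then have "variation M \<mu> A + (\<Sum>i. ennreal (norm (\<mu> (Q i)))) \<le> variation M \<mu> (A \<union> B)"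
    if "Q \<in> measurable_partitions M B" for Q
    using that by (simp only: variation_def[of M \<mu> A] ennreal_SUP_add_left[OF ne[OF assms(1)], symmetric])
  then have "(SUP Q\<in>measurable_partitions M B. variation M \<mu> A + (\<Sum>i. ennreal (norm (\<mu> (Q i)))))
      \<le> variation M \<mu> (A \<union> B)"
    by (intro SUP_least)
  then show ?thesis
    by (simp only: variation_def[of M \<mu> B] ennreal_SUP_add_right[OF ne[OF assms(2)]])
qed

lemma variation_mono:
  assumes "A \<in> sets M" "B \<in> sets M" "A \<subseteq> B"
  shows "variation M \<mu> A \<le> variation M \<mu> B"
proof -
  have "variation M \<mu> A \<le> variation M \<mu> A + variation M \<mu> (B - A)" by simp
  also have "\<dots> \<le> variation M \<mu> (A \<union> (B - A))"
    using assms by (intro variation_superadditive) auto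
  also have "A \<union> (B - A) = B" using assms by auto
  finally show ?thesis .
qed

text \<open>Tonelli, with the inner sum read as an integral against counting measure.\<close>

lemma suminf_commute_ennreal:
  fixes f :: "nat \<Rightarrow> nat \<Rightarrow> ennreal"
  shows "(\<Sum>i. \<Sum>j. f i j) = (\<Sum>j. \<Sum>i. f i j)"
proof -
  have "(\<Sum>i. \<Sum>j. f i j) = (\<Sum>i. \<integral>\<^sup>+ j. f i j \<partial>count_space UNIV)"
    by (simp add: nn_integral_count_space_nat)
  also have "\<dots> = (\<integral>\<^sup>+ j. (\<Sum>i. f i j) \<partial>count_space UNIV)"
    by (rule nn_integral_suminf[symmetric]) auto
  finally show ?thesis by (simp add: nn_integral_count_space_nat)
qed

lemma norm_sums_le_ennreal:
  fixes f :: "nat \<Rightarrow> 'b::real_normed_vector"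
  assumes "f sums s"
  shows "ennreal (norm s) \<le> (\<Sum>i. ennreal (norm (f i)))"
proof -
  have "(\<lambda>n. norm (\<Sum>i<n. f i)) \<longlonglongrightarrow> norm s"
    using assms by (intro tendsto_norm) (simp add: sums_def)
  then have "(\<lambda>n. ennreal (norm (\<Sum>i<n. f i))) \<longlonglongrightarrow> ennreal (norm s)"
    by (rule tendsto_ennrealI)
  moreover have "ennreal (norm (\<Sum>i<n. f i)) \<le> (\<Sum>i. ennreal (norm (f i)))" for n
  proof -
    have "ennreal (norm (\<Sum>i<n. f i)) \<le> ennreal (\<Sum>i<n. norm (f i))"
      by (intro ennreal_leI norm_sum)
    also have "\<dots> = (\<Sum>i<n. ennreal (norm (f i)))" by (simp add: sum_ennreal)
    also have "\<dots> \<le> (\<Sum>i. ennreal (norm (f i)))" by (intro sum_le_suminf) auto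
    finally show ?thesis .
  qed
  ultimately show ?thesis by (intro LIMSEQ_le_const2[where X = "\<lambda>n. ennreal (norm (\<Sum>i<n. f i))"]) blast+
qed

text \<open>Superadditivity on finite unions gives one inequality. For the other, an arbitrary
  partition of the union is cut along the sets \<open>E j\<close>, and exchanging the two sums
  regroups the pieces into partitions of each \<open>E j\<close>.\<close>

lemma countably_additive_variation:
  assumes \<mu>: "vector_measure M \<mu>"
  shows "countably_additive (sets M) (variation M \<mu>)"
proof (rule countably_additiveI)
  fix E :: "nat \<Rightarrow> 'a set"
  assume E: "range E \<subseteq> sets M" "disjoint_family E" "(\<Union>i. E i) \<in> sets M"
  have "(\<Sum>j<n. variation M \<mu> (E j)) \<le> variation M \<mu> (\<Union>j<n. E j)" for n
  proof (induction n)
    case (Suc n)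
    have "(\<Sum>j<Suc n. variation M \<mu> (E j)) \<le> variation M \<mu> (\<Union>j<n. E j) + variation M \<mu> (E n)"
      using Suc by (simp add: add_right_mono)
    also have "\<dots> \<le> variation M \<mu> ((\<Union>j<n. E j) \<union> E n)"
    proof (intro variation_superadditive)
      have "E j \<inter> E n = {}" if "j < n" for j
        using E(2) that by (auto simp: disjoint_family_on_def)
      then show "(\<Union>j<n. E j) \<inter> E n = {}" by blast
    qed (use E(1) in auto)
    also have "(\<Union>j<n. E j) \<union> E n = (\<Union>j<Suc n. E j)" by (auto simp: less_Suc_eq)
    finally show ?case .
  qed simp
  then have "(\<Sum>j<n. variation M \<mu> (E j)) \<le> variation M \<mu> (\<Union>j. E j)" for n
    by (rule order_trans) (use E in \<open>auto intro!: variation_mono\<close>)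
  then have "(\<Sum>j. variation M \<mu> (E j)) \<le> variation M \<mu> (\<Union>j. E j)"
    by (intro suminf_le_const) auto
  moreover have "variation M \<mu> (\<Union>j. E j) \<le> (\<Sum>j. variation M \<mu> (E j))"
    unfolding variation_def[of M \<mu> "\<Union>j. E j"]
  proof (rule SUP_least)
    fix A assume "A \<in> measurable_partitions M (\<Union>j. E j)"
    then have A: "range A \<subseteq> sets M" "disjoint_family A" "(\<Union>i. A i) = (\<Union>j. E j)"
      by (auto simp: measurable_partitions_def)
    have "ennreal (norm (\<mu> (A i))) \<le> (\<Sum>j. ennreal (norm (\<mu> (A i \<inter> E j))))" for i
    proof -
      have "(\<Union>j. A i \<inter> E j) = A i" using A(3) by auto
      moreover have "(\<lambda>j. \<mu> (A i \<inter> E j)) sums \<mu> (\<Union>j. A i \<inter> E j)"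
        using A(1) E(1) disjoint_family_on_bisimulation[OF E(2), of "\<lambda>j. A i \<inter> E j"]
        by (intro vector_measureD[OF \<mu>]) auto
      ultimately show ?thesis by (intro norm_sums_le_ennreal) simp
    qed
    then have "(\<Sum>i. ennreal (norm (\<mu> (A i)))) \<le> (\<Sum>i. \<Sum>j. ennreal (norm (\<mu> (A i \<inter> E j))))"
      by (intro suminf_le) auto
    also have "\<dots> = (\<Sum>j. \<Sum>i. ennreal (norm (\<mu> (A i \<inter> E j))))" by (rule suminf_commute_ennreal)
    also have "\<dots> \<le> (\<Sum>j. variation M \<mu> (E j))"
    proof (intro suminf_le)
      fix j
      have "(\<lambda>i. A i \<inter> E j) \<in> measurable_partitions M (E j)"
        using A E(1) disjoint_family_on_bisimulation[OF A(2), of "\<lambda>i. A i \<inter> E j"]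
        by (auto simp: measurable_partitions_def)
      then show "(\<Sum>i. ennreal (norm (\<mu> (A i \<inter> E j)))) \<le> variation M \<mu> (E j)" by (rule variation_upper)
    qed auto
    finally show "(\<Sum>i. ennreal (norm (\<mu> (A i)))) \<le> (\<Sum>j. variation M \<mu> (E j))" .
  qed
  ultimately show "(\<Sum>j. variation M \<mu> (E j)) = variation M \<mu> (\<Union>j. E j)" by (rule antisym)
qed

lemma variation_empty:
  assumes "vector_measure M \<mu>" shows "variation M \<mu> {} = 0"
proof -
  have *: "A i = {}" if "A \<in> measurable_partitions M {}" for A and i :: nat
    using that by (auto simp: measurable_partitions_def)
  then have "(\<Sum>i. ennreal (norm (\<mu> (A i)))) = 0" if "A \<in> measurable_partitions M {}" for A
    using * [OF that] by (simp add: vector_measure_empty[OF assms])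
  then have "variation M \<mu> {} \<le> 0" unfolding variation_def
    by (intro SUP_least) (simp only: order_refl)
  then show ?thesis by simp
qed

lemma sets_total_variation [simp, measurable_cong]: "sets (total_variation M \<mu>) = sets M"
  and space_total_variation [simp]: "space (total_variation M \<mu>) = space M"
  by (simp_all add: total_variation_def)

text \<open>\<open>measure_of\<close> returns the intended set function only once it is known to be
  a measure; otherwise its value would be zero everywhere.\<close>

lemma emeasure_total_variation:
  assumes "vector_measure M \<mu>" "E \<in> sets M"
  shows "emeasure (total_variation M \<mu>) E = variation M \<mu> E"
proof -
  have "total_variation M \<mu> = measure_of (space M) (sets M) (variation M \<mu>)"
    by (simp add: total_variation_def variation_def[abs_def] measurable_partitions_def)
  then show ?thesis
    using emeasure_measure_of_sigma[OF sets.sigma_algebra_axioms _ countably_additive_variation[OF assms(1)] assms(2)]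
      variation_empty[OF assms(1)]
    by (simp add: positive_def)
qed

lemma variation_le_of_norm_le:
  assumes "\<And>A. A \<in> sets M \<Longrightarrow> norm (\<nu> A) \<le> norm (\<mu> A)"
  shows "variation M \<nu> E \<le> variation M \<mu> E"
  unfolding variation_def
proof (rule SUP_mono, intro bexI)
  fix A assume "A \<in> measurable_partitions M E"
  then show "A \<in> measurable_partitions M E" .
  then show "(\<Sum>i. ennreal (norm (\<nu> (A i)))) \<le> (\<Sum>i. ennreal (norm (\<mu> (A i))))"
    by (intro suminf_le ennreal_leI assms) (auto simp: measurable_partitions_def)
qed

section \<open>Jordan parts and integration by densities\<close>

lemma sets_positive_variation [simp, measurable_cong]: "sets (positive_variation M \<nu>) = sets M"
  and space_positive_variation [simp]: "space (positive_variation M \<nu>) = space M"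
  by (simp_all add: positive_variation_def)

text \<open>Pointwise (|\<nu>| + \<nu>) / 2 \<le> |\<nu>|. Finiteness of the variation lets the
  real-valued formula in \<open>positive_variation\<close> define a measure; it is nonnegative
  because the modulus of \<nu> on a set is at most the variation of that set.\<close>

lemma positive_variation_le:
  fixes \<nu> :: "'a set \<Rightarrow> real"
  assumes \<nu>: "vector_measure M \<nu>" and fin: "variation M \<nu> (space M) < \<infinity>" and E: "E \<in> sets M"
  shows "emeasure (positive_variation M \<nu>) E \<le> variation M \<nu> E"
proof -
  define V where "V = total_variation M \<nu>"
  have V: "emeasure V E = variation M \<nu> E" if "E \<in> sets M" for E
    using emeasure_total_variation[OF \<nu> that] by (simp add: V_def)
  interpret finite_measure V
  proof
    have "space V = space M" by (simp add: V_def)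
    then show "emeasure V (space V) \<noteq> \<infinity>"
      using fin V[OF sets.top] by simp
  qed
  have bd: "\<bar>\<nu> E\<bar> \<le> measure V E" if "E \<in> sets M" for E
    using norm_le_variation[OF \<nu> that] by (simp add: emeasure_eq_measure flip: V[OF that])
  let ?f = "\<lambda>E. ennreal ((measure V E + \<nu> E) / 2)"
  have "countably_additive (sets M) ?f"
  proof (rule countably_additiveI)
    fix A :: "nat \<Rightarrow> 'a set"
    assume A: "range A \<subseteq> sets M" "disjoint_family A" "(\<Union>i. A i) \<in> sets M"
    have "(\<lambda>i. (measure V (A i) + \<nu> (A i)) / 2) sums ((measure V (\<Union>i. A i) + \<nu> (\<Union>i. A i)) / 2)"
      using A by (intro sums_divide sums_add finite_measure_UNION vector_measureD[OF \<nu>]) (auto simp: V_def)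
    moreover have "0 \<le> (measure V (A i) + \<nu> (A i)) / 2" for i
      using bd[of "A i"] A by auto
    ultimately show "(\<Sum>i. ?f (A i)) = ?f (\<Union>i. A i)"
      by (intro suminf_ennreal_eq)
  qed
  then have "emeasure (positive_variation M \<nu>) E = ?f E"
    unfolding positive_variation_def V_def[symmetric] using E
    by (intro emeasure_measure_of_sigma sets.sigma_algebra_axioms)
       (auto simp: positive_def vector_measure_empty[OF \<nu>])
  also have "\<dots> \<le> ennreal (measure V E)" using bd[OF E] by (intro ennreal_leI) auto
  also have "\<dots> = variation M \<nu> E" using V[OF E] by (simp add: emeasure_eq_measure)
  finally show ?thesis .
qed

text \<open>The Radon-Nikodym derivative of a dominated measure has finite integral, hence is finite
  almost everywhere and can be replaced by a nonnegative real function.\<close>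

lemma density_of_dominated:
  assumes "finite_measure N" "sets P = sets N" "P \<le> N"
  obtains p :: "'a \<Rightarrow> real" where "p \<in> borel_measurable N" "\<And>x. 0 \<le> p x" "P = density N p"
proof -
  interpret N: finite_measure N by fact
  have "absolutely_continuous N P"
    unfolding absolutely_continuous_def
  proof
    fix A assume "A \<in> null_sets N"
    then show "A \<in> null_sets P"
      using le_measureD3[OF assms(3), of A] assms(2) by (simp add: null_sets_def)
  qed
  then obtain f where f: "f \<in> borel_measurable N" "density N f = P"
    using N.Radon_Nikodym assms(2) by metis
  have "(\<integral>\<^sup>+ x. f x \<partial>N) = emeasure P (space N)"
    using f by (auto simp: emeasure_density cong: nn_integral_cong)
  also have "\<dots> \<le> emeasure N (space N)" using le_measureD3[OF assms(3)] assms(2) by auto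
  also have "\<dots> < \<infinity>" by (metis N.emeasure_finite less_top infinity_ennreal_def)
  finally have "AE x in N. f x \<noteq> \<infinity>" using f by (intro nn_integral_noteq_infinite) auto
  then have "density N f = density N (\<lambda>x. ennreal (enn2real (f x)))"
    using f by (intro density_cong) (auto elim!: eventually_mono simp: ennreal_enn2real_if)
  then show ?thesis using f that[of "\<lambda>x. enn2real (f x)"] by auto
qed

text \<open>\<open>h\<close> is the difference of the densities of the two Jordan parts. Instead of
  a bound on \<open>h\<close>, integrability of \<open>W * h\<close> is obtained: each part is at
  most \<open>N\<close>, so \<open>W\<close> is integrable against it. Hence any \<open>f\<close>
  bounded by a multiple of \<open>W\<close> is integrable against both parts separately.\<close>

lemma signed_integral_density:
  fixes \<nu> :: "'a set \<Rightarrow> real"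
  assumes \<nu>: "vector_measure M \<nu>" and N: "finite_measure N" "sets N = sets M"
    and le: "\<And>E. E \<in> sets M \<Longrightarrow> variation M \<nu> E \<le> emeasure N E"
    and W: "(\<integral>\<^sup>+ x. ennreal (W x) \<partial>N) < \<infinity>" "W \<in> borel_measurable N"
    and Wpos: "\<And>x. x \<in> space N \<Longrightarrow> 0 \<le> W x"
  obtains h :: "'a \<Rightarrow> real" where "h \<in> borel_measurable N" "integrable N (\<lambda>x. W x * h x)"
    "\<And>(f::'a\<Rightarrow>complex) C. f \<in> borel_measurable N \<Longrightarrow> (\<And>x. x \<in> space N \<Longrightarrow> norm (f x) \<le> C * W x) \<Longrightarrow>
        signed_integral M \<nu> f = (\<integral>x. f x * of_real (h x) \<partial>N)"
proof -
  interpret finite_measure N by fact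
  have "emeasure N (space M) < \<infinity>"
    using emeasure_finite less_top by (metis infinity_ennreal_def)
  with le[OF sets.top] have "variation M \<nu> (space M) < \<infinity>" by (rule le_less_trans)
  moreover have neg: "vector_measure M (\<lambda>E. - \<nu> E)"
    unfolding vector_measure_def by (intro allI impI sums_minus vector_measureD[OF \<nu>])
  moreover have "variation M (\<lambda>E. - \<nu> E) = variation M \<nu>" by (simp add: variation_def[abs_def])
  ultimately have le': "positive_variation M \<nu> \<le> N" "positive_variation M (\<lambda>E. - \<nu> E) \<le> N"
    unfolding atomize_conj
  proof (intro conjI)
    assume fin: "variation M \<nu> (space M) < \<infinity>" and eq: "variation M (\<lambda>E. - \<nu> E) = variation M \<nu>"
    show "positive_variation M \<nu> \<le> N"
    proof (subst le_measure, simp add: N(2), clarify)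
      fix E assume "E \<in> sets (positive_variation M \<nu>)"
      then have E: "E \<in> sets M" by simp
      show "emeasure (positive_variation M \<nu>) E \<le> emeasure N E"
        using positive_variation_le[OF \<nu> fin E] le[OF E] by (rule order_trans)
    qed
    show "positive_variation M (\<lambda>E. - \<nu> E) \<le> N"
    proof (subst le_measure, simp add: N(2), clarify)
      fix E assume "E \<in> sets (positive_variation M (\<lambda>E. - \<nu> E))"
      then have E: "E \<in> sets M" by simp
      show "emeasure (positive_variation M (\<lambda>E. - \<nu> E)) E \<le> emeasure N E"
        using positive_variation_le[OF neg _ E, unfolded eq, OF fin] le[OF E] by (rule order_trans)
    qed
  qed
  obtain p :: "'a \<Rightarrow> real" where
    p: "p \<in> borel_measurable N" "\<And>x. 0 \<le> p x" "positive_variation M \<nu> = density N p"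
    using density_of_dominated[OF N(1) _ le'(1)] N(2) by auto
  obtain q :: "'a \<Rightarrow> real" where
    q: "q \<in> borel_measurable N" "\<And>x. 0 \<le> q x" "positive_variation M (\<lambda>E. - \<nu> E) = density N q"
    using density_of_dominated[OF N(1) _ le'(2)] N(2) by auto
  have int: "integrable N (\<lambda>x. W x * r x)"
    if r: "r \<in> borel_measurable N" "\<And>x. 0 \<le> r x" "P = density N r" "P \<le> N" for r :: "'a \<Rightarrow> real" and P
  proof -
    have "integrable P W"
    proof (rule integrableI_bounded)
      have "(\<integral>\<^sup>+ x. ennreal (norm (W x)) \<partial>P) \<le> (\<integral>\<^sup>+ x. ennreal (norm (W x)) \<partial>N)"
        using r(3,4) by (intro nn_integral_mono_measure) auto
      also have "\<dots> < \<infinity>" using W(1) Wpos by (simp cong: nn_integral_cong)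
      finally show "(\<integral>\<^sup>+ x. ennreal (norm (W x)) \<partial>P) < \<infinity>" .
      show "W \<in> borel_measurable P" using W(2) r(3) by simp
    qed
    then show ?thesis using W(2) r by (simp add: integrable_density mult.commute)
  qed
  note ip = int[OF p le'(1)] and iq = int[OF q le'(2)]
  show thesis
  proof (rule that[of "\<lambda>x. p x - q x"])
    show "(\<lambda>x. p x - q x) \<in> borel_measurable N" using p q by simp
    show "integrable N (\<lambda>x. W x * (p x - q x))"
      using Bochner_Integration.integrable_diff[OF ip iq] by (simp add: algebra_simps)
    fix f :: "'a \<Rightarrow> complex" and C
    assume f: "f \<in> borel_measurable N" "\<And>x. x \<in> space N \<Longrightarrow> norm (f x) \<le> C * W x"
    have fr: "integrable N (\<lambda>x. r x *\<^sub>R f x)"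
      if r: "r \<in> borel_measurable N" "\<And>x. 0 \<le> r x" "integrable N (\<lambda>x. W x * r x)" for r :: "'a \<Rightarrow> real"
    proof (rule Bochner_Integration.integrable_bound)
      show "integrable N (\<lambda>x. C * (W x * r x))" using r(3) by simp
      show "(\<lambda>x. r x *\<^sub>R f x) \<in> borel_measurable N" using f(1) r(1) by simp
      have "norm (r x *\<^sub>R f x) \<le> norm (C * (W x * r x))" if "x \<in> space N" for x
      proof -
        have "norm (r x *\<^sub>R f x) \<le> r x * (C * W x)" using f(2)[OF that] r(2)[of x] by (simp add: mult_left_mono)
        also have "\<dots> = C * (W x * r x)" by (simp add: mult_ac)
        finally show ?thesis by simp
      qed
      then show "AE x in N. norm (r x *\<^sub>R f x) \<le> norm (C * (W x * r x))" by (rule AE_I2)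
    qed
    have "signed_integral M \<nu> f = (\<integral>x. p x *\<^sub>R f x \<partial>N) - (\<integral>x. q x *\<^sub>R f x \<partial>N)"
      unfolding signed_integral_def p(3) q(3)
      using f p q by (simp add: integral_density)
    also have "\<dots> = (\<integral>x. p x *\<^sub>R f x - q x *\<^sub>R f x \<partial>N)"
      by (intro Bochner_Integration.integral_diff[symmetric] fr p q ip iq)
    finally show "signed_integral M \<nu> f = (\<integral>x. f x * of_real (p x - q x) \<partial>N)"
      by (simp add: scaleR_conv_of_real algebra_simps)
  qed
qed

text \<open>Takes the place of polar decomposition: the variations of Re \<mu> and Im \<mu> are at
  most |\<mu>|, and their real densities \<open>a\<close> and \<open>b\<close> combine to the
  complex density. The lower bound 1 on \<open>W\<close> yields the finiteness of |\<mu>| that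
  Radon-Nikodym asks for.\<close>

lemma complex_integral_density:
  assumes \<mu>: "complex_measure M \<mu>"
    and W: "(\<integral>\<^sup>+ x. ennreal (W x) \<partial>total_variation M \<mu>) < \<infinity>" "W \<in> borel_measurable M"
      "\<And>x. x \<in> space M \<Longrightarrow> 1 \<le> W x"
  obtains h where "h \<in> borel_measurable (total_variation M \<mu>)"
    "integrable (total_variation M \<mu>) (\<lambda>x. complex_of_real (W x) * h x)"
    "\<And>f C. f \<in> borel_measurable (total_variation M \<mu>) \<Longrightarrow> (\<And>x. x \<in> space M \<Longrightarrow> norm (f x) \<le> C * W x) \<Longrightarrow>
        complex_integral M \<mu> f = (\<integral>x. f x * h x \<partial>total_variation M \<mu>)"
proof -
  define N where "N = total_variation M \<mu>"
  have vm: "vector_measure M \<mu>" using \<mu> by (simp add: complex_measure_def vector_measure_def)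
  have sN: "sets N = sets M" "space N = space M" by (simp_all add: N_def)
  have "(\<integral>\<^sup>+ x. 1 \<partial>N) \<le> (\<integral>\<^sup>+ x. ennreal (W x) \<partial>N)"
    using W(3) by (intro nn_integral_mono) (simp add: sN)
  also have "\<dots> < \<infinity>" using W(1) by (simp add: N_def)
  finally have "emeasure N (space N) < \<infinity>" by simp
  then have N: "finite_measure N" by (intro finite_measureI) auto
  have re: "vector_measure M (\<lambda>E. Re (\<mu> E))" and im: "vector_measure M (\<lambda>E. Im (\<mu> E))"
    unfolding vector_measure_def by (intro allI impI sums_Re sums_Im vector_measureD[OF vm]; assumption)+
  have le: "variation M (\<lambda>E. Re (\<mu> E)) E \<le> emeasure N E" "variation M (\<lambda>E. Im (\<mu> E)) E \<le> emeasure N E"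
    if "E \<in> sets M" for E
    unfolding N_def emeasure_total_variation[OF vm that]
    by (rule variation_le_of_norm_le, simp add: abs_Re_le_cmod abs_Im_le_cmod)+
  have Wpos: "0 \<le> W x" if "x \<in> space N" for x using W(3)[of x] that sN by simp
  have W': "(\<integral>\<^sup>+ x. ennreal (W x) \<partial>N) < \<infinity>" "W \<in> borel_measurable N"
    using W(1,2) by (simp_all add: N_def)
  obtain a :: "'a \<Rightarrow> real" where a: "a \<in> borel_measurable N" "integrable N (\<lambda>x. W x * a x)"
    "\<And>f C. f \<in> borel_measurable N \<Longrightarrow> (\<And>x. x \<in> space N \<Longrightarrow> norm (f x) \<le> C * W x) \<Longrightarrow>
        signed_integral M (\<lambda>E. Re (\<mu> E)) f = (\<integral>x. f x * of_real (a x) \<partial>N)"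
    by (rule signed_integral_density[OF re N sN(1) le(1) W' Wpos]) blast+
  obtain b :: "'a \<Rightarrow> real" where b: "b \<in> borel_measurable N" "integrable N (\<lambda>x. W x * b x)"
    "\<And>f C. f \<in> borel_measurable N \<Longrightarrow> (\<And>x. x \<in> space N \<Longrightarrow> norm (f x) \<le> C * W x) \<Longrightarrow>
        signed_integral M (\<lambda>E. Im (\<mu> E)) f = (\<integral>x. f x * of_real (b x) \<partial>N)"
    by (rule signed_integral_density[OF im N sN(1) le(2) W' Wpos]) blast+
  have int: "integrable N (\<lambda>x. f x * complex_of_real (r x))"
    if f: "f \<in> borel_measurable N" "\<And>x. x \<in> space N \<Longrightarrow> norm (f x) \<le> C * W x"
      and r: "r \<in> borel_measurable N" "integrable N (\<lambda>x. W x * r x)" for f C r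
  proof (rule Bochner_Integration.integrable_bound)
    show "integrable N (\<lambda>x. C * (W x * r x))" using r(2) by simp
    show "(\<lambda>x. f x * complex_of_real (r x)) \<in> borel_measurable N" using f(1) r(1) by simp
    have "norm (f x * complex_of_real (r x)) \<le> norm (C * (W x * r x))" if "x \<in> space N" for x
    proof -
      have "norm (f x * complex_of_real (r x)) \<le> C * W x * \<bar>r x\<bar>"
        using f(2)[OF that] by (simp add: norm_mult mult_right_mono)
      also have "\<dots> \<le> \<bar>C * W x\<bar> * \<bar>r x\<bar>" by (intro mult_right_mono) auto
      finally show ?thesis by (simp add: abs_mult mult_ac)
    qed
    then show "AE x in N. norm (f x * complex_of_real (r x)) \<le> norm (C * (W x * r x))" by (rule AE_I2)
  qed
  show thesis
  proof (rule that[of "\<lambda>x. complex_of_real (a x) + \<i> * complex_of_real (b x)"], fold N_def)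
    show "(\<lambda>x. complex_of_real (a x) + \<i> * complex_of_real (b x)) \<in> borel_measurable N" using a b by simp
    have "integrable N (\<lambda>x. complex_of_real (W x * a x) + \<i> * complex_of_real (W x * b x))"
      using a(2) b(2) by (intro Bochner_Integration.integrable_add integrable_mult_right integrable_of_real)
    then show "integrable N (\<lambda>x. complex_of_real (W x) * (complex_of_real (a x) + \<i> * complex_of_real (b x)))"
      by (simp add: algebra_simps)
    fix f :: "'a \<Rightarrow> complex" and C
    assume f: "f \<in> borel_measurable N" "\<And>x. x \<in> space M \<Longrightarrow> norm (f x) \<le> C * W x"
    have f2: "\<And>x. x \<in> space N \<Longrightarrow> norm (f x) \<le> C * W x" using f(2) sN by simp
    show "complex_integral M \<mu> f = (\<integral>x. f x * (complex_of_real (a x) + \<i> * complex_of_real (b x)) \<partial>N)"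
      using int[OF f(1) f2 a(1,2)] int[OF f(1) f2 b(1,2)]
      by (simp add: complex_integral_def a(3)[OF f(1) f2] b(3)[OF f(1) f2] distrib_left mult.left_commute[of _ \<i>])
  qed
qed

section \<open>Area measure on the disk\<close>

text \<open>Uniqueness of Haar measure: the rotated measure is translation invariant,
  \<sigma>-finite and agrees with Lebesgue measure on disks about 0. A double integral evaluated in
  two ways shows that the measures are proportional, and the unit disk fixes the factor as
  1.\<close>

lemma lborel_distr_mult_unimodular:
  fixes \<zeta> :: complex
  assumes \<zeta>: "cmod \<zeta> = 1"
  shows "distr lborel borel ((*) \<zeta>) = lborel"
proof -
  define \<mu> where "\<mu> = distr lborel borel ((*) \<zeta>)"
  have [simp]: "\<zeta> \<noteq> 0" using \<zeta> by auto
  have sets[simp, measurable_cong]: "sets \<mu> = sets borel" by (simp add: \<mu>_def)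
  have sp[simp]: "space \<mu> = UNIV" by (simp add: \<mu>_def)
  have em: "emeasure \<mu> (ball 0 r) = emeasure lborel (ball 0 r :: complex set)" for r
  proof -
    have "(*) \<zeta> -` ball 0 r \<inter> space lborel = ball 0 r" by (auto simp: norm_mult \<zeta>)
    then show ?thesis by (simp add: \<mu>_def emeasure_distr)
  qed
  have ball_fin: "emeasure lborel (ball 0 r :: complex set) < \<infinity>" for r
    by (rule emeasure_lborel_ball_finite)
  have "sigma_finite_measure \<mu>"
  proof
    show "\<exists>A. countable A \<and> A \<subseteq> sets \<mu> \<and> \<Union> A = space \<mu> \<and> (\<forall>a\<in>A. emeasure \<mu> a \<noteq> \<infinity>)"
    proof (intro exI[of _ "range (\<lambda>n::nat. ball 0 (real n))"] conjI)
      show "\<Union> (range (\<lambda>n. ball (0::complex) (real n))) = space \<mu>"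
        by (auto intro: reals_Archimedean2)
      show "\<forall>a\<in>range (\<lambda>n. ball 0 (real n)). emeasure \<mu> a \<noteq> \<infinity>"
        using ball_fin less_top by (auto simp: em)
    qed auto
  qed
  then interpret \<mu>: sigma_finite_measure \<mu> .
  interpret pair_sigma_finite \<mu> "lborel :: complex measure" ..
  have inv: "distr \<mu> borel (\<lambda>x. x + c) = \<mu>" for c
  proof -
    \<comment> \<open>Translating by \<open>c\<close> after rotating is rotating after translating
      by \<open>c / \<zeta>\<close>.\<close>
    have "distr \<mu> borel (\<lambda>x. x + c) = distr lborel borel (\<lambda>x. \<zeta> * (c / \<zeta> + x))"
      unfolding \<mu>_def by (subst distr_distr) (auto simp: comp_def algebra_simps)
    also have "\<dots> = distr (distr lborel borel ((+) (c / \<zeta>))) borel ((*) \<zeta>)"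
      by (subst distr_distr) (auto simp: comp_def)
    finally show ?thesis by (simp add: lborel_distr_plus \<mu>_def)
  qed
  have inv': "distr lborel borel (\<lambda>x. c + x) = (lborel :: complex measure)" for c
    using lborel_distr_plus[of c] by (simp add: fun_eq_iff[symmetric])
  show ?thesis unfolding \<mu>_def[symmetric]
  proof (rule measure_eqI)
    fix A assume "A \<in> sets \<mu>"
    then have A[measurable]: "A \<in> sets borel" by simp
    define B :: "complex set" where "B = ball 0 1"
    have B[measurable]: "B \<in> sets borel" by (simp add: B_def)
    \<comment> \<open>Integrating over \<open>y\<close> first uses invariance of Lebesgue measure
      and gives \<open>\<mu>\<close>-measure of \<open>B\<close> times Lebesgue measure of
      \<open>A\<close>.\<close>
    have "(\<integral>\<^sup>+ y. (\<integral>\<^sup>+ x. indicator A (x + y) * indicator B x \<partial>\<mu>) \<partial>lborel) =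
        (\<integral>\<^sup>+ x. (\<integral>\<^sup>+ y. indicator A (x + y) * indicator B x \<partial>lborel) \<partial>\<mu>)"
      using Fubini[of "\<lambda>(x, y). indicator A (x + y) * indicator B x"] by simp
    also have "\<dots> = (\<integral>\<^sup>+ x. indicator B x * emeasure lborel A \<partial>\<mu>)"
    proof (intro nn_integral_cong)
      fix x
      have "(\<integral>\<^sup>+ y. indicator A (x + y) \<partial>lborel) = (\<integral>\<^sup>+ y. indicator A y \<partial>distr lborel borel (\<lambda>y. x + y))"
        by (subst nn_integral_distr) auto
      also have "\<dots> = emeasure lborel A" by (simp add: inv')
      finally show "(\<integral>\<^sup>+ y. indicator A (x + y) * indicator B x \<partial>lborel) = indicator B x * emeasure lborel A"
        by (simp add: nn_integral_cmult mult.commute[of "indicator A _"])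
    qed
    also have "\<dots> = emeasure \<mu> B * emeasure lborel A" by (simp add: nn_integral_multc)
    finally have 1: "(\<integral>\<^sup>+ y. (\<integral>\<^sup>+ x. indicator A (x + y) * indicator B x \<partial>\<mu>) \<partial>lborel) =
        emeasure \<mu> B * emeasure lborel A" .
    \<comment> \<open>Invariance of \<open>\<mu>\<close> moves the shift onto \<open>B\<close>; by
      symmetry of the disk \<open>B\<close> about 0 this gives the product with the two measures
      exchanged.\<close>
    have "(\<integral>\<^sup>+ y. (\<integral>\<^sup>+ x. indicator A (x + y) * indicator B x \<partial>\<mu>) \<partial>lborel) =
        (\<integral>\<^sup>+ y. (\<integral>\<^sup>+ x. indicator A x * indicator B (x - y) \<partial>\<mu>) \<partial>lborel)"
    proof (rule nn_integral_cong)
      fix y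
      have "(\<integral>\<^sup>+ x. indicator A x * indicator B (x - y) \<partial>distr \<mu> borel (\<lambda>x. x + y)) =
          (\<integral>\<^sup>+ x. indicator A (x + y) * indicator B x \<partial>\<mu>)"
        by (subst nn_integral_distr) auto
      then show "(\<integral>\<^sup>+ x. indicator A (x + y) * indicator B x \<partial>\<mu>) = (\<integral>\<^sup>+ x. indicator A x * indicator B (x - y) \<partial>\<mu>)"
        by (simp add: inv)
    qed
    also have "\<dots> = (\<integral>\<^sup>+ x. (\<integral>\<^sup>+ y. indicator A x * indicator B (x - y) \<partial>lborel) \<partial>\<mu>)"
      using Fubini[of "\<lambda>(x, y). indicator A x * indicator B (x - y)"] by simp
    also have "\<dots> = (\<integral>\<^sup>+ x. indicator A x * emeasure lborel B \<partial>\<mu>)"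
    proof (intro nn_integral_cong)
      fix x
      have "(\<integral>\<^sup>+ y. indicator B (x - y) \<partial>lborel) = (\<integral>\<^sup>+ y. indicator B (x - y) \<partial>distr lborel borel (\<lambda>y. x + y))"
        by (simp add: inv')
      also have "\<dots> = (\<integral>\<^sup>+ y. indicator B (- y) \<partial>lborel)"
        by (subst nn_integral_distr) auto
      also have "\<dots> = (\<integral>\<^sup>+ y. indicator B y \<partial>lborel)"
        by (intro nn_integral_cong) (auto simp: B_def indicator_def)
      also have "\<dots> = emeasure lborel B" by simp
      finally show "(\<integral>\<^sup>+ y. indicator A x * indicator B (x - y) \<partial>lborel) = indicator A x * emeasure lborel B"
        by (simp add: nn_integral_cmult)
    qed
    also have "\<dots> = emeasure \<mu> A * emeasure lborel B" by (simp add: nn_integral_multc)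
    finally have "emeasure lborel B * emeasure \<mu> A = emeasure lborel B * emeasure lborel A"
      using 1 em[of 1] by (simp add: B_def mult.commute)
    moreover have "emeasure lborel B \<noteq> 0"
      using content_ball_gt_0_iff[of "0::complex" 1] by (auto simp: B_def measure_def)
    moreover have "emeasure lborel B \<noteq> \<infinity>" using ball_fin[of 1] by (auto simp: B_def)
    ultimately show "emeasure \<mu> A = emeasure lborel A"
      by (metis ennreal_mult_cancel_left infinity_ennreal_def)
  qed simp
qed

section \<open>Normalized area, rotations and radial integration\<close>

lemma space_disk_area [simp]: "space disk_area = unit_disk"
  and sets_disk_area: "sets disk_area = sets (restrict_space borel unit_disk)"
  by (simp_all add: disk_area_def space_scale_measure space_restrict_space sets_restrict_space)

lemma sets_disk_borel: "sets disk_borel = sets (restrict_space borel unit_disk)"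
  and space_disk_borel [simp]: "space disk_borel = unit_disk"
  by (simp_all add: disk_borel_def space_restrict_space)

lemma sets_disk_area_iff: "A \<in> sets disk_area \<longleftrightarrow> A \<in> sets borel \<and> A \<subseteq> unit_disk"
  unfolding sets_disk_area by (subst sets_restrict_space_iff) auto

lemma emeasure_disk_area:
  assumes "A \<in> sets disk_area"
  shows "emeasure disk_area A = ennreal (1 / pi) * emeasure lborel A"
  using assms unfolding disk_area_def
  by (simp add: emeasure_restrict_space sets_restrict_space_iff)

lemma emeasure_lborel_disk: "0 \<le> r \<Longrightarrow> emeasure lborel (ball 0 r :: complex set) = ennreal (pi * r\<^sup>2)"
  by (simp add: emeasure_ball unit_ball_vol_2)

lemma emeasure_disk_area_ball: 
  assumes "0 \<le> r" "r \<le> 1"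
  shows "emeasure disk_area (ball 0 r) = ennreal (r\<^sup>2)"
proof -
  have "emeasure disk_area (ball 0 r) = ennreal (1 / pi) * ennreal (pi * r\<^sup>2)"
    using assms by (subst emeasure_disk_area) (auto simp: sets_disk_area_iff emeasure_lborel_disk)
  then show ?thesis by (simp flip: ennreal_mult)
qed

interpretation disk_area: finite_measure disk_area
  by (rule finite_measureI) (simp add: emeasure_disk_area_ball)

lemma measurable_disk_area_ident [measurable]: "(\<lambda>z. z) \<in> disk_area \<rightarrow>\<^sub>M borel"
  by (rule measurableI) (auto simp: sets_disk_area_iff)

lemma borel_measurable_disk_continuous:
  assumes "sets M = sets disk_borel" "continuous_on unit_disk (f :: complex \<Rightarrow> 'b::topological_space)"
  shows "f \<in> borel_measurable M"
proof -
  have "f \<in> borel_measurable (restrict_space borel unit_disk)"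
    using assms(2) by (rule borel_measurable_continuous_on_restrict)
  then show ?thesis using assms(1) sets_disk_borel measurable_cong_sets by blast
qed

lemma sets_disk_area_borel: "sets disk_area = sets disk_borel"
  by (simp add: sets_disk_area sets_disk_borel)

lemma measurable_rotation:
  assumes \<zeta>: "cmod \<zeta> = 1" shows "(*) \<zeta> \<in> disk_area \<rightarrow>\<^sub>M disk_area"
proof (rule measurableI)
  fix A assume "A \<in> sets disk_area"
  then have A: "A \<in> sets borel" "A \<subseteq> unit_disk" by (auto simp: sets_disk_area_iff)
  have "(*) \<zeta> -` A \<in> sets borel" using measurable_sets[of "(*) \<zeta>" borel borel A] A(1) by simp
  moreover have "(*) \<zeta> -` A \<subseteq> unit_disk" using A(2) \<zeta> by (auto simp: norm_mult)
  ultimately show "(*) \<zeta> -` A \<inter> space disk_area \<in> sets disk_area" by (auto simp: sets_disk_area_iff)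
qed (auto simp: norm_mult \<zeta>)

lemma borel_measurable_indicator_ball:
  "r \<le> 1 \<Longrightarrow> (indicator (ball 0 r) :: complex \<Rightarrow> complex) \<in> borel_measurable disk_area"
  by (intro borel_measurable_indicator) (auto simp: sets_disk_area_iff)

lemma disk_area_rotation:
  assumes \<zeta>: "cmod \<zeta> = 1"
  shows "distr disk_area disk_area ((*) \<zeta>) = disk_area"
proof (rule measure_eqI)
  note meas = measurable_rotation[OF \<zeta>]
  fix A assume "A \<in> sets (distr disk_area disk_area ((*) \<zeta>))"
  then have A': "A \<in> sets disk_area" by simp
  then have A: "A \<in> sets borel" "A \<subseteq> unit_disk" by (auto simp: sets_disk_area_iff)
  have eq: "(*) \<zeta> -` A \<inter> unit_disk = (*) \<zeta> -` A" using A(2) \<zeta> by (auto simp: norm_mult)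
  have "emeasure (distr disk_area disk_area ((*) \<zeta>)) A = emeasure disk_area ((*) \<zeta> -` A)"
    using meas A' by (simp add: emeasure_distr eq)
  also have "\<dots> = ennreal (1 / pi) * emeasure lborel ((*) \<zeta> -` A)"
    using measurable_sets[OF meas A'] by (intro emeasure_disk_area) (simp add: eq)
  also have "emeasure lborel ((*) \<zeta> -` A) = emeasure (distr lborel borel ((*) \<zeta>)) A"
    using A(1) by (simp add: emeasure_distr)
  finally show "emeasure (distr disk_area disk_area ((*) \<zeta>)) A = emeasure disk_area A"
    using A' by (simp add: lborel_distr_mult_unimodular[OF \<zeta>] emeasure_disk_area)
qed simp

lemma integral_disk_area_rotation:
  fixes f :: "complex \<Rightarrow> complex"
  assumes \<zeta>: "cmod \<zeta> = 1" and f: "f \<in> borel_measurable disk_area"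
  shows "(\<integral>z. f (\<zeta> * z) \<partial>disk_area) = (\<integral>z. f z \<partial>disk_area)"
proof -
  note meas = measurable_rotation[OF \<zeta>]
  have "(\<integral>z. f z \<partial>distr disk_area disk_area ((*) \<zeta>)) = (\<integral>z. f (\<zeta> * z) \<partial>disk_area)"
    using meas f by (rule integral_distr)
  then show ?thesis by (simp add: disk_area_rotation[OF \<zeta>])
qed

text \<open>Replaces polar coordinates: the disk of radius sqrt x has normalized area x, so |z|^2 is
  uniformly distributed on (0, 1). Comparing half-lines suffices.\<close>

lemma disk_area_radial:
  "distr disk_area borel (\<lambda>z. (cmod z)\<^sup>2) = density lborel (indicator {0<..<1})"
proof (rule measure_eqI_lessThan)
  have pre: "(\<lambda>z. (cmod z)\<^sup>2) -` {x<..} \<inter> space disk_area = unit_disk - {z. (cmod z)\<^sup>2 \<le> x}" for x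
    by auto
  fix x :: real
  have 1: "emeasure (distr disk_area borel (\<lambda>z. (cmod z)\<^sup>2)) {x<..} =
      emeasure disk_area (unit_disk - {z. (cmod z)\<^sup>2 \<le> x})"
    by (subst emeasure_distr, simp, simp, simp only: pre)
  have 2: "emeasure (density lborel (indicator {0<..<1})) {x<..} = emeasure lborel ({0<..<1} \<inter> {x<..})"
    by (subst emeasure_density) (auto simp flip: indicator_inter_arith)
  show "emeasure (distr disk_area borel (\<lambda>z. (cmod z)\<^sup>2)) {x<..} < \<infinity>"
    unfolding 1 using disk_area.emeasure_finite less_top by (metis infinity_ennreal_def)
  consider "x < 0" | "0 \<le> x" "x < 1" | "1 \<le> x" by linarith
  then show "emeasure (distr disk_area borel (\<lambda>z. (cmod z)\<^sup>2)) {x<..} =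
      emeasure (density lborel (indicator {0<..<1})) {x<..}"
  proof cases
    case 1
    then have "unit_disk - {z. (cmod z)\<^sup>2 \<le> x} = ball 0 1" "{0<..<1} \<inter> {x<..} = {0<..<1}"
      using zero_le_power2[of "cmod _"] by (auto simp: not_le intro: less_le_trans) (metis less_le_trans linorder_not_less zero_le_power2)
    then show ?thesis by (simp add: \<open>emeasure _ _ = emeasure disk_area _\<close> 2 emeasure_disk_area_ball)
  next
    case 2
    have "{z. (cmod z)\<^sup>2 \<le> x} = cball 0 (sqrt x)"
      using 2 by (auto simp: real_le_rsqrt sqrt_ge_absD real_sqrt_pow2 dest: power_mono[of _ "sqrt x" 2])
    moreover have "emeasure disk_area (cball 0 (sqrt x)) = ennreal x"
    proof -
      have "sqrt x < 1" using 2 by simp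
      then have sub: "cball 0 (sqrt x) \<subseteq> ball (0::complex) 1"
        by (intro subsetI) (metis le_less_trans mem_ball mem_cball)
      have "emeasure disk_area (cball 0 (sqrt x)) = ennreal (1 / pi) * ennreal (pi * x)"
        using 2 sub by (subst emeasure_disk_area) (simp_all add: sets_disk_area_iff emeasure_cball unit_ball_vol_2)
      then show ?thesis using 2 by (simp flip: ennreal_mult)
    qed
    moreover have "cball 0 (sqrt x) \<subseteq> unit_disk"
    proof -
      have "sqrt x < 1" using 2 by simp
      then show ?thesis by (intro subsetI) (metis le_less_trans mem_ball mem_cball)
    qed
    moreover have "ennreal 1 - ennreal x = ennreal (1 - x)" using 2 by (intro ennreal_minus) auto
    moreover have "{0<..<1} \<inter> {x<..} = {x<..<1}" using 2 by auto
    ultimately show ?thesis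
      unfolding 1 \<open>emeasure (density _ _) _ = _\<close> using 2
      by (subst emeasure_Diff) (simp_all add: sets_disk_area_iff emeasure_disk_area_ball)
  next
    case 3
    then have "unit_disk - {z. (cmod z)\<^sup>2 \<le> x} = {}" "{0<..<1} \<inter> {x<..} = {}"
      using power_le_one[of "cmod _" 2] by (auto simp: not_le) (smt (verit) norm_ge_zero power_le_one)
    then show ?thesis by (simp only: \<open>emeasure _ _ = emeasure disk_area _\<close> 2 emeasure_empty)
  qed
qed auto

text \<open>The indicator restricts to a subdisk. For radius below 1 every holomorphic function is
  bounded there, so Taylor series can be integrated termwise against this formula.\<close>

lemma integral_disk_monomials:
  assumes r: "0 \<le> r" "r \<le> 1"
  shows "(\<integral>z. indicator (ball 0 r) z * (z ^ n * cnj z ^ m) \<partial>disk_area) =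
    (if n = m then of_real (r ^ (2 * n + 2) / (real n + 1)) else (0::complex))"
proof (cases "n = m")
  case False
  \<comment> \<open>\<open>\<zeta>\<close> is chosen with \<zeta>^(n - m) = -1: rotation by it
    changes the sign of the integrand, so the integral equals its own negative. The difference is a
    real number because it may be negative.\<close>
  define d where "d = real n - real m"
  define \<zeta> where "\<zeta> = cis (pi / d)"
  have \<zeta>: "cmod \<zeta> = 1" by (simp add: \<zeta>_def)
  have "d \<noteq> 0" using False by (simp add: d_def)
  have "\<zeta> ^ n * cnj \<zeta> ^ m = cis (real n * (pi / d)) * cis (- (real m * (pi / d)))"
  proof -
    have "\<zeta> ^ n = cis (real n * (pi / d))" unfolding \<zeta>_def by (rule Complex.DeMoivre)
    moreover have "cnj \<zeta> ^ m = cis (real m * (- (pi / d)))" unfolding \<zeta>_def cis_cnj by (rule Complex.DeMoivre)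
    ultimately show ?thesis by simp
  qed
  also have "\<dots> = cis (d * (pi / d))" by (simp add: cis_mult d_def algebra_simps diff_divide_distrib)
  also have "\<dots> = -1" using \<open>d \<noteq> 0\<close> by (simp add: cis_pi)
  finally have z: "\<zeta> ^ n * cnj \<zeta> ^ m = -1" .
  let ?f = "\<lambda>z. indicator (ball 0 r) z * (z ^ n * cnj z ^ m) :: complex"
  have eq: "?f (\<zeta> * z) = - ?f z" for z
  proof -
    have "indicator (ball 0 r) (\<zeta> * z) = (indicator (ball 0 r) z :: complex)"
      by (auto simp: indicator_def norm_mult \<zeta>)
    moreover have "(\<zeta> * z) ^ n * cnj (\<zeta> * z) ^ m = (\<zeta> ^ n * cnj \<zeta> ^ m) * (z ^ n * cnj z ^ m)"
      by (simp add: power_mult_distrib mult_ac)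
    ultimately show ?thesis by (simp add: z)
  qed
  have "(\<lambda>z. z ^ n * cnj z ^ m) \<in> borel_measurable borel"
    by (intro borel_measurable_continuous_onI continuous_intros)
  then have "?f \<in> borel_measurable borel"
    by (rule borel_measurable_times[OF borel_measurable_indicator, rotated]) auto
  then have "?f \<in> borel_measurable disk_area"
    by (rule measurable_compose[OF measurable_disk_area_ident])
  then have "(\<integral>z. ?f (\<zeta> * z) \<partial>disk_area) = (\<integral>z. ?f z \<partial>disk_area)"
    by (rule integral_disk_area_rotation[OF \<zeta>])
  then have "- (\<integral>z. ?f z \<partial>disk_area) = (\<integral>z. ?f z \<partial>disk_area)"
    unfolding eq by simp
  then show ?thesis using False by simp
next
  case True
  let ?g = "\<lambda>t::real. indicator {0<..<r\<^sup>2} t * t ^ n"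
  \<comment> \<open>On the diagonal the integrand depends on |z|^2 only, and the integral becomes
    that of t^n from 0 to r^2.\<close>
  have rw: "indicator (ball 0 r) z * (z ^ n * cnj z ^ n) = complex_of_real (indicator {t. t < r\<^sup>2} ((cmod z)\<^sup>2) * ((cmod z)\<^sup>2) ^ n)" for z
  proof -
    have "(cmod z < r) = ((cmod z)\<^sup>2 < r\<^sup>2)" 
    proof
      show "cmod z < r \<Longrightarrow> (cmod z)\<^sup>2 < r\<^sup>2" by (intro power_strict_mono) auto
      show "(cmod z)\<^sup>2 < r\<^sup>2 \<Longrightarrow> cmod z < r" by (rule power2_less_imp_less) (use r in auto)
    qed
    moreover have "z ^ n * cnj z ^ n = complex_of_real (((cmod z)\<^sup>2) ^ n)"
      by (simp only: of_real_power[of _ n] complex_norm_square power_mult_distrib)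
    ultimately show ?thesis by (auto simp: indicator_def)
  qed
  have "(\<integral>z. indicator (ball 0 r) z * (z ^ n * cnj z ^ n) \<partial>disk_area) =
      complex_of_real (\<integral>z. indicator {t. t < r\<^sup>2} ((cmod z)\<^sup>2) * ((cmod z)\<^sup>2) ^ n \<partial>disk_area)"
    unfolding rw by (rule integral_complex_of_real)
  also have "(\<integral>z. indicator {t. t < r\<^sup>2} ((cmod z)\<^sup>2) * ((cmod z)\<^sup>2) ^ n \<partial>disk_area) =
      (\<integral>t. indicator {t. t < r\<^sup>2} t * t ^ n \<partial>distr disk_area borel (\<lambda>z. (cmod z)\<^sup>2))"
    by (subst integral_distr) auto
  also have "\<dots> = (\<integral>t. ?g t \<partial>lborel)"
  proof -
    have "(\<integral>t. indicator {t. t < r\<^sup>2} t * t ^ n \<partial>density lborel (\<lambda>t. ennreal (indicator {0<..<1} t))) =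
        (\<integral>t. indicator {0<..<1} t *\<^sub>R (indicator {t. t < r\<^sup>2} t * t ^ n) \<partial>lborel)"
      by (intro integral_density) auto
    also have "\<dots> = (\<integral>t. ?g t \<partial>lborel)"
    proof (intro Bochner_Integration.integral_cong refl)
      fix t :: real
      have "r\<^sup>2 \<le> 1" using r by (simp add: power_le_one)
      then show "indicator {0<..<1} t *\<^sub>R (indicator {t. t < r\<^sup>2} t * t ^ n) = ?g t"
        by (auto simp: indicator_def)
    qed
    finally show ?thesis by (simp add: disk_area_radial ennreal_indicator)
  qed
  also have "\<dots> = (\<integral>t. t ^ n * indicator {0..r\<^sup>2} t \<partial>lborel)"
  proof (rule integral_cong_AE)
    have "AE t in lborel. t \<noteq> (0::real)" "AE t in lborel. t \<noteq> r\<^sup>2" by (rule AE_lborel_singleton)+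
    then show "AE t in lborel. ?g t = t ^ n * indicator {0..r\<^sup>2} t"
      by eventually_elim (auto simp: indicator_def)
  qed auto
  also have "\<dots> = ((r\<^sup>2) ^ Suc n - 0 ^ Suc n) / Suc n"
    by (rule integral_power) simp
  also have "((r\<^sup>2) ^ Suc n - 0 ^ Suc n) / Suc n = r ^ (2 * n + 2) / (real n + 1)"
  proof -
    have "(r\<^sup>2) ^ Suc n = r ^ (2 * Suc n)" by (rule power_mult[symmetric])
    moreover have "2 * Suc n = 2 * n + 2" by simp
    ultimately show ?thesis by (simp only: of_nat_Suc) (simp add: add.commute)
  qed
  finally show ?thesis using True by (simp only: if_True refl)
qed

section \<open>The Bergman space as an inner product space\<close>

lemma bergman_holomorphic: "f \<in> bergman \<Longrightarrow> f holomorphic_on unit_disk"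
  and bergman_integrable: "f \<in> bergman \<Longrightarrow> integrable disk_area (\<lambda>z. (cmod (f z))\<^sup>2)"
  and bergman_outside: "f \<in> bergman \<Longrightarrow> z \<notin> unit_disk \<Longrightarrow> f z = 0"
  by (auto simp: bergman_def)

lemma holomorphic_measurable_disk_area:
  "f holomorphic_on unit_disk \<Longrightarrow> f \<in> borel_measurable disk_area"
  by (intro borel_measurable_disk_continuous holomorphic_on_imp_continuous_on sets_disk_area_borel)

lemma bergman_measurable: "f \<in> bergman \<Longrightarrow> f \<in> borel_measurable disk_area"
  by (intro holomorphic_measurable_disk_area bergman_holomorphic)

lemma borel_measurable_cnj:
  assumes "f \<in> borel_measurable M" shows "(\<lambda>z. cnj (f z)) \<in> borel_measurable M"
proof -
  have "cnj \<in> borel_measurable borel"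
    by (intro borel_measurable_continuous_onI continuous_on_cnj continuous_on_id)
  then show ?thesis by (rule measurable_compose[OF assms])
qed

lemma bergman_zero [simp]: "(\<lambda>_. 0) \<in> bergman"
  by (simp add: bergman_def)

lemma bergman_mult_integrable:
  assumes "f \<in> bergman" "g \<in> bergman"
  shows "integrable disk_area (\<lambda>z. f z * cnj (g z))"
proof (rule Bochner_Integration.integrable_bound)
  show "integrable disk_area (\<lambda>z. (cmod (f z))\<^sup>2 + (cmod (g z))\<^sup>2)"
    using assms by (intro Bochner_Integration.integrable_add bergman_integrable)
  show "(\<lambda>z. f z * cnj (g z)) \<in> borel_measurable disk_area"
    using bergman_measurable[OF assms(1)] borel_measurable_cnj[OF bergman_measurable[OF assms(2)]] by simp
  have "cmod (f z) * cmod (g z) \<le> (cmod (f z))\<^sup>2 + (cmod (g z))\<^sup>2" for z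
  proof -
    have "2 * cmod (f z) * cmod (g z) \<le> (cmod (f z))\<^sup>2 + (cmod (g z))\<^sup>2" by (rule sum_squares_bound)
    moreover have "0 \<le> cmod (f z) * cmod (g z)" by simp
    ultimately show ?thesis by linarith
  qed
  then show "AE z in disk_area. norm (f z * cnj (g z)) \<le> norm ((cmod (f z))\<^sup>2 + (cmod (g z))\<^sup>2)"
    by (intro AE_I2) (simp add: norm_mult)
qed

lemma bergman_lincomb:
  assumes "f \<in> bergman" "g \<in> bergman"
  shows "(\<lambda>z. a * f z + b * g z) \<in> bergman"
  unfolding bergman_def
proof (intro CollectI conjI allI impI)
  show h: "(\<lambda>z. a * f z + b * g z) holomorphic_on unit_disk"
    using assms by (intro holomorphic_intros bergman_holomorphic)
  show "integrable disk_area (\<lambda>z. (cmod (a * f z + b * g z))\<^sup>2)"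
  proof (rule Bochner_Integration.integrable_bound)
    show "integrable disk_area (\<lambda>z. 2 * (cmod a)\<^sup>2 * (cmod (f z))\<^sup>2 + 2 * (cmod b)\<^sup>2 * (cmod (g z))\<^sup>2)"
      using assms by (intro Bochner_Integration.integrable_add integrable_mult_right bergman_integrable)
    show "(\<lambda>z. (cmod (a * f z + b * g z))\<^sup>2) \<in> borel_measurable disk_area"
      using holomorphic_measurable_disk_area[OF h] by simp
    have "(cmod (a * f z + b * g z))\<^sup>2 \<le> 2 * (cmod a)\<^sup>2 * (cmod (f z))\<^sup>2 + 2 * (cmod b)\<^sup>2 * (cmod (g z))\<^sup>2" for z
    proof -
      have "(cmod (a * f z + b * g z))\<^sup>2 \<le> (cmod (a * f z) + cmod (b * g z))\<^sup>2"
        by (intro power_mono norm_triangle_ineq) simp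
      also have "\<dots> \<le> 2 * (cmod (a * f z))\<^sup>2 + 2 * (cmod (b * g z))\<^sup>2"
        using sum_squares_bound[of "cmod (a * f z)" "cmod (b * g z)"] by (simp add: power2_sum)
      finally show ?thesis by (simp add: norm_mult power_mult_distrib)
    qed
    then show "AE z in disk_area. norm ((cmod (a * f z + b * g z))\<^sup>2) \<le>
        norm (2 * (cmod a)\<^sup>2 * (cmod (f z))\<^sup>2 + 2 * (cmod b)\<^sup>2 * (cmod (g z))\<^sup>2)"
      by (intro AE_I2) simp
  qed
  show "a * f z + b * g z = 0" if "z \<notin> unit_disk" for z
    using bergman_outside[OF assms(1) that] bergman_outside[OF assms(2) that] by simp
qed

lemma bergman_scale: "f \<in> bergman \<Longrightarrow> (\<lambda>z. a * f z) \<in> bergman"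
  using bergman_lincomb[of f f a 0] by simp

lemma bergman_add: "f \<in> bergman \<Longrightarrow> g \<in> bergman \<Longrightarrow> (\<lambda>z. f z + g z) \<in> bergman"
  using bergman_lincomb[of f g 1 1] by simp

lemma bergman_diff: "f \<in> bergman \<Longrightarrow> g \<in> bergman \<Longrightarrow> (\<lambda>z. f z - g z) \<in> bergman"
  using bergman_lincomb[of f g 1 "-1"] by simp

lemma bergman_sum:
  "(\<And>i. i \<in> I \<Longrightarrow> f i \<in> bergman) \<Longrightarrow> (\<lambda>z. \<Sum>i\<in>I. c i * f i z) \<in> bergman"
proof (induction I rule: infinite_finite_induct)
  case (insert x I)
  then show ?case using bergman_lincomb[of "f x" "\<lambda>z. \<Sum>i\<in>I. c i * f i z" "c x" 1] by simp
qed simp_all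

lemma bergman_inner_lincomb:
  assumes "f \<in> bergman" "g \<in> bergman" "h \<in> bergman"
  shows "bergman_inner (\<lambda>z. a * f z + b * g z) h = a * bergman_inner f h + b * bergman_inner g h"
proof -
  have "(\<lambda>z. (a * f z + b * g z) * cnj (h z)) = (\<lambda>z. a * (f z * cnj (h z)) + b * (g z * cnj (h z)))"
    by (simp add: algebra_simps)
  then show ?thesis
    unfolding bergman_inner_def
    using bergman_mult_integrable[OF assms(1,3)] bergman_mult_integrable[OF assms(2,3)] by simp
qed

lemma bergman_inner_commute: "bergman_inner f g = cnj (bergman_inner g f)"
  unfolding bergman_inner_def by (subst Bochner_Integration.integral_cnj[symmetric]) (simp add: mult.commute del: Bochner_Integration.integral_cnj)

lemma bergman_inner_scale: "bergman_inner (\<lambda>z. a * f z) g = a * bergman_inner f g"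
proof -
  have "(\<lambda>z. a * f z * cnj (g z)) = (\<lambda>z. a * (f z * cnj (g z)))" by (simp add: mult_ac)
  then show ?thesis by (simp add: bergman_inner_def)
qed

lemma bergman_inner_scale_right: "bergman_inner f (\<lambda>z. a * g z) = cnj a * bergman_inner f g"
  by (subst (1 2) bergman_inner_commute) (simp add: bergman_inner_scale)

lemma bergman_inner_diff:
  "f \<in> bergman \<Longrightarrow> g \<in> bergman \<Longrightarrow> h \<in> bergman \<Longrightarrow>
    bergman_inner (\<lambda>z. f z - g z) h = bergman_inner f h - bergman_inner g h"
  using bergman_inner_lincomb[of f g h 1 "-1"] by simp

lemma bergman_inner_lincomb_right:
  "f \<in> bergman \<Longrightarrow> g \<in> bergman \<Longrightarrow> h \<in> bergman \<Longrightarrow>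
    bergman_inner h (\<lambda>z. a * f z + b * g z) = cnj a * bergman_inner h f + cnj b * bergman_inner h g"
  by (subst (1 2 3) bergman_inner_commute) (simp add: bergman_inner_lincomb)

lemma bergman_inner_zero [simp]: "bergman_inner (\<lambda>_. 0) g = 0" "bergman_inner f (\<lambda>_. 0) = 0"
  by (simp_all add: bergman_inner_def)

lemma bergman_inner_sum:
  assumes "\<And>i. i \<in> I \<Longrightarrow> f i \<in> bergman" "h \<in> bergman"
  shows "bergman_inner (\<lambda>z. \<Sum>i\<in>I. c i * f i z) h = (\<Sum>i\<in>I. c i * bergman_inner (f i) h)"
  using assms(1)
proof (induction I rule: infinite_finite_induct)
  case (insert x I)
  then show ?case
    using bergman_inner_lincomb[of "f x" "\<lambda>z. \<Sum>i\<in>I. c i * f i z" h "c x" 1] bergman_sum[of I f c] assms(2)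
    by simp
qed simp_all

lemma bergman_inner_sum_right:
  assumes "\<And>i. i \<in> I \<Longrightarrow> f i \<in> bergman" "h \<in> bergman"
  shows "bergman_inner h (\<lambda>z. \<Sum>i\<in>I. c i * f i z) = (\<Sum>i\<in>I. cnj (c i) * bergman_inner h (f i))"
proof -
  have "bergman_inner h (\<lambda>z. \<Sum>i\<in>I. c i * f i z) = cnj (\<Sum>i\<in>I. c i * bergman_inner (f i) h)"
    by (subst bergman_inner_commute) (simp only: bergman_inner_sum[OF assms])
  also have "\<dots> = (\<Sum>i\<in>I. cnj (c i) * bergman_inner h (f i))"
    by (simp add: bergman_inner_commute[of h])
  finally show ?thesis .
qed

lemma bergman_norm_nonneg [simp]: "0 \<le> bergman_norm f"
  by (simp add: bergman_norm_def)

lemma bergman_norm_square: "(bergman_norm f)\<^sup>2 = (\<integral>z. (cmod (f z))\<^sup>2 \<partial>disk_area)"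
  by (simp add: bergman_norm_def)

lemma bergman_inner_self: "bergman_inner f f = of_real ((bergman_norm f)\<^sup>2)"
proof -
  have "bergman_inner f f = (\<integral>z. complex_of_real ((cmod (f z))\<^sup>2) \<partial>disk_area)"
    unfolding bergman_inner_def by (simp only: complex_norm_square)
  then show ?thesis by (simp only: integral_complex_of_real bergman_norm_square)
qed

lemma bergman_norm_zero [simp]: "bergman_norm (\<lambda>_. 0) = 0"
  by (simp add: bergman_norm_def)

text \<open>Serves three times: with the coefficient of the projection it gives Cauchy-Schwarz, with
  \<open>a = 1\<close> the triangle inequality, with small real \<open>a\<close> the variation of
  the norm at a maximizer.\<close>

lemma bergman_norm_square_add:
  assumes "f \<in> bergman" "g \<in> bergman"
  shows "(bergman_norm (\<lambda>z. f z + a * g z))\<^sup>2 =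
    (bergman_norm f)\<^sup>2 + 2 * Re (cnj a * bergman_inner f g) + (cmod a)\<^sup>2 * (bergman_norm g)\<^sup>2"
proof -
  have ag: "(\<lambda>z. a * g z) \<in> bergman" using assms by (intro bergman_scale)
  note fag = bergman_add[OF assms(1) ag]
  define F where "F = (\<lambda>z. f z + a * g z)"
  have F: "F \<in> bergman" unfolding F_def by (rule fag)
  have 1: "bergman_inner F F = bergman_inner f F + a * bergman_inner g F"
    using bergman_inner_lincomb[OF assms F, of 1 a] by (simp add: F_def)
  have 2: "bergman_inner f F = bergman_inner f f + cnj a * bergman_inner f g"
    using bergman_inner_lincomb_right[OF assms assms(1), of 1 a] by (simp add: F_def)
  have 3: "bergman_inner g F = bergman_inner g f + cnj a * bergman_inner g g"
    using bergman_inner_lincomb_right[OF assms assms(2), of 1 a] by (simp add: F_def)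
  have "complex_of_real ((bergman_norm F)\<^sup>2) =
      bergman_inner f f + cnj a * bergman_inner f g + (a * bergman_inner g f + a * (cnj a * bergman_inner g g))"
    by (simp only: bergman_inner_self[symmetric, of F] 1 2 3 distrib_left)
  also have "a * bergman_inner g f = cnj (cnj a * bergman_inner f g)"
    by (subst bergman_inner_commute) simp
  also have "bergman_inner f f + cnj a * bergman_inner f g + (cnj (cnj a * bergman_inner f g) + a * (cnj a * bergman_inner g g))
      = of_real ((bergman_norm f)\<^sup>2 + 2 * Re (cnj a * bergman_inner f g) + (cmod a)\<^sup>2 * (bergman_norm g)\<^sup>2)"
  proof -
    define u where "u = cnj a * bergman_inner f g"
    have "a * (cnj a * bergman_inner g g) = of_real ((cmod a)\<^sup>2 * (bergman_norm g)\<^sup>2)"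
      by (simp only: bergman_inner_self of_real_mult complex_norm_square mult.assoc)
    moreover have "bergman_inner f f + u + (cnj u + X) = bergman_inner f f + (u + cnj u) + X" for X
      by (simp only: add.assoc)
    ultimately show ?thesis
      unfolding u_def[symmetric] complex_add_cnj bergman_inner_self[of f] by (simp only: of_real_add)
  qed
  finally show ?thesis by (simp only: of_real_eq_iff F_def)
qed

lemma bergman_Cauchy_Schwarz:
  assumes "f \<in> bergman" "g \<in> bergman"
  shows "cmod (bergman_inner f g) \<le> bergman_norm f * bergman_norm g"
proof (cases "bergman_norm g = 0")
  \<comment> \<open>Norm zero so far yields vanishing almost everywhere only, which suffices under
    the integral.\<close>
  case True
  have "(\<integral>z. (cmod (g z))\<^sup>2 \<partial>disk_area) = 0"
    using True bergman_norm_square[of g] by simp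
  then have "AE z in disk_area. (cmod (g z))\<^sup>2 = 0"
    using integral_nonneg_eq_0_iff_AE[OF bergman_integrable[OF assms(2)]] by simp
  then have "AE z in disk_area. f z * cnj (g z) = 0" by eventually_elim simp
  then have "bergman_inner f g = 0"
    unfolding bergman_inner_def by (rule integral_eq_zero_AE)
  then show ?thesis by simp
next
  case False
  define G where "G = (bergman_norm g)\<^sup>2"
  have G: "G > 0" using False by (simp add: G_def)
  define w where "w = bergman_inner f g"
  \<comment> \<open>The coefficient -w / G subtracts from \<open>f\<close> its projection onto
    \<open>g\<close>.\<close>
  have "0 \<le> (bergman_norm (\<lambda>z. f z + (- w / of_real G) * g z))\<^sup>2" by simp
  also have "\<dots> = (bergman_norm f)\<^sup>2 + 2 * Re (cnj (- w / of_real G) * w) + (cmod (- w / of_real G))\<^sup>2 * G"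
    unfolding G_def w_def by (rule bergman_norm_square_add[OF assms])
  also have "cnj (- w / of_real G) * w = of_real (- (cmod w)\<^sup>2 / G)"
    using complex_norm_square[of w] by (simp add: mult.commute)
  also have "(cmod (- w / of_real G))\<^sup>2 * G = (cmod w)\<^sup>2 / G"
    using G by (simp add: norm_divide power2_eq_square field_simps)
  finally have "(cmod w)\<^sup>2 / G \<le> (bergman_norm f)\<^sup>2" by simp
  then have "(cmod w)\<^sup>2 \<le> (bergman_norm f)\<^sup>2 * G" using G by (simp add: field_simps)
  then have "(cmod w)\<^sup>2 \<le> (bergman_norm f * bergman_norm g)\<^sup>2" by (simp add: G_def power_mult_distrib)
  then show ?thesis unfolding w_def by (rule power2_le_imp_le) simp
qed

lemma bergman_norm_scale: "bergman_norm (\<lambda>z. a * f z) = cmod a * bergman_norm f"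
  by (simp add: bergman_norm_def norm_mult power_mult_distrib real_sqrt_mult)

lemma bergman_norm_triangle:
  assumes "f \<in> bergman" "g \<in> bergman"
  shows "bergman_norm (\<lambda>z. f z + g z) \<le> bergman_norm f + bergman_norm g"
proof (rule power2_le_imp_le)
  have "Re (bergman_inner f g) \<le> bergman_norm f * bergman_norm g"
    using bergman_Cauchy_Schwarz[OF assms] complex_Re_le_cmod order_trans by blast
  then show "(bergman_norm (\<lambda>z. f z + g z))\<^sup>2 \<le> (bergman_norm f + bergman_norm g)\<^sup>2"
    using bergman_norm_square_add[OF assms, of 1] by (simp add: power2_sum)
qed simp

subsection \<open>Power series\<close>

definition taylor_coeff :: "(complex \<Rightarrow> complex) \<Rightarrow> nat \<Rightarrow> complex" where
  "taylor_coeff f n = (deriv ^^ n) f 0 / fact n"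

lemma taylor_sums:
  assumes "f holomorphic_on unit_disk" "z \<in> unit_disk"
  shows "(\<lambda>n. taylor_coeff f n * z ^ n) sums f z"
  using holomorphic_power_series[OF assms] by (simp add: taylor_coeff_def)

text \<open>Convergence at a radius strictly between \<open>r\<close> and 1 gives absolute
  convergence at \<open>r\<close>.\<close>

lemma taylor_abs_summable:
  assumes "f holomorphic_on unit_disk" "0 \<le> r" "r < 1"
  shows "summable (\<lambda>n. cmod (taylor_coeff f n) * r ^ n)"
proof -
  define s where "s = (r + 1) / 2"
  have s: "r < s" "s < 1" "0 < s" using assms by (auto simp: s_def)
  have "summable (\<lambda>n. taylor_coeff f n * of_real s ^ n)"
    using taylor_sums[OF assms(1), of "of_real s"] s by (auto intro: sums_summable)
  then have "summable (\<lambda>n. cmod (taylor_coeff f n * of_real r ^ n))"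
    by (rule powser_insidea) (use s assms in auto)
  then show ?thesis using assms by (simp add: norm_mult norm_power)
qed

lemma integral_disk_uniform_sums:
  fixes S :: "nat \<Rightarrow> complex \<Rightarrow> complex"
  assumes r: "0 \<le> r" "r \<le> 1"
    and S: "\<And>n. S n \<in> borel_measurable disk_area" "\<And>n z. z \<in> ball 0 r \<Longrightarrow> cmod (S n z) \<le> B"
    and lim: "\<And>z. z \<in> ball 0 r \<Longrightarrow> (\<lambda>n. S n z) \<longlonglongrightarrow> F z"
  shows "(\<lambda>n. \<integral>z. indicator (ball 0 r) z * S n z \<partial>disk_area) \<longlonglongrightarrow> (\<integral>z. indicator (ball 0 r) z * F z \<partial>disk_area)"
proof (rule integral_dominated_convergence)
  have ind: "(indicator (ball 0 r) :: complex \<Rightarrow> complex) \<in> borel_measurable disk_area"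
    by (rule borel_measurable_indicator_ball) (use r in \<open>auto intro: less_imp_le\<close>)
  show "(\<lambda>z. indicator (ball 0 r) z * S n z) \<in> borel_measurable disk_area" for n
    using ind S(1) by simp
  have L: "(\<lambda>n. indicator (ball 0 r) z * S n z) \<longlonglongrightarrow> indicator (ball 0 r) z * F z" for z
    using lim[of z] by (auto simp: indicator_def)
  then show "AE z in disk_area. (\<lambda>n. indicator (ball 0 r) z * S n z) \<longlonglongrightarrow> indicator (ball 0 r) z * F z"
    by simp
  show "(\<lambda>z. indicator (ball 0 r) z * F z) \<in> borel_measurable disk_area"
    by (rule borel_measurable_LIMSEQ_metric[OF _ L]) (use ind S(1) in simp)
  \<comment> \<open>For \<open>r = 0\<close> the disk is empty and \<open>B\<close> may be negative,
    hence the absolute value.\<close>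
  show "integrable disk_area (\<lambda>z. \<bar>B\<bar>)" by simp
  show "AE z in disk_area. norm (indicator (ball 0 r) z * S n z) \<le> \<bar>B\<bar>" for n
    
  proof (intro AE_I2)
    fix z
    have "cmod (S n z) \<le> \<bar>B\<bar>" if "z \<in> ball 0 r" using S(2)[OF that, of n] by linarith
    then show "norm (indicator (ball 0 r) z * S n z) \<le> \<bar>B\<bar>" by (auto simp: indicator_def)
  qed
qed

definition taylor_sum :: "(complex \<Rightarrow> complex) \<Rightarrow> nat \<Rightarrow> complex \<Rightarrow> complex" where
  "taylor_sum f N z = (\<Sum>n<N. taylor_coeff f n * z ^ n)"

lemma taylor_sum_bound:
  assumes "f holomorphic_on unit_disk" "0 \<le> r" "r < 1" "z \<in> ball 0 r"
  shows "cmod (taylor_sum f N z) \<le> (\<Sum>n. cmod (taylor_coeff f n) * r ^ n)"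
proof -
  have "cmod (taylor_sum f N z) \<le> (\<Sum>n<N. cmod (taylor_coeff f n) * r ^ n)"
    unfolding taylor_sum_def using assms
    by (intro sum_norm_le) (auto simp: norm_mult norm_power intro!: mult_left_mono power_mono)
  also have "\<dots> \<le> (\<Sum>n. cmod (taylor_coeff f n) * r ^ n)"
    using assms by (intro sum_le_suminf taylor_abs_summable) auto
  finally show ?thesis .
qed

lemma taylor_sum_tendsto:
  "f holomorphic_on unit_disk \<Longrightarrow> z \<in> unit_disk \<Longrightarrow> (\<lambda>N. taylor_sum f N z) \<longlonglongrightarrow> f z"
  using taylor_sums[of f z] by (simp add: taylor_sum_def sums_def)

lemma integrable_disk_monomials:
  assumes "0 \<le> r" "r \<le> 1"
  shows "integrable disk_area (\<lambda>z. indicator (ball 0 r) z * (z ^ n * cnj z ^ m) :: complex)"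
proof (rule disk_area.integrable_const_bound[where B = 1])
  have ind: "(indicator (ball 0 r) :: complex \<Rightarrow> complex) \<in> borel_measurable disk_area"
    by (rule borel_measurable_indicator_ball) (use assms in \<open>auto intro: less_imp_le\<close>)
  have "(\<lambda>z. z ^ n * cnj z ^ m) \<in> borel_measurable disk_area"
    by (intro borel_measurable_disk_continuous continuous_intros sets_disk_area_borel)
  then show "(\<lambda>z. indicator (ball 0 r) z * (z ^ n * cnj z ^ m) :: complex) \<in> borel_measurable disk_area"
    using ind by simp
  show "AE z in disk_area. norm (indicator (ball 0 r) z * (z ^ n * cnj z ^ m) :: complex) \<le> 1"
    by (intro AE_I2) (auto simp: indicator_def norm_mult norm_power intro!: mult_le_one power_le_one)
qed

lemma integral_disk_taylor_sum:
  assumes r: "0 \<le> r" "r \<le> 1"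
  shows "(\<integral>z. indicator (ball 0 r) z * (taylor_sum f N z * cnj z ^ m) \<partial>disk_area) =
    (if m < N then taylor_coeff f m * of_real (r ^ (2 * m + 2) / (real m + 1)) else 0)"
proof -
  have "(\<lambda>z. indicator (ball 0 r) z * (taylor_sum f N z * cnj z ^ m)) =
      (\<lambda>z. \<Sum>n<N. taylor_coeff f n * (indicator (ball 0 r) z * (z ^ n * cnj z ^ m)))"
    by (simp add: fun_eq_iff taylor_sum_def sum_distrib_left sum_distrib_right mult_ac)
  then have "(\<integral>z. indicator (ball 0 r) z * (taylor_sum f N z * cnj z ^ m) \<partial>disk_area) =
      (\<Sum>n<N. taylor_coeff f n * (\<integral>z. indicator (ball 0 r) z * (z ^ n * cnj z ^ m) \<partial>disk_area))"
    using integrable_disk_monomials[OF r] by (simp add: Bochner_Integration.integral_sum)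
  also have "\<dots> = (\<Sum>n<N. if n = m then taylor_coeff f m * of_real (r ^ (2 * m + 2) / (real m + 1)) else 0)"
    by (intro sum.cong refl) (simp add: integral_disk_monomials[OF r])
  finally show ?thesis by simp
qed

text \<open>Taylor polynomials converge boundedly on the subdisk, and by orthogonality their
  integrals are constant as soon as \<open>N\<close> exceeds \<open>m\<close>.\<close>

lemma integral_disk_holomorphic_monomial:
  assumes f: "f holomorphic_on unit_disk" and r: "0 \<le> r" "r < 1"
  shows "(\<integral>z. indicator (ball 0 r) z * (f z * cnj z ^ m) \<partial>disk_area) =
    taylor_coeff f m * of_real (r ^ (2 * m + 2) / (real m + 1))"
proof -
  define B where "B = (\<Sum>n. cmod (taylor_coeff f n) * r ^ n)"
  have "(\<lambda>N. \<integral>z. indicator (ball 0 r) z * (taylor_sum f N z * cnj z ^ m) \<partial>disk_area)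
      \<longlonglongrightarrow> (\<integral>z. indicator (ball 0 r) z * (f z * cnj z ^ m) \<partial>disk_area)"
  proof (rule integral_disk_uniform_sums)
    show "(\<lambda>z. taylor_sum f N z * cnj z ^ m) \<in> borel_measurable disk_area" for N
      unfolding taylor_sum_def by (intro borel_measurable_disk_continuous continuous_intros sets_disk_area_borel)
    show "cmod (taylor_sum f N z * cnj z ^ m) \<le> B" if "z \<in> ball 0 r" for N z
    proof -
      have "cmod (taylor_sum f N z) * cmod z ^ m \<le> B * 1"
        using taylor_sum_bound[OF f r that, of N] that r unfolding B_def
        by (intro mult_mono power_le_one suminf_nonneg taylor_abs_summable[OF f r]) auto
      then show ?thesis by (simp add: norm_mult norm_power)
    qed
    show "(\<lambda>N. taylor_sum f N z * cnj z ^ m) \<longlonglongrightarrow> f z * cnj z ^ m" if "z \<in> ball 0 r" for z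
      using that r by (intro tendsto_mult tendsto_const taylor_sum_tendsto f) auto
  qed (use r in auto)
  moreover have "eventually (\<lambda>N. (\<integral>z. indicator (ball 0 r) z * (taylor_sum f N z * cnj z ^ m) \<partial>disk_area) =
      taylor_coeff f m * of_real (r ^ (2 * m + 2) / (real m + 1))) sequentially"
    using eventually_gt_at_top[of m] by eventually_elim (use r in \<open>simp add: integral_disk_taylor_sum\<close>)
  ultimately show ?thesis
    by (rule LIMSEQ_unique[OF _ tendsto_eventually])
qed

text \<open>Only one factor \<open>f\<close> is replaced by its Taylor polynomial; each resulting
  term is the conjugate of a moment from \<open>integral_disk_holomorphic_monomial\<close>. For
  \<open>r < 1\<close> the function is bounded on the subdisk, so square integrability on the whole
  disk is not presupposed.\<close>

lemma parseval_subdisk: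
  assumes f: "f holomorphic_on unit_disk" and r: "0 \<le> r" "r < 1"
  shows "(\<lambda>n. (cmod (taylor_coeff f n))\<^sup>2 * (r ^ (2 * n + 2) / (real n + 1))) sums
    (\<integral>z. indicator (ball 0 r) z * (cmod (f z))\<^sup>2 \<partial>disk_area)"
proof -
  define B where "B = (\<Sum>n. cmod (taylor_coeff f n) * r ^ n)"
  have "cmod (taylor_sum f N z) \<le> B" if "z \<in> ball 0 r" for N z
    unfolding B_def by (rule taylor_sum_bound[OF f r that])
  then have fB: "cmod (f z) \<le> B" if "z \<in> ball 0 r" for z
    using that r by (intro LIMSEQ_le_const2[OF tendsto_norm[OF taylor_sum_tendsto[OF f]]]) auto
  have cont: "continuous_on unit_disk f" using f by (rule holomorphic_on_imp_continuous_on)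
  have cnjf: "(\<lambda>z. cnj (f z)) \<in> borel_measurable disk_area"
    by (intro borel_measurable_disk_continuous continuous_intros cont sets_disk_area_borel)
  have tsm: "taylor_sum f N \<in> borel_measurable disk_area" for N
    unfolding taylor_sum_def[abs_def] by (intro borel_measurable_disk_continuous continuous_intros sets_disk_area_borel)
  have "(\<lambda>N. \<integral>z. indicator (ball 0 r) z * (taylor_sum f N z * cnj (f z)) \<partial>disk_area)
      \<longlonglongrightarrow> (\<integral>z. indicator (ball 0 r) z * (f z * cnj (f z)) \<partial>disk_area)"
  proof (rule integral_disk_uniform_sums)
    show "(\<lambda>z. taylor_sum f N z * cnj (f z)) \<in> borel_measurable disk_area" for N
      using tsm cnjf by simp
    show "cmod (taylor_sum f N z * cnj (f z)) \<le> B * B" if "z \<in> ball 0 r" for N z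
      using taylor_sum_bound[OF f r that, of N] fB[OF that] unfolding B_def[symmetric]
      by (simp add: norm_mult) (intro mult_mono, auto intro: order_trans[OF norm_ge_zero])
    show "(\<lambda>N. taylor_sum f N z * cnj (f z)) \<longlonglongrightarrow> f z * cnj (f z)" if "z \<in> ball 0 r" for z
      using that r by (intro tendsto_mult tendsto_const taylor_sum_tendsto f) auto
  qed (use r in auto)
  moreover have "(\<integral>z. indicator (ball 0 r) z * (taylor_sum f N z * cnj (f z)) \<partial>disk_area) =
      of_real (\<Sum>n<N. (cmod (taylor_coeff f n))\<^sup>2 * (r ^ (2 * n + 2) / (real n + 1)))" for N
  proof -
    have int: "integrable disk_area (\<lambda>z. indicator (ball 0 r) z * (z ^ n * cnj (f z)) :: complex)" for n
    proof (rule disk_area.integrable_const_bound[where B = "\<bar>B\<bar>"])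
      have ind: "(indicator (ball 0 r) :: complex \<Rightarrow> complex) \<in> borel_measurable disk_area"
        by (rule borel_measurable_indicator_ball) (use r in \<open>auto intro: less_imp_le\<close>)
      have "(\<lambda>z. z ^ n * cnj (f z)) \<in> borel_measurable disk_area"
        by (intro borel_measurable_disk_continuous continuous_intros cont sets_disk_area_borel)
      then show "(\<lambda>z. indicator (ball 0 r) z * (z ^ n * cnj (f z)) :: complex) \<in> borel_measurable disk_area"
        using ind by simp
      have "cmod z ^ n * cmod (f z) \<le> 1 * \<bar>B\<bar>" if "cmod z < r" for z
        using fB[of z] that r by (intro mult_mono power_le_one) auto
      then show "AE z in disk_area. norm (indicator (ball 0 r) z * (z ^ n * cnj (f z)) :: complex) \<le> \<bar>B\<bar>"
        by (intro AE_I2) (auto simp: indicator_def norm_mult norm_power)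
    qed
    have "(\<lambda>z. indicator (ball 0 r) z * (taylor_sum f N z * cnj (f z))) =
        (\<lambda>z. \<Sum>n<N. taylor_coeff f n * (indicator (ball 0 r) z * (z ^ n * cnj (f z))))"
      by (simp add: fun_eq_iff taylor_sum_def sum_distrib_left sum_distrib_right mult_ac)
    then have "(\<integral>z. indicator (ball 0 r) z * (taylor_sum f N z * cnj (f z)) \<partial>disk_area) =
        (\<Sum>n<N. taylor_coeff f n * (\<integral>z. indicator (ball 0 r) z * (z ^ n * cnj (f z)) \<partial>disk_area))"
      using int by (simp add: Bochner_Integration.integral_sum)
    also have "\<dots> = (\<Sum>n<N. of_real ((cmod (taylor_coeff f n))\<^sup>2 * (r ^ (2 * n + 2) / (real n + 1))))"
    proof (intro sum.cong refl)
      fix n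
      have "(\<integral>z. indicator (ball 0 r) z * (z ^ n * cnj (f z)) \<partial>disk_area) =
          (\<integral>z. cnj (indicator (ball 0 r) z * (f z * cnj z ^ n)) \<partial>disk_area)"
        by (intro Bochner_Integration.integral_cong refl) (auto simp: indicator_def)
      also have "\<dots> = cnj (taylor_coeff f n * of_real (r ^ (2 * n + 2) / (real n + 1)))"
        by (simp only: Bochner_Integration.integral_cnj integral_disk_holomorphic_monomial[OF f r])
      finally show "taylor_coeff f n * (\<integral>z. indicator (ball 0 r) z * (z ^ n * cnj (f z)) \<partial>disk_area) =
          of_real ((cmod (taylor_coeff f n))\<^sup>2 * (r ^ (2 * n + 2) / (real n + 1)))"
        by (simp only: of_real_mult complex_norm_square complex_cnj_mult complex_cnj_complex_of_real mult.assoc)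
    qed
    finally show ?thesis by simp
  qed
  moreover have "(\<integral>z. indicator (ball 0 r) z * (f z * cnj (f z)) \<partial>disk_area) =
      of_real (\<integral>z. indicator (ball 0 r) z * (cmod (f z))\<^sup>2 \<partial>disk_area)"
  proof -
    have "(\<lambda>z. indicator (ball 0 r) z * (f z * cnj (f z))) = (\<lambda>z. complex_of_real (indicator (ball 0 r) z * (cmod (f z))\<^sup>2))"
      by (auto simp: fun_eq_iff indicator_def complex_norm_square[symmetric])
    then show ?thesis by (simp only: integral_complex_of_real)
  qed
  ultimately have "(\<lambda>N. complex_of_real (\<Sum>n<N. (cmod (taylor_coeff f n))\<^sup>2 * (r ^ (2 * n + 2) / (real n + 1)))) \<longlonglongrightarrow>
      complex_of_real (\<integral>z. indicator (ball 0 r) z * (cmod (f z))\<^sup>2 \<partial>disk_area)"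
    by simp
  then show ?thesis unfolding sums_def by (simp only: tendsto_of_real_iff)
qed

text \<open>Both sides increase with the radius, so monotone convergence as it tends to 1 gives the
  identity with the value \<infinity> allowed. It therefore decides membership in the Bergman space
  as well as computing norms.\<close>

lemma nn_integral_parseval:
  assumes f: "f holomorphic_on unit_disk"
  shows "(\<integral>\<^sup>+ z. ennreal ((cmod (f z))\<^sup>2) \<partial>disk_area) =
    (\<Sum>n. ennreal ((cmod (taylor_coeff f n))\<^sup>2 / (real n + 1)))"
proof -
  define r where "r k = 1 - 1 / (real k + 2)" for k
  have r: "0 \<le> r k" "r k < 1" for k by (auto simp: r_def field_simps)
  have r_mono: "r k \<le> r l" if "k \<le> l" for k l using that by (auto simp: r_def frac_le)
  have r_lim: "r \<longlonglongrightarrow> 1" unfolding r_def by real_asymp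
  have mf: "f \<in> borel_measurable disk_area" using f by (rule holomorphic_measurable_disk_area)
  have ind[measurable]: "ball 0 (r k) \<in> sets disk_area" for k using r[of k] by (auto simp: sets_disk_area_iff)
  have fmeas: "(\<lambda>z. ennreal ((cmod (f z))\<^sup>2)) \<in> borel_measurable disk_area" using mf by simp
  have L1: "(\<integral>\<^sup>+ z. indicator (ball 0 (r k)) z * ennreal ((cmod (f z))\<^sup>2) \<partial>disk_area) =
      (\<Sum>n. ennreal ((cmod (taylor_coeff f n))\<^sup>2 * (r k ^ (2 * n + 2) / (real n + 1))))" for k
  proof -
    have "compact (f ` cball 0 (r k))"
      using r[of k] by (intro compact_continuous_image continuous_on_subset[OF holomorphic_on_imp_continuous_on[OF f]]) auto
    then obtain B where B: "\<And>z. z \<in> cball 0 (r k) \<Longrightarrow> cmod (f z) \<le> B"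
      using compact_imp_bounded bounded_iff by (metis imageI)
    then have "norm (indicator (ball 0 (r k)) z * (cmod (f z))\<^sup>2) \<le> B\<^sup>2" for z
      by (auto simp: indicator_def intro!: power_mono)
    moreover have "(\<lambda>z. indicator (ball 0 (r k)) z * (cmod (f z))\<^sup>2) \<in> borel_measurable disk_area"
      using mf by simp
    ultimately have "integrable disk_area (\<lambda>z. indicator (ball 0 (r k)) z * (cmod (f z))\<^sup>2)"
      by (intro disk_area.integrable_const_bound[where B = "B\<^sup>2"] AE_I2)
    then have "(\<integral>\<^sup>+ z. ennreal (indicator (ball 0 (r k)) z * (cmod (f z))\<^sup>2) \<partial>disk_area) =
        ennreal (\<integral>z. indicator (ball 0 (r k)) z * (cmod (f z))\<^sup>2 \<partial>disk_area)"
      by (intro nn_integral_eq_integral) auto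
    also have "\<dots> = (\<Sum>n. ennreal ((cmod (taylor_coeff f n))\<^sup>2 * (r k ^ (2 * n + 2) / (real n + 1))))"
      using parseval_subdisk[OF f r] r by (intro suminf_ennreal_eq[symmetric]) auto
    finally show ?thesis by (simp add: ennreal_mult' ennreal_indicator)
  qed
  have "(\<lambda>k. \<integral>\<^sup>+ z. indicator (ball 0 (r k)) z * ennreal ((cmod (f z))\<^sup>2) \<partial>disk_area)
      \<longlonglongrightarrow> (\<integral>\<^sup>+ z. indicator unit_disk z * ennreal ((cmod (f z))\<^sup>2) \<partial>disk_area)"
  proof (rule nn_integral_LIMSEQ)
    show "incseq (\<lambda>k z. indicator (ball 0 (r k)) z * ennreal ((cmod (f z))\<^sup>2))"
      using r_mono by (auto simp: incseq_def le_fun_def indicator_def intro: less_le_trans)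
    show "(\<lambda>z. indicator (ball 0 (r k)) z * ennreal ((cmod (f z))\<^sup>2)) \<in> borel_measurable disk_area" for k
      using fmeas by simp
    show "(\<lambda>k. indicator (ball 0 (r k)) z * ennreal ((cmod (f z))\<^sup>2)) \<longlonglongrightarrow>
        indicator unit_disk z * ennreal ((cmod (f z))\<^sup>2)" for z
    proof (cases "z \<in> unit_disk")
      case True
      then have "eventually (\<lambda>k. cmod z < r k) sequentially"
        using order_tendstoD(1)[OF r_lim, of "cmod z"] by simp
      then have "eventually (\<lambda>k. indicator (ball 0 (r k)) z * ennreal ((cmod (f z))\<^sup>2) =
          indicator unit_disk z * ennreal ((cmod (f z))\<^sup>2)) sequentially"
        by eventually_elim (use True in simp)
      then show ?thesis by (rule tendsto_eventually)
    next
      case False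
      then have "z \<notin> ball 0 (r k)" for k using r(2)[of k] by auto
      then show ?thesis using False by simp
    qed
  qed
  also have "(\<integral>\<^sup>+ z. indicator unit_disk z * ennreal ((cmod (f z))\<^sup>2) \<partial>disk_area) =
      (\<integral>\<^sup>+ z. ennreal ((cmod (f z))\<^sup>2) \<partial>disk_area)"
    by (intro nn_integral_cong) simp
  finally have "(\<lambda>k. \<integral>\<^sup>+ z. indicator (ball 0 (r k)) z * ennreal ((cmod (f z))\<^sup>2) \<partial>disk_area)
      \<longlonglongrightarrow> (\<integral>\<^sup>+ z. ennreal ((cmod (f z))\<^sup>2) \<partial>disk_area)" .
  \<comment> \<open>The series is read as an integral against counting measure, so that monotone
    convergence applies to it too.\<close>
  moreover have "(\<lambda>k. \<integral>\<^sup>+ n. ennreal ((cmod (taylor_coeff f n))\<^sup>2 * (r k ^ (2 * n + 2) / (real n + 1))) \<partial>count_space UNIV)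
      \<longlonglongrightarrow> (\<integral>\<^sup>+ n. ennreal ((cmod (taylor_coeff f n))\<^sup>2 / (real n + 1)) \<partial>count_space UNIV)"
  proof (rule nn_integral_LIMSEQ)
    show "incseq (\<lambda>k n. ennreal ((cmod (taylor_coeff f n))\<^sup>2 * (r k ^ (2 * n + 2) / (real n + 1))))"
      unfolding incseq_def le_fun_def
      by (intro allI impI ennreal_leI mult_left_mono divide_right_mono power_mono r_mono r(1)) auto
    have "(\<lambda>k. ennreal ((cmod (taylor_coeff f n))\<^sup>2 * (r k ^ (2 * n + 2) / (real n + 1))))
        \<longlonglongrightarrow> ennreal ((cmod (taylor_coeff f n))\<^sup>2 * (1 ^ (2 * n + 2) / (real n + 1)))" for n
      by (intro tendsto_ennrealI tendsto_intros r_lim) simp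
    then show "(\<lambda>k. ennreal ((cmod (taylor_coeff f n))\<^sup>2 * (r k ^ (2 * n + 2) / (real n + 1))))
        \<longlonglongrightarrow> ennreal ((cmod (taylor_coeff f n))\<^sup>2 / (real n + 1))" for n
      by simp
  qed simp
  ultimately show ?thesis
    unfolding L1 nn_integral_count_space_nat by (rule LIMSEQ_unique)
qed

section \<open>Completeness and the reproducing kernel\<close>

lemma taylor_coeff_unique:
  assumes "\<And>z. z \<in> unit_disk \<Longrightarrow> (\<lambda>n. a n * z ^ n) sums f z"
  shows "taylor_coeff f n = a n"
proof -
  have "eventually (\<lambda>u. (\<lambda>n. fps_nth (Abs_fps a) n * u ^ n) sums f u) (nhds 0)"
    using eventually_nhds_in_open[of unit_disk "0::complex"] assms by (auto elim!: eventually_mono)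
  then have "f has_fps_expansion Abs_fps a" by (rule has_fps_expansionI)
  from fps_nth_fps_expansion[OF this, of n] show ?thesis by (simp add: taylor_coeff_def)
qed

text \<open>Cut off outside the disk, as membership in \<open>bergman\<close> demands.\<close>

definition monomial :: "nat \<Rightarrow> complex \<Rightarrow> complex" where
  "monomial n z = (if z \<in> unit_disk then z ^ n else 0)"

lemma bergmanI_taylor:
  assumes f: "f holomorphic_on unit_disk" "\<And>z. z \<notin> unit_disk \<Longrightarrow> f z = 0"
    and s: "summable (\<lambda>n. (cmod (taylor_coeff f n))\<^sup>2 / (real n + 1))"
  shows "f \<in> bergman"
proof -
  have "integrable disk_area (\<lambda>z. (cmod (f z))\<^sup>2)"
  proof (rule integrableI_bounded)
    show "(\<lambda>z. (cmod (f z))\<^sup>2) \<in> borel_measurable disk_area"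
      using holomorphic_measurable_disk_area[OF f(1)] by simp
    have "(\<integral>\<^sup>+ z. ennreal (norm ((cmod (f z))\<^sup>2)) \<partial>disk_area) =
        (\<Sum>n. ennreal ((cmod (taylor_coeff f n))\<^sup>2 / (real n + 1)))"
      using nn_integral_parseval[OF f(1)] by simp
    also have "\<dots> = ennreal (\<Sum>n. (cmod (taylor_coeff f n))\<^sup>2 / (real n + 1))"
      by (rule suminf_ennreal2) (simp_all add: s)
    finally show "(\<integral>\<^sup>+ z. ennreal (norm ((cmod (f z))\<^sup>2)) \<partial>disk_area) < \<infinity>" by simp
  qed
  then show ?thesis using f by (simp add: bergman_def)
qed

lemma bergman_norm_sums:
  assumes f: "f \<in> bergman"
  shows "(\<lambda>n. (cmod (taylor_coeff f n))\<^sup>2 / (real n + 1)) sums (bergman_norm f)\<^sup>2"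
proof -
  have "ennreal ((bergman_norm f)\<^sup>2) = (\<integral>\<^sup>+ z. ennreal ((cmod (f z))\<^sup>2) \<partial>disk_area)"
    unfolding bergman_norm_square using bergman_integrable[OF f] by (intro nn_integral_eq_integral[symmetric]) auto
  also have "\<dots> = (\<Sum>n. ennreal ((cmod (taylor_coeff f n))\<^sup>2 / (real n + 1)))"
    by (rule nn_integral_parseval[OF bergman_holomorphic[OF f]])
  finally have eq: "(\<Sum>n. ennreal ((cmod (taylor_coeff f n))\<^sup>2 / (real n + 1))) = ennreal ((bergman_norm f)\<^sup>2)" by simp
  have s: "summable (\<lambda>n. (cmod (taylor_coeff f n))\<^sup>2 / (real n + 1))"
    by (rule summable_suminf_not_top) (simp_all add: eq)
  have "ennreal (\<Sum>n. (cmod (taylor_coeff f n))\<^sup>2 / (real n + 1)) = ennreal ((bergman_norm f)\<^sup>2)"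
    using suminf_ennreal2[OF _ s] eq by simp
  then have "(\<Sum>n. (cmod (taylor_coeff f n))\<^sup>2 / (real n + 1)) = (bergman_norm f)\<^sup>2"
    by (subst (asm) ennreal_inj) (auto intro!: suminf_nonneg s)
  with s show ?thesis by (simp add: sums_iff)
qed

lemma monomial_holomorphic: "monomial n holomorphic_on unit_disk"
proof -
  have "(\<lambda>z. z ^ n) holomorphic_on unit_disk" by (intro holomorphic_intros)
  then show ?thesis by (rule holomorphic_transform) (simp add: monomial_def)
qed

lemma taylor_coeff_monomial: "taylor_coeff (monomial n) m = (if m = n then 1 else 0)"
proof (rule taylor_coeff_unique)
  fix z :: complex assume "z \<in> unit_disk"
  have "(\<lambda>m. if m = n then z ^ m else 0) sums z ^ n" by (rule sums_single)
  also have "(\<lambda>m. if m = n then z ^ m else 0) = (\<lambda>m. (if m = n then 1 else 0) * z ^ m)" by auto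
  finally show "(\<lambda>m. (if m = n then 1 else 0) * z ^ m) sums monomial n z"
    using \<open>z \<in> unit_disk\<close> by (simp add: monomial_def)
qed

lemma monomial_bergman [simp]: "monomial n \<in> bergman"
proof (rule bergmanI_taylor)
  have "(\<lambda>m. (cmod (taylor_coeff (monomial n) m))\<^sup>2 / (real m + 1)) = (\<lambda>m. if m = n then 1 / (real m + 1) else 0)"
    by (auto simp: taylor_coeff_monomial)
  then show "summable (\<lambda>m. (cmod (taylor_coeff (monomial n) m))\<^sup>2 / (real m + 1))"
    by simp
qed (auto simp: monomial_holomorphic monomial_def)

text \<open>The powers are orthogonal with squared norm 1 / (m + 1), which is the divisor. Square
  integrability of \<open>f\<close> provides the dominating function that carries the subdisk
  formula to radius 1.\<close>

lemma bergman_inner_monomial: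
  assumes f: "f \<in> bergman"
  shows "bergman_inner f (monomial m) = taylor_coeff f m / (of_nat m + 1)"
proof -
  define r where "r k = 1 - 1 / (real k + 2)" for k
  have r: "0 \<le> r k" "r k < 1" for k by (auto simp: r_def field_simps)
  have r_lim: "r \<longlonglongrightarrow> 1" unfolding r_def by real_asymp
  note int = bergman_mult_integrable[OF f monomial_bergman[of m]]
  have 1: "(\<lambda>k. \<integral>z. indicator (ball 0 (r k)) z * (f z * cnj (monomial m z)) \<partial>disk_area) \<longlonglongrightarrow>
      (\<integral>z. f z * cnj (monomial m z) \<partial>disk_area)"
  proof (rule integral_dominated_convergence)
    show "integrable disk_area (\<lambda>z. norm (f z * cnj (monomial m z)))" using int by simp
    show "(\<lambda>z. f z * cnj (monomial m z)) \<in> borel_measurable disk_area" using int by simp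
    have ind: "(indicator (ball 0 (r k)) :: complex \<Rightarrow> complex) \<in> borel_measurable disk_area" for k
      by (rule borel_measurable_indicator_ball) (use r in \<open>auto intro: less_imp_le\<close>)
    show "(\<lambda>z. indicator (ball 0 (r k)) z * (f z * cnj (monomial m z))) \<in> borel_measurable disk_area" for k
      by (rule borel_measurable_times[OF ind]) (use int in simp)
    show "AE z in disk_area. norm (indicator (ball 0 (r k)) z * (f z * cnj (monomial m z))) \<le> norm (f z * cnj (monomial m z))" for k
      by (intro AE_I2) (simp add: indicator_def)
    show "AE z in disk_area. (\<lambda>k. indicator (ball 0 (r k)) z * (f z * cnj (monomial m z))) \<longlonglongrightarrow> f z * cnj (monomial m z)"
    proof (intro AE_I2)
      fix z assume "z \<in> space disk_area"
      then have "eventually (\<lambda>k. cmod z < r k) sequentially"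
        using order_tendstoD(1)[OF r_lim, of "cmod z"] by simp
      then have "eventually (\<lambda>k. indicator (ball 0 (r k)) z * (f z * cnj (monomial m z)) = f z * cnj (monomial m z)) sequentially"
        by eventually_elim simp
      then show "(\<lambda>k. indicator (ball 0 (r k)) z * (f z * cnj (monomial m z))) \<longlonglongrightarrow> f z * cnj (monomial m z)"
        by (rule tendsto_eventually)
    qed
  qed
  have 2: "(\<integral>z. indicator (ball 0 (r k)) z * (f z * cnj (monomial m z)) \<partial>disk_area) =
      taylor_coeff f m * of_real (r k ^ (2 * m + 2) / (real m + 1))" for k
  proof -
    have "(\<integral>z. indicator (ball 0 (r k)) z * (f z * cnj (monomial m z)) \<partial>disk_area) =
        (\<integral>z. indicator (ball 0 (r k)) z * (f z * cnj z ^ m) \<partial>disk_area)"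
      by (intro Bochner_Integration.integral_cong refl) (simp add: monomial_def)
    then show ?thesis by (simp only: integral_disk_holomorphic_monomial[OF bergman_holomorphic[OF f] r])
  qed
  have 3: "(\<lambda>k. taylor_coeff f m * of_real (r k ^ (2 * m + 2) / (real m + 1))) \<longlonglongrightarrow>
      taylor_coeff f m * of_real (1 ^ (2 * m + 2) / (real m + 1))"
    by (intro tendsto_intros r_lim) simp
  have "bergman_inner f (monomial m) = taylor_coeff f m * of_real (1 ^ (2 * m + 2) / (real m + 1))"
    unfolding bergman_inner_def by (rule LIMSEQ_unique[OF 1[unfolded 2] 3])
  then show ?thesis by (simp add: divide_inverse add.commute)
qed

section \<open>Polynomial approximation and Riesz representation\<close>

definition bergman_partial :: "(complex \<Rightarrow> complex) \<Rightarrow> nat \<Rightarrow> complex \<Rightarrow> complex" where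
  "bergman_partial f N = (\<lambda>z. \<Sum>n<N. taylor_coeff f n * monomial n z)"

lemma bergman_partial_in [simp]: "bergman_partial f N \<in> bergman"
  unfolding bergman_partial_def by (intro bergman_sum monomial_bergman)

lemma of_nat_plus_one_neq_zero: "of_nat n + 1 \<noteq> (0::'a::semiring_char_0)"
  by (metis of_nat_Suc of_nat_neq_0 add.commute)

lemma taylor_coeff_inner: "f \<in> bergman \<Longrightarrow> taylor_coeff f m = (of_nat m + 1) * bergman_inner f (monomial m)"
  by (simp add: bergman_inner_monomial of_nat_plus_one_neq_zero)

text \<open>The remainder has the Taylor coefficients of \<open>f\<close> from index
  \<open>N\<close> on, so its squared norm is a tail of the Parseval series.\<close>

lemma bergman_partial_tendsto:
  assumes f: "f \<in> bergman"
  shows "(\<lambda>N. bergman_norm (\<lambda>z. f z - bergman_partial f N z)) \<longlonglongrightarrow> 0"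
proof -
  let ?t = "\<lambda>n. (cmod (taylor_coeff f n))\<^sup>2 / (real n + 1)"
  have coeff: "taylor_coeff (\<lambda>z. f z - bergman_partial f N z) m = (if m < N then 0 else taylor_coeff f m)" for N m
  proof -
    have "bergman_inner (bergman_partial f N) (monomial m) = (\<Sum>n<N. taylor_coeff f n * bergman_inner (monomial n) (monomial m))"
      unfolding bergman_partial_def by (intro bergman_inner_sum monomial_bergman)
    also have "\<dots> = (\<Sum>n<N. if n = m then taylor_coeff f m / (of_nat m + 1) else 0)"
      by (intro sum.cong refl) (auto simp: bergman_inner_monomial taylor_coeff_monomial)
    finally have sum: "bergman_inner (bergman_partial f N) (monomial m) = (if m < N then taylor_coeff f m / (of_nat m + 1) else 0)"
      by simp
    show ?thesis
      unfolding taylor_coeff_inner[OF bergman_diff[OF f bergman_partial_in]]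
        bergman_inner_diff[OF f bergman_partial_in monomial_bergman] sum bergman_inner_monomial[OF f]
      by (simp add: of_nat_plus_one_neq_zero)
  qed
  have "(bergman_norm (\<lambda>z. f z - bergman_partial f N z))\<^sup>2 = (bergman_norm f)\<^sup>2 - (\<Sum>n<N. ?t n)" for N
  proof -
    have "(\<lambda>n. ?t n - (if n \<in> {..<N} then ?t n else 0)) sums ((bergman_norm f)\<^sup>2 - (\<Sum>n<N. ?t n))"
      by (intro sums_diff bergman_norm_sums[OF f] sums_If_finite_set) simp
    also have "(\<lambda>n. ?t n - (if n \<in> {..<N} then ?t n else 0)) =
        (\<lambda>n. (cmod (taylor_coeff (\<lambda>z. f z - bergman_partial f N z) n))\<^sup>2 / (real n + 1))"
      by (auto simp: coeff)
    finally show ?thesis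
      using bergman_norm_sums[OF bergman_diff[OF f bergman_partial_in]] by (rule sums_unique2[rotated])
  qed
  moreover have "(\<lambda>N. (bergman_norm f)\<^sup>2 - (\<Sum>n<N. ?t n)) \<longlonglongrightarrow> (bergman_norm f)\<^sup>2 - (bergman_norm f)\<^sup>2"
    using bergman_norm_sums[OF f] unfolding sums_def by (intro tendsto_intros)
  ultimately have "(\<lambda>N. (bergman_norm (\<lambda>z. f z - bergman_partial f N z))\<^sup>2) \<longlonglongrightarrow> 0" by simp
  then have "(\<lambda>N. sqrt ((bergman_norm (\<lambda>z. f z - bergman_partial f N z))\<^sup>2)) \<longlonglongrightarrow> sqrt 0"
    by (rule tendsto_real_sqrt)
  then show ?thesis by simp
qed

lemma bergman_inner_partial_tendsto:
  assumes f: "f \<in> bergman" and g: "g \<in> bergman"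
  shows "(\<lambda>N. bergman_inner f (bergman_partial g N)) \<longlonglongrightarrow> bergman_inner f g"
proof -
  have "(\<lambda>N. bergman_norm f * bergman_norm (\<lambda>z. g z - bergman_partial g N z)) \<longlonglongrightarrow> bergman_norm f * 0"
    by (intro tendsto_intros bergman_partial_tendsto g)
  then have "(\<lambda>N. bergman_inner f (bergman_partial g N) - bergman_inner f g) \<longlonglongrightarrow> 0"
  proof (rule Lim_null_comparison[rotated, OF tendsto_eq_rhs])
    show "eventually (\<lambda>N. norm (bergman_inner f (bergman_partial g N) - bergman_inner f g) \<le>
        bergman_norm f * bergman_norm (\<lambda>z. g z - bergman_partial g N z)) sequentially"
    proof (intro always_eventually allI)
      fix N
      have "bergman_inner f (\<lambda>z. g z - bergman_partial g N z) = bergman_inner f g - bergman_inner f (bergman_partial g N)"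
        using bergman_inner_lincomb_right[OF g bergman_partial_in f, of 1 "-1" g N] by simp
      then show "norm (bergman_inner f (bergman_partial g N) - bergman_inner f g) \<le>
          bergman_norm f * bergman_norm (\<lambda>z. g z - bergman_partial g N z)"
        using bergman_Cauchy_Schwarz[OF f bergman_diff[OF g bergman_partial_in], of g N]
        by (simp add: norm_minus_commute)
    qed
  qed simp
  then show ?thesis by (simp add: LIM_zero_iff)
qed

lemma bergman_partial_norm:
  "(bergman_norm (\<lambda>z. \<Sum>n<N. c n * monomial n z))\<^sup>2 = (\<Sum>n<N. (cmod (c n))\<^sup>2 / (real n + 1))"
proof -
  let ?h = "\<lambda>z. \<Sum>n<N. c n * monomial n z"
  have h: "?h \<in> bergman" by (intro bergman_sum monomial_bergman)
  have i: "bergman_inner ?h (monomial m) = (if m < N then c m / (of_nat m + 1) else 0)" for m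
  proof -
    have "bergman_inner ?h (monomial m) = (\<Sum>n<N. c n * bergman_inner (monomial n) (monomial m))"
      by (intro bergman_inner_sum monomial_bergman)
    also have "\<dots> = (\<Sum>n<N. if n = m then c m / (of_nat m + 1) else 0)"
      by (intro sum.cong refl) (auto simp: bergman_inner_monomial taylor_coeff_monomial)
    finally show ?thesis by simp
  qed
  have "complex_of_real ((bergman_norm ?h)\<^sup>2) = bergman_inner ?h ?h" by (rule bergman_inner_self[symmetric])
  also have "\<dots> = (\<Sum>n<N. cnj (c n) * bergman_inner ?h (monomial n))"
    by (intro bergman_inner_sum_right monomial_bergman h)
  also have "\<dots> = (\<Sum>n<N. of_real ((cmod (c n))\<^sup>2 / (real n + 1)))"
  proof (intro sum.cong refl)
    fix n assume "n \<in> {..<N}"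
    then have "cnj (c n) * bergman_inner ?h (monomial n) = (c n * cnj (c n)) / (of_nat n + 1)" by (simp add: i)
    also have "\<dots> = of_real ((cmod (c n))\<^sup>2) / (of_nat n + 1)" by (simp only: complex_norm_square)
    finally show "cnj (c n) * bergman_inner ?h (monomial n) = of_real ((cmod (c n))\<^sup>2 / (real n + 1))" by simp
  qed
  also have "\<dots> = of_real (\<Sum>n<N. (cmod (c n))\<^sup>2 / (real n + 1))" by (simp only: of_real_sum)
  finally show ?thesis by (simp only: of_real_eq_iff)
qed

lemma summable_Suc_power:
  assumes "0 \<le> x" "x < (1::real)"
  shows "summable (\<lambda>n. (real n + 1) * x ^ n)"
proof -
  have "(\<lambda>n. of_nat (Suc n) * x ^ n) sums (1 / (1 - x)\<^sup>2)"
    using assms by (intro geometric_deriv_sums) simp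
  then show ?thesis by (auto dest!: sums_summable simp: add.commute)
qed

text \<open>Completeness in coefficient form: every weighted square-summable sequence is realized.
  The condition is strong enough to make the power series converge on the whole disk.\<close>

lemma bergman_of_coeffs:
  assumes c: "summable (\<lambda>n. (cmod (c n))\<^sup>2 / (real n + 1))"
  obtains F where "F \<in> bergman" "\<And>n. taylor_coeff F n = c n"
proof -
  have sm: "summable (\<lambda>n. c n * z ^ n)" if z: "z \<in> unit_disk" for z
  proof (rule summable_norm_cancel, rule summable_comparison_test')
    have "(cmod z)\<^sup>2 < 1" using z by (simp add: power_less_one_iff abs_square_less_1)
    then show "summable (\<lambda>n. (cmod (c n))\<^sup>2 / (real n + 1) + (real n + 1) * ((cmod z)\<^sup>2) ^ n)"
      by (intro summable_add c summable_Suc_power) auto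
    fix n
    define p where "p = cmod (c n)"
    define q where "q = cmod z ^ n"
    define s where "s = sqrt (real n + 1)"
    have s: "s > 0" "s\<^sup>2 = real n + 1" by (simp_all add: s_def)
    \<comment> \<open>Weighting by s = sqrt (n + 1) splits |c_n z^n| into a term of the given series
      and (n + 1) |z|^(2n), both summable.\<close>
    have "2 * (p / s) * (s * q) \<le> (p / s)\<^sup>2 + (s * q)\<^sup>2" by (rule sum_squares_bound)
    then have "2 * (p * q) \<le> p\<^sup>2 / (real n + 1) + (real n + 1) * q\<^sup>2"
      using s by (simp add: power_divide power_mult_distrib)
    moreover have "0 \<le> p * q" by (simp add: p_def q_def)
    ultimately have "p * q \<le> p\<^sup>2 / (real n + 1) + (real n + 1) * q\<^sup>2" by linarith
    then show "norm (norm (c n * z ^ n)) \<le> (cmod (c n))\<^sup>2 / (real n + 1) + (real n + 1) * ((cmod z)\<^sup>2) ^ n"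
      by (simp add: p_def q_def norm_mult norm_power power_mult[symmetric] mult.commute)
  qed
  define F where "F z = (if z \<in> unit_disk then \<Sum>n. c n * z ^ n else 0)" for z
  have F: "(\<lambda>n. c n * z ^ n) sums F z" if "z \<in> unit_disk" for z
    using sm[OF that] that by (simp add: F_def summable_sums)
  have coeff: "taylor_coeff F n = c n" for n by (rule taylor_coeff_unique[OF F])
  have "F \<in> bergman"
  proof (rule bergmanI_taylor)
    show "F holomorphic_on unit_disk"
      by (rule power_series_holomorphic[where a = c]) (use F in simp)
    show "summable (\<lambda>n. (cmod (taylor_coeff F n))\<^sup>2 / (real n + 1))" using c by (simp add: coeff)
  qed (simp add: F_def)
  then show ?thesis using coeff that by blast
qed

text \<open>The functional is conjugate-linear, like the second argument of the inner product. Its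
  values on monomials prescribe the Taylor coefficients of \<open>G\<close>; boundedness makes these
  square-summable, and density of polynomials extends the identity to the whole space.\<close>

lemma bergman_Riesz:
  assumes lin: "\<And>f g a b. f \<in> bergman \<Longrightarrow> g \<in> bergman \<Longrightarrow> \<phi> (\<lambda>z. a * f z + b * g z) = cnj a * \<phi> f + cnj b * \<phi> g"
    and bd: "\<And>f. f \<in> bergman \<Longrightarrow> cmod (\<phi> f) \<le> C * bergman_norm f" and C: "0 \<le> C"
  obtains G where "G \<in> bergman" "\<And>g. g \<in> bergman \<Longrightarrow> bergman_inner G g = \<phi> g" "bergman_norm G \<le> C"
proof -
  have \<phi>_sum: "\<phi> (\<lambda>z. \<Sum>n<N. c n * monomial n z) = (\<Sum>n<N. cnj (c n) * \<phi> (monomial n))" for c and N :: nat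
  proof (induction N)
    case 0
    have "\<phi> (\<lambda>_. 0) = 0" using lin[of "\<lambda>_. 0" "\<lambda>_. 0" 0 0] by simp
    then show ?case by simp
  next
    case (Suc N)
    have "(\<lambda>z. \<Sum>n<N. c n * monomial n z) \<in> bergman" by (intro bergman_sum monomial_bergman)
    from lin[OF this monomial_bergman[of N], of 1 "c N"] Suc show ?case by simp
  qed
  \<comment> \<open>The factor n + 1 undoes the division in
    \<open>bergman_inner_monomial\<close>.\<close>
  define c where "c n = (of_nat n + 1) * \<phi> (monomial n)" for n
  note n1 = of_nat_plus_one_neq_zero[where 'a = complex]
  have \<phi>c: "\<phi> (monomial n) = c n / (of_nat n + 1)" for n using n1[of n] by (simp add: c_def)
  have bound: "(\<Sum>n<N. (cmod (c n))\<^sup>2 / (real n + 1)) \<le> C\<^sup>2" for N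
  proof -
    define s where "s = (\<Sum>n<N. (cmod (c n))\<^sup>2 / (real n + 1))"
    have s0: "0 \<le> s" unfolding s_def by (intro sum_nonneg) simp
    let ?h = "\<lambda>z. \<Sum>n<N. c n * monomial n z"
    have h: "?h \<in> bergman" by (intro bergman_sum monomial_bergman)
    \<comment> \<open>On the polynomial with these same coefficients the functional equals its
      squared norm \<open>s\<close>, so s is at most C sqrt s and hence at most C^2, uniformly in
      \<open>N\<close>.\<close>
    have "\<phi> ?h = (\<Sum>n<N. of_real ((cmod (c n))\<^sup>2 / (real n + 1)))"
      unfolding \<phi>_sum
    proof (intro sum.cong refl)
      fix n
      have "cnj (c n) * \<phi> (monomial n) = (c n * cnj (c n)) / (of_nat n + 1)" by (simp add: \<phi>c)
      also have "\<dots> = of_real ((cmod (c n))\<^sup>2) / (of_nat n + 1)" by (simp only: complex_norm_square)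
      finally show "cnj (c n) * \<phi> (monomial n) = of_real ((cmod (c n))\<^sup>2 / (real n + 1))" by simp
    qed
    then have "\<phi> ?h = of_real s" unfolding s_def by (simp only: of_real_sum)
    then have "s \<le> C * bergman_norm ?h" using bd[OF h] s0 by simp
    then have "s\<^sup>2 \<le> (C * bergman_norm ?h)\<^sup>2" using s0 by (intro power_mono)
    also have "\<dots> = C\<^sup>2 * s" by (simp only: power_mult_distrib bergman_partial_norm s_def)
    finally have "s * s \<le> C\<^sup>2 * s" by (simp add: power2_eq_square)
    then have "s \<le> C\<^sup>2"
      using s0 by (cases "s = 0") auto
    then show ?thesis by (simp add: s_def)
  qed
  have "summable (\<lambda>n. (cmod (c n))\<^sup>2 / (real n + 1))"
    by (rule summableI_nonneg_bounded[where x = "C\<^sup>2"]) (auto simp: bound)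
  then obtain G where G: "G \<in> bergman" "\<And>n. taylor_coeff G n = c n" by (rule bergman_of_coeffs) blast
  have Gm: "bergman_inner G (monomial n) = \<phi> (monomial n)" for n
    by (simp add: bergman_inner_monomial[OF G(1)] G(2) \<phi>c)
  have inner: "bergman_inner G g = \<phi> g" if g: "g \<in> bergman" for g
  proof -
    have "bergman_inner G (bergman_partial g N) = \<phi> (bergman_partial g N)" for N
      unfolding bergman_partial_def \<phi>_sum
      by (subst bergman_inner_sum_right) (auto simp: Gm G(1))
    then have 1: "(\<lambda>N. \<phi> (bergman_partial g N)) \<longlonglongrightarrow> bergman_inner G g"
      using bergman_inner_partial_tendsto[OF G(1) g] by simp
    have "(\<lambda>N. C * bergman_norm (\<lambda>z. g z - bergman_partial g N z)) \<longlonglongrightarrow> C * 0"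
      by (intro tendsto_intros bergman_partial_tendsto g)
    then have "(\<lambda>N. \<phi> (bergman_partial g N) - \<phi> g) \<longlonglongrightarrow> 0"
    proof (rule Lim_null_comparison[rotated, OF tendsto_eq_rhs])
      show "eventually (\<lambda>N. norm (\<phi> (bergman_partial g N) - \<phi> g) \<le>
          C * bergman_norm (\<lambda>z. g z - bergman_partial g N z)) sequentially"
      proof (intro always_eventually allI)
        fix N
        have "\<phi> (\<lambda>z. g z - bergman_partial g N z) = \<phi> g - \<phi> (bergman_partial g N)"
          using lin[OF g bergman_partial_in, of 1 "-1" g N] by simp
        then show "norm (\<phi> (bergman_partial g N) - \<phi> g) \<le> C * bergman_norm (\<lambda>z. g z - bergman_partial g N z)"
          using bd[OF bergman_diff[OF g bergman_partial_in], of g N] by (simp add: norm_minus_commute)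
      qed
    qed simp
    then have "(\<lambda>N. \<phi> (bergman_partial g N)) \<longlonglongrightarrow> \<phi> g" by (simp add: LIM_zero_iff)
    with 1 show ?thesis by (rule LIMSEQ_unique)
  qed
  \<comment> \<open>Testing on \<open>G\<close> itself gives the norm bound.\<close>
  have "(bergman_norm G)\<^sup>2 = cmod (\<phi> G)"
    using bergman_inner_self[of G] inner[OF G(1)] by (simp add: norm_power)
  also have "\<dots> \<le> C * bergman_norm G" by (rule bd[OF G(1)])
  finally have "bergman_norm G * bergman_norm G \<le> C * bergman_norm G" by (simp add: power2_eq_square)
  then have "bergman_norm G \<le> C"
    using C bergman_norm_nonneg[of G] by (cases "bergman_norm G = 0") auto
  then show ?thesis using G(1) inner that by blast
qed

section \<open>The Bergman kernel and point evaluation\<close>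

lemma bergman_kernel_series:
  assumes "z \<in> unit_disk" "w \<in> unit_disk"
  shows "(\<lambda>n. (of_nat n + 1) * cnj z ^ n * w ^ n) sums bergman_kernel z w"
proof -
  have "cmod z * cmod w < 1 * 1"
    using assms by (intro mult_strict_mono') auto
  then have "norm (cnj z * w) < 1" by (simp add: norm_mult)
  from geometric_deriv_sums[OF this] show ?thesis
    using assms by (simp add: bergman_kernel_def power_mult_distrib mult.assoc add.commute)
qed

lemma taylor_coeff_kernel: "z \<in> unit_disk \<Longrightarrow> taylor_coeff (bergman_kernel z) n = (of_nat n + 1) * cnj z ^ n"
  by (rule taylor_coeff_unique) (rule bergman_kernel_series)

lemma bergman_kernel_in [simp]:
  assumes z: "z \<in> unit_disk"
  shows "bergman_kernel z \<in> bergman"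
proof (rule bergmanI_taylor)
  show "bergman_kernel z holomorphic_on unit_disk"
    by (rule power_series_holomorphic) (use bergman_kernel_series[OF z] in simp)
  have "(cmod z)\<^sup>2 < 1" using z by (simp add: abs_square_less_1)
  then have "summable (\<lambda>n. (real n + 1) * ((cmod z)\<^sup>2) ^ n)" by (intro summable_Suc_power) auto
  also have "(\<lambda>n. (real n + 1) * ((cmod z)\<^sup>2) ^ n) =
      (\<lambda>n. (cmod (taylor_coeff (bergman_kernel z) n))\<^sup>2 / (real n + 1))"
  proof
    fix n
    have "cmod (of_nat n + 1) = real n + 1"
      using norm_of_nat[of "Suc n", where 'a = complex] by (simp add: add.commute)
    then show "(real n + 1) * ((cmod z)\<^sup>2) ^ n = (cmod (taylor_coeff (bergman_kernel z) n))\<^sup>2 / (real n + 1)"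
      by (simp add: taylor_coeff_kernel[OF z] norm_mult norm_power power_mult_distrib power2_eq_square)
  qed
  finally show "summable (\<lambda>n. (cmod (taylor_coeff (bergman_kernel z) n))\<^sup>2 / (real n + 1))" .
qed (simp add: bergman_kernel_def)

text \<open>Pairing \<open>f\<close> with truncations of the kernel returns the Taylor partial sums
  of \<open>f\<close> at \<open>z\<close>, the factors n + 1 cancelling.\<close>

lemma bergman_reproducing:
  assumes f: "f \<in> bergman" and z: "z \<in> unit_disk"
  shows "bergman_inner f (bergman_kernel z) = f z"
proof (rule LIMSEQ_unique)
  show "(\<lambda>N. bergman_inner f (bergman_partial (bergman_kernel z) N)) \<longlonglongrightarrow> bergman_inner f (bergman_kernel z)"
    by (intro bergman_inner_partial_tendsto f bergman_kernel_in z)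
  note n1 = of_nat_plus_one_neq_zero[where 'a = complex]
  have "bergman_inner f (bergman_partial (bergman_kernel z) N) = (\<Sum>n<N. taylor_coeff f n * z ^ n)" for N
    unfolding bergman_partial_def
    by (subst bergman_inner_sum_right) (auto simp: f bergman_inner_monomial taylor_coeff_kernel[OF z] n1 intro!: sum.cong)
  then show "(\<lambda>N. bergman_inner f (bergman_partial (bergman_kernel z) N)) \<longlonglongrightarrow> f z"
    using taylor_sums[OF bergman_holomorphic[OF f] z] by (simp add: sums_def)
qed

text \<open>By the reproducing property the squared norm is the value of the kernel on the
  diagonal.\<close>

lemma bergman_kernel_norm:
  assumes z: "z \<in> unit_disk"
  shows "bergman_norm (bergman_kernel z) = 1 / (1 - (cmod z)\<^sup>2)"
proof -
  have lt: "(cmod z)\<^sup>2 < 1" using z by (simp add: abs_square_less_1)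
  have "complex_of_real ((bergman_norm (bergman_kernel z))\<^sup>2) = bergman_kernel z z"
    using bergman_reproducing[OF bergman_kernel_in[OF z] z] by (simp only: bergman_inner_self)
  also have "\<dots> = 1 / (1 - z * cnj z)\<^sup>2" using z by (simp add: bergman_kernel_def mult.commute)
  also have "\<dots> = complex_of_real ((1 / (1 - (cmod z)\<^sup>2))\<^sup>2)"
    unfolding complex_norm_square[symmetric] by (simp add: power_divide)
  finally have "(bergman_norm (bergman_kernel z))\<^sup>2 = (1 / (1 - (cmod z)\<^sup>2))\<^sup>2" by (simp only: of_real_eq_iff)
  then show ?thesis by (rule power2_eq_imp_eq) (use lt in auto)
qed

lemma bergman_pointwise_bound:
  assumes "f \<in> bergman" "z \<in> unit_disk"
  shows "cmod (f z) \<le> bergman_norm f / (1 - (cmod z)\<^sup>2)"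
  using bergman_Cauchy_Schwarz[OF assms(1) bergman_kernel_in[OF assms(2)]] assms
  by (simp add: bergman_reproducing bergman_kernel_norm)

lemma bergman_norm_zero_iff:
  assumes "f \<in> bergman" shows "bergman_norm f = 0 \<longleftrightarrow> f = (\<lambda>_. 0)"
proof
  assume "bergman_norm f = 0"
  then have "f z = 0" for z
    using bergman_pointwise_bound[OF assms, of z] bergman_outside[OF assms, of z] by (cases "z \<in> unit_disk") auto
  then show "f = (\<lambda>_. 0)" by auto
qed simp

section \<open>Operators given by bounded sesquilinear forms\<close>

definition form_operator ::
    "((complex \<Rightarrow> complex) \<Rightarrow> (complex \<Rightarrow> complex) \<Rightarrow> complex) \<Rightarrow> (complex \<Rightarrow> complex) \<Rightarrow> complex \<Rightarrow> complex" where
  "form_operator B f z = (if z \<in> unit_disk then B f (bergman_kernel z) else 0)"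

definition bounded_form :: "((complex \<Rightarrow> complex) \<Rightarrow> (complex \<Rightarrow> complex) \<Rightarrow> complex) \<Rightarrow> bool" where
  "bounded_form B \<longleftrightarrow>
     (\<forall>f\<in>bergman. \<forall>g\<in>bergman. \<forall>h\<in>bergman. \<forall>a b.
        B (\<lambda>z. a * f z + b * g z) h = a * B f h + b * B g h \<and>
        B h (\<lambda>z. a * f z + b * g z) = cnj a * B h f + cnj b * B h g) \<and>
     (\<exists>C\<ge>0. \<forall>f\<in>bergman. \<forall>g\<in>bergman. cmod (B f g) \<le> C * bergman_norm f * bergman_norm g)"

text \<open>For each \<open>f\<close> Riesz yields a vector representing \<open>B f\<close>; pairing
  it with kernels identifies it as \<open>form_operator B f\<close>. Thus an operator given only by
  values at kernels, the shape of \<open>toeplitz_operator\<close>, satisfies the form identity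
  against all \<open>g\<close>.\<close>

lemma form_operator_Riesz:
  assumes B: "bounded_form B"
  obtains C where "0 \<le> C" "\<And>f. f \<in> bergman \<Longrightarrow> form_operator B f \<in> bergman"
    "\<And>f g. f \<in> bergman \<Longrightarrow> g \<in> bergman \<Longrightarrow> bergman_inner (form_operator B f) g = B f g"
    "\<And>f. f \<in> bergman \<Longrightarrow> bergman_norm (form_operator B f) \<le> C * bergman_norm f"
proof -
  obtain C where C: "C \<ge> 0" "\<And>f g. f \<in> bergman \<Longrightarrow> g \<in> bergman \<Longrightarrow> cmod (B f g) \<le> C * bergman_norm f * bergman_norm g"
    using B unfolding bounded_form_def by blast
  have "form_operator B f \<in> bergman \<and> (\<forall>g\<in>bergman. bergman_inner (form_operator B f) g = B f g) \<and>
      bergman_norm (form_operator B f) \<le> C * bergman_norm f" if f: "f \<in> bergman" for f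
  proof -
    obtain G where G: "G \<in> bergman" "\<And>g. g \<in> bergman \<Longrightarrow> bergman_inner G g = B f g" "bergman_norm G \<le> C * bergman_norm f"
    proof (rule bergman_Riesz[of "B f" "C * bergman_norm f"])
      show "B f (\<lambda>z. a * g z + b * h z) = cnj a * B f g + cnj b * B f h" if "g \<in> bergman" "h \<in> bergman" for g h a b
        using B f that unfolding bounded_form_def by blast
    qed (use C f in auto)
    have "form_operator B f = G"
    proof
      fix z show "form_operator B f z = G z"
        using G(2)[of "bergman_kernel z"] bergman_reproducing[OF G(1), of z] bergman_outside[OF G(1), of z]
        by (auto simp: form_operator_def)
    qed
    then show ?thesis using G by simp
  qed
  then show ?thesis using C(1) that by blast
qed

lemma bergman_operator_form_operator:
  assumes B: "bounded_form B"
  shows "bergman_operator (form_operator B)"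
proof -
  obtain C where "0 \<le> C" "\<And>f. f \<in> bergman \<Longrightarrow> form_operator B f \<in> bergman"
    "\<And>f. f \<in> bergman \<Longrightarrow> bergman_norm (form_operator B f) \<le> C * bergman_norm f"
    by (rule form_operator_Riesz[OF B], rule that)
  moreover have "form_operator B (\<lambda>z. a * f z + b * g z) = (\<lambda>z. a * form_operator B f z + b * form_operator B g z)"
    if "f \<in> bergman" "g \<in> bergman" for f g a b
    using B that unfolding bounded_form_def form_operator_def fun_eq_iff by auto
  ultimately show ?thesis unfolding bergman_operator_def by blast
qed

section \<open>Derivatives as functionals\<close>

lemma bergman_deriv_lincomb:
  assumes "f \<in> bergman" "g \<in> bergman" "w \<in> unit_disk"
  shows "(deriv ^^ n) (\<lambda>z. a * f z + b * g z) w = a * (deriv ^^ n) f w + b * (deriv ^^ n) g w"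
proof -
  note h = bergman_holomorphic[OF assms(1)] bergman_holomorphic[OF assms(2)]
  have "(deriv ^^ n) (\<lambda>z. a * f z + b * g z) w = (deriv ^^ n) (\<lambda>z. a * f z) w + (deriv ^^ n) (\<lambda>z. b * g z) w"
    using assms(3) h by (intro higher_deriv_add[of _ unit_disk] holomorphic_intros) auto
  also have "(deriv ^^ n) (\<lambda>z. a * f z) w = a * (deriv ^^ n) f w"
    using assms(3) h by (intro higher_deriv_cmult[of _ unit_disk]) auto
  also have "(deriv ^^ n) (\<lambda>z. b * g z) w = b * (deriv ^^ n) g w"
    using assms(3) h by (intro higher_deriv_cmult[of _ unit_disk]) auto
  finally show ?thesis .
qed

text \<open>Cauchy's estimate on the disk about \<open>w\<close> of half the distance to the circle,
  where \<open>f\<close> is bounded by its norm over the radius. The constant 4^(n + 1) comes from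
  (1 - |w|^2) / 4 \<le> r, used n + 1 times.\<close>

lemma bergman_deriv_bound:
  assumes f: "f \<in> bergman" and w: "w \<in> unit_disk"
  shows "cmod ((deriv ^^ n) f w) \<le> fact n * 4 ^ (n + 1) * bergman_norm f / (1 - (cmod w)\<^sup>2) ^ (n + 1)"
proof -
  have lt: "cmod w < 1" using w by simp
  have sq: "(cmod w)\<^sup>2 < 1" using lt by (simp add: abs_square_less_1)
  define d where "d = 1 - (cmod w)\<^sup>2"
  have d: "d > 0" using sq by (simp add: d_def)
  \<comment> \<open>The form of Cauchy's estimate below needs n > 0 and a strict bound on
    \<open>f\<close>, hence a positive norm; the other two cases are direct.\<close>
  consider "n = 0" | "bergman_norm f = 0" | "n > 0" "bergman_norm f > 0"
  proof -
    have "bergman_norm f = 0 \<or> bergman_norm f > 0"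
      using bergman_norm_nonneg[of f] by linarith
    moreover have "n = 0 \<or> n > 0" by blast
    ultimately show ?thesis using that by blast
  qed
  then show ?thesis
  proof cases
    case 1
    have "bergman_norm f / d \<le> 4 * bergman_norm f / d" using d by (intro divide_right_mono) auto
    then show ?thesis using bergman_pointwise_bound[OF f w] 1 by (simp add: d_def)
  next
    case 2
    then have "f = (\<lambda>_. 0)" using bergman_norm_zero_iff[OF f] by simp
    then show ?thesis by simp
  next
    case 3
    define r where "r = (1 - cmod w) / 2"
    have r: "r > 0" using lt by (simp add: r_def)
    have "d = (1 - cmod w) * (1 + cmod w)" by (simp add: d_def power2_eq_square algebra_simps)
    also have "\<dots> \<le> (1 - cmod w) * 2" using lt by (intro mult_left_mono) auto
    finally have dr: "d / 4 \<le> r" by (simp add: r_def)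
    have "cmod z \<le> cmod w + r" if "z \<in> cball w r" for z
      using that norm_triangle_sub[of z w] by (simp add: dist_norm norm_minus_commute)
    moreover have "cmod w + r < 1" using lt by (simp add: r_def field_simps)
    ultimately have sub: "cball w r \<subseteq> unit_disk" by (intro subsetI) (fastforce intro: le_less_trans)
    have "cmod ((deriv ^^ n) f w) \<le> fact n * (bergman_norm f / r) / r ^ n"
    proof (rule Cauchy_higher_deriv_bound[where y = 0])
      show "f holomorphic_on ball w r"
        using bergman_holomorphic[OF f] sub ball_subset_cball holomorphic_on_subset by blast
      show "continuous_on (cball w r) f"
        using holomorphic_on_imp_continuous_on[OF bergman_holomorphic[OF f]] sub continuous_on_subset by blast
      fix z assume z: "z \<in> ball w r"
      then have wz: "cmod z < cmod w + r"
        using norm_triangle_sub[of z w] by (simp add: dist_norm norm_minus_commute)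
      have zr: "r < 1 - cmod z" using wz unfolding r_def by argo
      then have zr1: "cmod z < 1" using r by linarith
      have "1 - cmod z \<le> 1 - (cmod z)\<^sup>2" using zr1 by (simp add: power2_eq_square mult_left_le)
      then have "r < 1 - (cmod z)\<^sup>2" using zr by linarith
      then have "bergman_norm f / (1 - (cmod z)\<^sup>2) < bergman_norm f / r"
        using r 3 by (intro divide_strict_left_mono) auto
      then show "f z \<in> ball 0 (bergman_norm f / r)"
        using bergman_pointwise_bound[OF f, of z] zr1 by simp
    qed (use r 3 in auto)
    also have "\<dots> = fact n * bergman_norm f / r ^ (n + 1)" by simp
    also have "\<dots> \<le> fact n * bergman_norm f / (d / 4) ^ (n + 1)"
      using dr d 3 r by (intro divide_left_mono power_mono mult_pos_pos zero_less_power) auto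
    also have "\<dots> = fact n * 4 ^ (n + 1) * bergman_norm f / d ^ (n + 1)"
      by (simp add: power_divide)
    finally show ?thesis by (simp add: d_def)
  qed
qed

definition deriv_bound :: "nat \<Rightarrow> complex \<Rightarrow> real" where
  "deriv_bound n w = fact n * 4 ^ (n + 1) / (1 - (cmod w)\<^sup>2) ^ (n + 1)"

lemma deriv_bound_mult:
  "deriv_bound \<alpha> w * deriv_bound \<beta> w =
    (fact \<alpha> * 4 ^ (\<alpha> + 1) * (fact \<beta> * 4 ^ (\<beta> + 1))) * (1 / (1 - (cmod w)\<^sup>2) ^ (\<alpha> + \<beta> + 2))"
proof -
  have "(1 - (cmod w)\<^sup>2) ^ (\<alpha> + \<beta> + 2) = (1 - (cmod w)\<^sup>2) ^ (\<alpha> + 1) * (1 - (cmod w)\<^sup>2) ^ (\<beta> + 1)"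
    by (simp flip: power_add)
  moreover have "c / x * (d / y) = c * d * (1 / (x * y))" for c d x y :: real by simp
  ultimately show ?thesis unfolding deriv_bound_def by (simp only:)
qed

lemma disk_one_minus_pos: "w \<in> unit_disk \<Longrightarrow> 0 < 1 - (cmod w)\<^sup>2"
  by (simp add: abs_square_less_1)

lemma deriv_bound_nonneg: "w \<in> unit_disk \<Longrightarrow> 0 \<le> deriv_bound n w"
  using disk_one_minus_pos[of w] by (simp add: deriv_bound_def)

lemma bergman_deriv_le:
  assumes "f \<in> bergman" "w \<in> unit_disk"
  shows "cmod ((deriv ^^ n) f w) \<le> deriv_bound n w * bergman_norm f"
  using bergman_deriv_bound[OF assms, of n] by (simp add: deriv_bound_def)

lemma has_field_derivative_inverse_power:
  fixes a w :: complex
  assumes "1 - a * w \<noteq> 0"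
  shows "((\<lambda>v. 1 / (1 - a * v) ^ m) has_field_derivative of_nat m * a / (1 - a * w) ^ Suc m) (at w)"
proof (cases m)
  case (Suc k)
  have "((\<lambda>v. inverse (1 - a * v)) has_field_derivative a * inverse (1 - a * w) ^ 2) (at w)"
    using assms by (auto intro!: derivative_eq_intros simp: power2_eq_square)
  from DERIV_power_Suc[OF this, of k] show ?thesis
    by (simp add: Suc divide_inverse power_inverse power2_eq_square mult_ac)
qed simp

lemma deriv_kernel:
  assumes z: "z \<in> unit_disk" and w: "w \<in> unit_disk"
  shows "(deriv ^^ n) (bergman_kernel z) w = fact (n + 1) * cnj z ^ n / (1 - cnj z * w) ^ (n + 2)"
  using w
proof (induction n arbitrary: w)
  case 0
  then show ?case by (simp add: bergman_kernel_def power2_eq_square)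
next
  case (Suc n)
  let ?F = "\<lambda>w. fact (n + 1) * cnj z ^ n / (1 - cnj z * w) ^ (n + 2)"
  have "cmod z * cmod w < 1 * 1" using z Suc.prems by (intro mult_strict_mono') auto
  then have "cnj z * w \<noteq> 1" by (metis complex_mod_cnj mult_1 norm_mult norm_one less_irrefl)
  then have ne: "1 - cnj z * w \<noteq> 0" by simp
  have "deriv ((deriv ^^ n) (bergman_kernel z)) w = deriv ?F w"
  proof (rule deriv_cong_ev)
    show "eventually (\<lambda>v. (deriv ^^ n) (bergman_kernel z) v = ?F v) (nhds w)"
      using eventually_nhds_in_open[OF open_ball Suc.prems] by eventually_elim (rule Suc.IH)
  qed simp
  also have "\<dots> = fact (n + 2) * cnj z ^ (n + 1) / (1 - cnj z * w) ^ (n + 3)"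
  proof (rule DERIV_imp_deriv)
    have "((\<lambda>w. fact (n + 1) * cnj z ^ n * (1 / (1 - cnj z * w) ^ (n + 2))) has_field_derivative
        fact (n + 1) * cnj z ^ n * (of_nat (n + 2) * cnj z / (1 - cnj z * w) ^ Suc (n + 2))) (at w)"
      by (intro DERIV_cmult has_field_derivative_inverse_power ne)
    moreover have "fact (n + 1) * cnj z ^ n * (of_nat (n + 2) * cnj z / (1 - cnj z * w) ^ Suc (n + 2)) =
        fact (n + 2) * cnj z ^ (n + 1) / (1 - cnj z * w) ^ (n + 3)"
      by (simp add: eval_nat_numeral mult_ac)
    ultimately show "(?F has_field_derivative fact (n + 2) * cnj z ^ (n + 1) / (1 - cnj z * w) ^ (n + 3)) (at w)"
      by simp
  qed
  finally show ?case by (simp add: eval_nat_numeral)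
qed

text \<open>As a function of \<open>z\<close>, the conjugate of the n-th derivative of
  \<open>bergman_kernel z\<close> at \<open>w\<close>; cut off outside the disk.\<close>

definition kernel_deriv :: "nat \<Rightarrow> complex \<Rightarrow> complex \<Rightarrow> complex" where
  "kernel_deriv n w z = (if z \<in> unit_disk then fact (n + 1) * z ^ n / (1 - z * cnj w) ^ (n + 2) else 0)"

text \<open>Riesz provides a representer; its value at \<open>z\<close> is its pairing with the
  kernel at \<open>z\<close>, which \<open>deriv_kernel\<close> computes.\<close>

lemma kernel_deriv_reproducing:
  assumes w: "w \<in> unit_disk"
  shows "kernel_deriv n w \<in> bergman"
    and "\<And>g. g \<in> bergman \<Longrightarrow> bergman_inner g (kernel_deriv n w) = (deriv ^^ n) g w"
proof -
  obtain G where G: "G \<in> bergman" "\<And>g. g \<in> bergman \<Longrightarrow> bergman_inner G g = cnj ((deriv ^^ n) g w)"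
  proof (rule bergman_Riesz[of "\<lambda>g. cnj ((deriv ^^ n) g w)" "deriv_bound n w"])
    show "cmod (cnj ((deriv ^^ n) f w)) \<le> deriv_bound n w * bergman_norm f" if "f \<in> bergman" for f
      using bergman_deriv_le[OF that w] by simp
    show "cnj ((deriv ^^ n) (\<lambda>z. a * f z + b * g z) w) = cnj a * cnj ((deriv ^^ n) f w) + cnj b * cnj ((deriv ^^ n) g w)"
      if "f \<in> bergman" "g \<in> bergman" for f g a b
      by (simp add: bergman_deriv_lincomb[OF that w])
  qed (use deriv_bound_nonneg[OF w] in auto)
  have "G = kernel_deriv n w"
  proof
    fix z show "G z = kernel_deriv n w z"
    proof (cases "z \<in> unit_disk")
      case True
      have "G z = cnj ((deriv ^^ n) (bergman_kernel z) w)"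
        using bergman_reproducing[OF G(1) True] G(2)[OF bergman_kernel_in[OF True]] by simp
      then show ?thesis using True by (simp add: deriv_kernel[OF True w] kernel_deriv_def)
    next
      case False
      then show ?thesis using bergman_outside[OF G(1)] by (simp add: kernel_deriv_def)
    qed
  qed
  then show "kernel_deriv n w \<in> bergman" "\<And>g. g \<in> bergman \<Longrightarrow> bergman_inner g (kernel_deriv n w) = (deriv ^^ n) g w"
    using G by (auto simp: bergman_inner_commute[of _ "kernel_deriv n w"])
qed

section \<open>Orthonormal families\<close>

text \<open>Indexed rather than a set of vectors, because the vectors \<open>e\<close> and the
  normalized images of \<open>T e\<close> are compared over the same indices.\<close>

definition orthonormal :: "'i set \<Rightarrow> ('i \<Rightarrow> complex \<Rightarrow> complex) \<Rightarrow> bool" where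
  "orthonormal I u \<longleftrightarrow> (\<forall>i\<in>I. u i \<in> bergman) \<and>
     (\<forall>i\<in>I. \<forall>j\<in>I. bergman_inner (u i) (u j) = (if i = j then 1 else 0))"

lemma orthonormal_subset: "orthonormal I u \<Longrightarrow> J \<subseteq> I \<Longrightarrow> orthonormal J u"
  unfolding orthonormal_def by blast

lemma bergman_onb_orthonormal: "bergman_onb E \<Longrightarrow> orthonormal E (\<lambda>e. e)"
  by (auto simp: bergman_onb_def orthonormal_def)

lemma orthonormal_norm_sum:
  assumes "orthonormal I u" "finite I"
  shows "(bergman_norm (\<lambda>z. \<Sum>i\<in>I. c i * u i z))\<^sup>2 = (\<Sum>i\<in>I. (cmod (c i))\<^sup>2)"
proof -
  have u: "u i \<in> bergman" if "i \<in> I" for i using assms that by (auto simp: orthonormal_def)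
  let ?h = "\<lambda>z. \<Sum>i\<in>I. c i * u i z"
  have h: "?h \<in> bergman" by (intro bergman_sum u)
  have "complex_of_real ((bergman_norm ?h)\<^sup>2) = bergman_inner ?h ?h" by (rule bergman_inner_self[symmetric])
  also have "\<dots> = (\<Sum>j\<in>I. cnj (c j) * bergman_inner ?h (u j))"
    by (intro bergman_inner_sum_right u h)
  also have "\<dots> = (\<Sum>j\<in>I. of_real ((cmod (c j))\<^sup>2))"
  proof (intro sum.cong refl)
    fix j assume j: "j \<in> I"
    have "bergman_inner ?h (u j) = (\<Sum>i\<in>I. c i * bergman_inner (u i) (u j))"
      by (intro bergman_inner_sum u j)
    also have "\<dots> = (\<Sum>i\<in>I. if i = j then c j else 0)"
      using assms(1) j by (intro sum.cong refl) (auto simp: orthonormal_def)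
    also have "\<dots> = c j" using j assms(2) by simp
    finally show "cnj (c j) * bergman_inner ?h (u j) = of_real ((cmod (c j))\<^sup>2)"
      by (simp only: complex_norm_square mult.commute)
  qed
  also have "\<dots> = of_real (\<Sum>j\<in>I. (cmod (c j))\<^sup>2)" by (simp only: of_real_sum)
  finally show ?thesis by (simp only: of_real_eq_iff)
qed

text \<open>The functional is tested on the combination of the u_i with coefficients conj (L u_i):
  its value there and the squared norm both equal the left-hand side. Bessel's inequality and the
  bound for derivatives are instances, with a constant independent of the index set.\<close>

lemma orthonormal_functional_bound:
  assumes u: "orthonormal I u" "finite I"
    and L: "\<And>f g a b. f \<in> bergman \<Longrightarrow> g \<in> bergman \<Longrightarrow> L (\<lambda>z. a * f z + b * g z) = a * L f + b * L g"
    and bd: "\<And>f. f \<in> bergman \<Longrightarrow> cmod (L f) \<le> K * bergman_norm f"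
  shows "(\<Sum>i\<in>I. (cmod (L (u i)))\<^sup>2) \<le> K\<^sup>2"
proof -
  have ub: "u i \<in> bergman" if "i \<in> I" for i using u that by (auto simp: orthonormal_def)
  define s where "s = (\<Sum>i\<in>I. (cmod (L (u i)))\<^sup>2)"
  have s0: "0 \<le> s" unfolding s_def by (intro sum_nonneg) simp
  have Lsum: "L (\<lambda>z. \<Sum>i\<in>J. c i * u i z) = (\<Sum>i\<in>J. c i * L (u i))" if "finite J" "J \<subseteq> I" for J c
    using that
  proof (induction J rule: finite_induct)
    case empty
    show ?case using L[of "\<lambda>_. 0" "\<lambda>_. 0" 0 0] by simp
  next
    case (insert x J)
    have "(\<lambda>z. \<Sum>i\<in>J. c i * u i z) \<in> bergman" using insert ub by (intro bergman_sum) auto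
    from L[OF ub this, of x "c x" 1] insert show ?case by simp
  qed
  let ?h = "\<lambda>z. \<Sum>i\<in>I. cnj (L (u i)) * u i z"
  have h: "?h \<in> bergman" by (intro bergman_sum ub)
  have "L ?h = (\<Sum>i\<in>I. of_real ((cmod (L (u i)))\<^sup>2))"
    unfolding Lsum[OF u(2) order_refl] by (intro sum.cong refl) (simp only: complex_norm_square mult.commute)
  then have "L ?h = of_real s" unfolding s_def by (simp only: of_real_sum)
  then have "s \<le> K * bergman_norm ?h" using bd[OF h] s0 by simp
  then have "s\<^sup>2 \<le> (K * bergman_norm ?h)\<^sup>2" using s0 by (intro power_mono)
  also have "\<dots> = K\<^sup>2 * s" by (simp add: power_mult_distrib orthonormal_norm_sum[OF u] s_def)
  finally have "s * s \<le> K\<^sup>2 * s" by (simp add: power2_eq_square)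
  then have "s \<le> K\<^sup>2" using s0 by (cases "s = 0") auto
  then show ?thesis by (simp add: s_def)
qed

lemma Bessel:
  assumes "orthonormal I u" "finite I" "g \<in> bergman"
  shows "(\<Sum>i\<in>I. (cmod (bergman_inner (u i) g))\<^sup>2) \<le> (bergman_norm g)\<^sup>2"
  by (rule orthonormal_functional_bound[OF assms(1,2)])
     (use assms(3) bergman_Cauchy_Schwarz in \<open>auto simp: bergman_inner_lincomb mult.commute\<close>)

lemma orthonormal_deriv_bound:
  assumes "orthonormal I u" "finite I" "w \<in> unit_disk"
  shows "(\<Sum>i\<in>I. (cmod ((deriv ^^ n) (u i) w))\<^sup>2) \<le> (deriv_bound n w)\<^sup>2"
  by (rule orthonormal_functional_bound[OF assms(1,2), where L = "\<lambda>f. (deriv ^^ n) f w"])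
     (rule bergman_deriv_lincomb bergman_deriv_le; (assumption | rule assms))+

lemma sum_mult_le_sqrt:
  fixes a b :: "'i \<Rightarrow> real"
  assumes "(\<Sum>i\<in>I. (a i)\<^sup>2) \<le> A\<^sup>2" "(\<Sum>i\<in>I. (b i)\<^sup>2) \<le> B\<^sup>2" "0 \<le> A" "0 \<le> B"
  shows "(\<Sum>i\<in>I. a i * b i) \<le> A * B"
proof (rule power2_le_imp_le)
  have "(\<Sum>i\<in>I. a i * b i)\<^sup>2 \<le> (\<Sum>i\<in>I. (a i)\<^sup>2) * (\<Sum>i\<in>I. (b i)\<^sup>2)" by (rule Cauchy_Schwarz_ineq_sum)
  also have "\<dots> \<le> A\<^sup>2 * B\<^sup>2" using assms by (intro mult_mono sum_nonneg) auto
  finally show "(\<Sum>i\<in>I. a i * b i)\<^sup>2 \<le> (A * B)\<^sup>2" by (simp add: power_mult_distrib)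
qed (use assms in simp)

section \<open>Diagonal forms, Parseval's identity and countability of bases\<close>

definition diagonal_form ::
    "((complex \<Rightarrow> complex) set) \<Rightarrow> ((complex \<Rightarrow> complex) \<Rightarrow> real) \<Rightarrow> (complex \<Rightarrow> complex) \<Rightarrow> (complex \<Rightarrow> complex) \<Rightarrow> complex" where
  "diagonal_form E s f g = (\<Sum>\<^sub>\<infinity>e\<in>E. of_real (s e) * (bergman_inner f e * bergman_inner e g))"

text \<open>Bessel's inequality for \<open>f\<close> and for \<open>g\<close>, joined by
  Cauchy-Schwarz, uniformly in \<open>F\<close>. The absolute value of \<open>S\<close> covers empty
  \<open>E\<close>, where \<open>S\<close> is unconstrained.\<close>

lemma diagonal_sum_le:
  assumes E: "orthonormal E (\<lambda>e. e)" and s: "\<And>e. e \<in> E \<Longrightarrow> \<bar>s e\<bar> \<le> S"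
    and f: "f \<in> bergman" and g: "g \<in> bergman" and F: "finite F" "F \<subseteq> E"
  shows "(\<Sum>e\<in>F. cmod (of_real (s e) * (bergman_inner f e * bergman_inner e g))) \<le> \<bar>S\<bar> * (bergman_norm f * bergman_norm g)"
proof -
  have o: "orthonormal F (\<lambda>e. e)" using E F(2) by (rule orthonormal_subset)
  have "(\<Sum>e\<in>F. cmod (of_real (s e) * (bergman_inner f e * bergman_inner e g))) \<le>
      (\<Sum>e\<in>F. \<bar>S\<bar> * (cmod (bergman_inner e f) * cmod (bergman_inner e g)))"
  proof (rule sum_mono)
    fix e assume "e \<in> F"
    then have "\<bar>s e\<bar> \<le> \<bar>S\<bar>" using s[of e] F(2) by force
    moreover have "cmod (bergman_inner f e) = cmod (bergman_inner e f)" by (subst bergman_inner_commute) simp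
    ultimately show "cmod (of_real (s e) * (bergman_inner f e * bergman_inner e g)) \<le> \<bar>S\<bar> * (cmod (bergman_inner e f) * cmod (bergman_inner e g))"
      by (simp add: norm_mult mult_right_mono)
  qed
  also have "\<dots> = \<bar>S\<bar> * (\<Sum>e\<in>F. cmod (bergman_inner e f) * cmod (bergman_inner e g))" by (rule sum_distrib_left[symmetric])
  also have "\<dots> \<le> \<bar>S\<bar> * (bergman_norm f * bergman_norm g)"
    by (intro mult_left_mono sum_mult_le_sqrt Bessel[OF o F(1) f] Bessel[OF o F(1) g]) auto
  finally show ?thesis .
qed

lemma diagonal_summable:
  assumes E: "orthonormal E (\<lambda>e. e)" and s: "\<And>e. e \<in> E \<Longrightarrow> \<bar>s e\<bar> \<le> S"
    and f: "f \<in> bergman" and g: "g \<in> bergman"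
  shows "(\<lambda>e. norm (complex_of_real (s e) * (bergman_inner f e * bergman_inner e g))) summable_on E"
  unfolding Infinite_Sum.abs_summable_iff_bdd_above
  by (rule bdd_aboveI2) (use diagonal_sum_le[OF E s f g] in auto)

text \<open>Makes diagonal operators available through \<open>form_operator\<close>: entries 1 give
  the expansion in a basis, singular values give the modulus.\<close>

lemma diagonal_form_bounded:
  assumes E: "orthonormal E (\<lambda>e. e)" and s: "\<And>e. e \<in> E \<Longrightarrow> \<bar>s e\<bar> \<le> S"
  shows "bounded_form (diagonal_form E s)"
  unfolding bounded_form_def
proof (intro conjI ballI allI exI)
  have Eb: "e \<in> bergman" if "e \<in> E" for e using E that by (auto simp: orthonormal_def)
  fix f g h a b assume fgh: "f \<in> bergman" "g \<in> bergman" "h \<in> bergman"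
  note sm = Infinite_Sum.abs_summable_summable[OF diagonal_summable[OF E s]]
  let ?t = "\<lambda>f g e. of_real (s e) * (bergman_inner f e * bergman_inner e g)"
  have "diagonal_form E s (\<lambda>z. a * f z + b * g z) h = (\<Sum>\<^sub>\<infinity>e\<in>E. a * ?t f h e + b * ?t g h e)"
    unfolding diagonal_form_def
    by (intro infsum_cong) (simp add: bergman_inner_lincomb fgh Eb algebra_simps)
  also have "\<dots> = (\<Sum>\<^sub>\<infinity>e\<in>E. a * ?t f h e) + (\<Sum>\<^sub>\<infinity>e\<in>E. b * ?t g h e)"
    by (intro infsum_add summable_on_cmult_right sm fgh)
  finally show "diagonal_form E s (\<lambda>z. a * f z + b * g z) h = a * diagonal_form E s f h + b * diagonal_form E s g h"
    by (simp add: infsum_cmult_right' diagonal_form_def)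
  have "diagonal_form E s h (\<lambda>z. a * f z + b * g z) = (\<Sum>\<^sub>\<infinity>e\<in>E. cnj a * ?t h f e + cnj b * ?t h g e)"
    unfolding diagonal_form_def
    by (intro infsum_cong) (simp add: bergman_inner_lincomb_right fgh Eb algebra_simps)
  also have "\<dots> = (\<Sum>\<^sub>\<infinity>e\<in>E. cnj a * ?t h f e) + (\<Sum>\<^sub>\<infinity>e\<in>E. cnj b * ?t h g e)"
    by (intro infsum_add summable_on_cmult_right sm fgh)
  finally show "diagonal_form E s h (\<lambda>z. a * f z + b * g z) = cnj a * diagonal_form E s h f + cnj b * diagonal_form E s h g"
    by (simp add: infsum_cmult_right' diagonal_form_def)
next
  show "0 \<le> \<bar>S\<bar>" by simp
  fix f g assume fg: "f \<in> bergman" "g \<in> bergman"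
  have "cmod (diagonal_form E s f g) \<le> (\<Sum>\<^sub>\<infinity>e\<in>E. cmod (of_real (s e) * (bergman_inner f e * bergman_inner e g)))"
    unfolding diagonal_form_def by (intro Infinite_Sum.norm_infsum_bound diagonal_summable[OF E s] fg)
  also have "\<dots> \<le> \<bar>S\<bar> * (bergman_norm f * bergman_norm g)"
    by (intro infsum_le_finite_sums diagonal_summable[OF E s] diagonal_sum_le[OF E s] fg)
  finally show "cmod (diagonal_form E s f g) \<le> \<bar>S\<bar> * bergman_norm f * bergman_norm g" by (simp add: mult.assoc)
qed

lemma diagonal_form_basis:
  assumes E: "orthonormal E (\<lambda>e. e)" and e: "e \<in> E"
  shows "diagonal_form E s f e = of_real (s e) * bergman_inner f e"
proof -
  have "diagonal_form E s f e = (\<Sum>\<^sub>\<infinity>e'\<in>{e}. of_real (s e') * (bergman_inner f e' * bergman_inner e' e))"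
    unfolding diagonal_form_def
    by (rule infsum_cong_neutral) (use E e in \<open>auto simp: orthonormal_def\<close>)
  then show ?thesis using E e by (simp add: orthonormal_def)
qed

lemma bergman_onb_complete:
  "bergman_onb E \<Longrightarrow> f \<in> bergman \<Longrightarrow> (\<And>e. e \<in> E \<Longrightarrow> bergman_inner f e = 0) \<Longrightarrow> f = (\<lambda>_. 0)"
  by (simp add: bergman_onb_def)

text \<open>A basis is only known to have trivial orthogonal complement. The diagonal operator with
  entries 1 sends \<open>f\<close> to a vector with the same coefficients, so the difference is
  orthogonal to the basis and vanishes.\<close>

lemma bergman_onb_Parseval:
  assumes E: "bergman_onb E" and f: "f \<in> bergman" and g: "g \<in> bergman"
  shows "((\<lambda>e. bergman_inner f e * bergman_inner e g) has_sum bergman_inner f g) E"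
proof -
  note o = bergman_onb_orthonormal[OF E]
  have Eb: "e \<in> bergman" if "e \<in> E" for e using o that by (auto simp: orthonormal_def)
  have s1: "\<bar>1::real\<bar> \<le> 1" by simp
  note bf = diagonal_form_bounded[OF o s1]
  obtain C where G: "0 \<le> C" "\<And>f. f \<in> bergman \<Longrightarrow> form_operator (diagonal_form E (\<lambda>_. 1)) f \<in> bergman"
    "\<And>f g. f \<in> bergman \<Longrightarrow> g \<in> bergman \<Longrightarrow>
        bergman_inner (form_operator (diagonal_form E (\<lambda>_. 1)) f) g = diagonal_form E (\<lambda>_. 1) f g"
    "\<And>f. f \<in> bergman \<Longrightarrow> bergman_norm (form_operator (diagonal_form E (\<lambda>_. 1)) f) \<le> C * bergman_norm f"
    by (rule form_operator_Riesz[OF bf], rule that)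
  define G' where "G' = form_operator (diagonal_form E (\<lambda>_. 1)) f"
  have G'b: "G' \<in> bergman" unfolding G'_def by (rule G(2)[OF f])
  have "bergman_inner (\<lambda>z. f z - G' z) e = 0" if "e \<in> E" for e
    using G(3)[OF f Eb[OF that]] diagonal_form_basis[OF o that, of "\<lambda>_. 1" f]
    unfolding bergman_inner_diff[OF f G'b Eb[OF that]] by (simp add: G'_def)
  then have "(\<lambda>z. f z - G' z) = (\<lambda>_. 0)"
    by (intro bergman_onb_complete[OF E] bergman_diff f G'b)
  then have "G' = f" by (auto simp: fun_eq_iff)
  then have "bergman_inner f g = diagonal_form E (\<lambda>_. 1) f g" using G(3)[OF f g] by (simp add: G'_def)
  moreover have "(\<lambda>e. bergman_inner f e * bergman_inner e g) summable_on E"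
    using Infinite_Sum.abs_summable_summable[OF diagonal_summable[OF o s1 f g]] by simp
  ultimately show ?thesis by (simp add: diagonal_form_def)
qed

text \<open>By Bessel each monomial has nonzero inner product with only countably many basis
  vectors, and a unit vector must have a nonzero Taylor coefficient. Countability permits summation
  under the integral sign.\<close>

lemma bergman_onb_countable:
  assumes E: "bergman_onb E" shows "countable E"
proof -
  note o = bergman_onb_orthonormal[OF E]
  have Eb: "e \<in> bergman" "bergman_inner e e = 1" if "e \<in> E" for e using o that by (auto simp: orthonormal_def)
  have "countable {e\<in>E. bergman_inner e (monomial n) \<noteq> 0}" for n
  proof -
    have "(\<lambda>e. (cmod (bergman_inner e (monomial n)))\<^sup>2) summable_on E"
    proof (rule nonneg_bdd_above_summable_on)
      show "bdd_above (sum (\<lambda>e. (cmod (bergman_inner e (monomial n)))\<^sup>2) ` {F. F \<subseteq> E \<and> finite F})"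
        by (rule bdd_aboveI2[where M = "(bergman_norm (monomial n))\<^sup>2"])
           (auto intro!: Bessel orthonormal_subset[OF o])
    qed simp
    from summable_countable_real[OF this] show ?thesis by simp
  qed
  then have "countable (\<Union>n. {e\<in>E. bergman_inner e (monomial n) \<noteq> 0})" by simp
  moreover have "E \<subseteq> (\<Union>n. {e\<in>E. bergman_inner e (monomial n) \<noteq> 0})"
  proof
    fix e assume e: "e \<in> E"
    have "\<exists>n. bergman_inner e (monomial n) \<noteq> 0"
    proof (rule ccontr)
      assume "\<not> ?thesis"
      then have "taylor_coeff e n = 0" for n
        using bergman_inner_monomial[OF Eb(1)[OF e], of n] by (simp add: of_nat_plus_one_neq_zero)
      then have "(bergman_norm e)\<^sup>2 = 0"
        using bergman_norm_sums[OF Eb(1)[OF e]] by (simp add: sums_iff)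
      then show False using Eb(2)[OF e] by (simp add: bergman_inner_self)
    qed
    then show "e \<in> (\<Union>n. {e\<in>E. bergman_inner e (monomial n) \<noteq> 0})" using e by auto
  qed
  ultimately show ?thesis by (rule countable_subset[rotated])
qed

text \<open>The order of the two representers in Parseval's identity puts the conjugate on the
  \<beta> factor; their pairing is again the evaluation of a derivative.\<close>

lemma onb_deriv_has_sum:
  assumes E: "bergman_onb E" and w: "w \<in> unit_disk"
  shows "((\<lambda>e. (deriv ^^ \<alpha>) e w * cnj ((deriv ^^ \<beta>) e w)) has_sum (deriv ^^ \<alpha>) (kernel_deriv \<beta> w) w) E"
proof -
  note o = bergman_onb_orthonormal[OF E]
  have Eb: "e \<in> bergman" if "e \<in> E" for e using o that by (auto simp: orthonormal_def)
  have 1: "((\<lambda>e. bergman_inner (kernel_deriv \<beta> w) e * bergman_inner e (kernel_deriv \<alpha> w)) has_sum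
      bergman_inner (kernel_deriv \<beta> w) (kernel_deriv \<alpha> w)) E"
    by (intro bergman_onb_Parseval[OF E] kernel_deriv_reproducing w)
  have 2: "bergman_inner (kernel_deriv \<beta> w) e * bergman_inner e (kernel_deriv \<alpha> w) =
      (deriv ^^ \<alpha>) e w * cnj ((deriv ^^ \<beta>) e w)" if "e \<in> E" for e
    using kernel_deriv_reproducing(2)[OF w Eb[OF that]]
    by (simp add: bergman_inner_commute[of "kernel_deriv \<beta> w"] mult.commute)
  have 3: "bergman_inner (kernel_deriv \<beta> w) (kernel_deriv \<alpha> w) = (deriv ^^ \<alpha>) (kernel_deriv \<beta> w) w"
    by (intro kernel_deriv_reproducing w)
  show ?thesis
    using 1 2 unfolding 3 by (rule has_sum_cong[THEN iffD1, rotated])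
qed

section \<open>Weak compactness\<close>

text \<open>Norm bounds are locally uniform bounds, so Montel applies. The limit stays in the unit
  ball by semicontinuity in the Taylor coefficients, and weak convergence is reduced to polynomials,
  where it is convergence of finitely many coefficients.\<close>

lemma bergman_weak_compactness:
  assumes f: "\<And>n. f n \<in> bergman" "\<And>n. bergman_norm (f n) \<le> 1"
  obtains g r where "g \<in> bergman" "bergman_norm g \<le> 1" "strict_mono (r :: nat \<Rightarrow> nat)"
    "\<And>m w. w \<in> unit_disk \<Longrightarrow> (\<lambda>n. (deriv ^^ m) (f (r n)) w) \<longlonglongrightarrow> (deriv ^^ m) g w"
    "\<And>e. e \<in> bergman \<Longrightarrow> (\<lambda>n. bergman_inner (f (r n)) e) \<longlonglongrightarrow> bergman_inner g e"
proof -
  obtain g0 r where g0: "g0 holomorphic_on unit_disk" and r: "strict_mono (r :: nat \<Rightarrow> nat)"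
    and ul0: "\<And>K. compact K \<Longrightarrow> K \<subseteq> unit_disk \<Longrightarrow> uniform_limit K (f \<circ> r) g0 sequentially"
  proof (rule Montel[of unit_disk "range f" f])
    fix K :: "complex set" assume K: "compact K" "K \<subseteq> unit_disk"
    show "\<exists>B. \<forall>h\<in>range f. \<forall>z\<in>K. cmod (h z) \<le> B"
    proof (cases "K = {}")
      case False
      obtain z0 where z0: "z0 \<in> K" "\<And>z. z \<in> K \<Longrightarrow> cmod z \<le> cmod z0"
        using continuous_attains_sup[OF K(1) False, of cmod] by (auto intro: continuous_intros)
      have "cmod (f n z) \<le> 1 / (1 - (cmod z0)\<^sup>2)" if z: "z \<in> K" for n z
      proof -
        have zd: "z \<in> unit_disk" "z0 \<in> unit_disk" using K z z0 by auto
        have "cmod (f n z) \<le> bergman_norm (f n) / (1 - (cmod z)\<^sup>2)"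
          by (rule bergman_pointwise_bound[OF f(1) zd(1)])
        also have "\<dots> \<le> 1 / (1 - (cmod z0)\<^sup>2)"
          using disk_one_minus_pos[OF zd(1)] disk_one_minus_pos[OF zd(2)] z0(2)[OF z]
          by (intro frac_le f(2)) (auto intro: power_mono)
        finally show ?thesis .
      qed
      then show ?thesis by auto
    qed auto
  qed (use f bergman_holomorphic in auto)
  \<comment> \<open>Montel's limit is controlled on the disk only; outside it is reset to 0.\<close>
  define g where "g z = (if z \<in> unit_disk then g0 z else 0)" for z
  have g_hol: "g holomorphic_on unit_disk"
    using g0 by (rule holomorphic_transform) (simp add: g_def)
  have ul: "uniform_limit K (\<lambda>n. f (r n)) g sequentially" if K: "compact K" "K \<subseteq> unit_disk" for K
  proof -
    have "uniform_limit K (\<lambda>n. f (r n)) g0 sequentially" using ul0[OF K] by (simp add: comp_def)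
    then show ?thesis
      by (rule uniform_limit_cong'[THEN iffD1, rotated 2]) (use K(2) in \<open>auto simp: g_def\<close>)
  qed
  have dl: "(\<lambda>n. (deriv ^^ m) (f (r n)) w) \<longlonglongrightarrow> (deriv ^^ m) g w" if w: "w \<in> unit_disk" for m w
  proof (rule higher_deriv_complex_uniform_limit)
    define s where "s = (1 + cmod w) / 2"
    have s: "cmod w < s" "s < 1" using w by (auto simp: s_def)
    have "uniform_limit (cball 0 s) (\<lambda>n. f (r n)) g sequentially" using s by (intro ul) auto
    then show "uniform_limit (ball 0 s) (\<lambda>n. f (r n)) g sequentially"
      by (rule uniform_limit_on_subset) auto
    have "f (r n) holomorphic_on ball 0 s" for n
      using bergman_holomorphic[OF f(1)] by (rule holomorphic_on_subset) (use s in auto)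
    then show "eventually (\<lambda>n. f (r n) holomorphic_on ball 0 s) sequentially" by simp
  qed (use w in \<open>auto simp: field_simps\<close>)
  have cl: "(\<lambda>n. taylor_coeff (f (r n)) m) \<longlonglongrightarrow> taylor_coeff g m" for m
    unfolding taylor_coeff_def by (intro tendsto_divide dl tendsto_const) auto
  \<comment> \<open>Fatou for the Parseval series: every finite section passes to the limit.\<close>
  have part: "(\<Sum>m<M. (cmod (taylor_coeff g m))\<^sup>2 / (real m + 1)) \<le> 1" for M
  proof (rule LIMSEQ_le_const2)
    show "(\<lambda>n. \<Sum>m<M. (cmod (taylor_coeff (f (r n)) m))\<^sup>2 / (real m + 1)) \<longlonglongrightarrow>
        (\<Sum>m<M. (cmod (taylor_coeff g m))\<^sup>2 / (real m + 1))"
      by (intro tendsto_intros cl) (auto simp: add_eq_0_iff)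
    have "(\<Sum>m<M. (cmod (taylor_coeff (f k) m))\<^sup>2 / (real m + 1)) \<le> (bergman_norm (f k))\<^sup>2" for k
      using sum_le_suminf[OF sums_summable[OF bergman_norm_sums[OF f(1)]], of "{..<M}" k]
        sums_unique[OF bergman_norm_sums[OF f(1)], of k] by simp
    also have "(bergman_norm (f k))\<^sup>2 \<le> 1" for k using f(2)[of k] by (simp add: power_le_one)
    finally show "\<exists>N. \<forall>n\<ge>N. (\<Sum>m<M. (cmod (taylor_coeff (f (r n)) m))\<^sup>2 / (real m + 1)) \<le> 1" by blast
  qed
  have sm: "summable (\<lambda>m. (cmod (taylor_coeff g m))\<^sup>2 / (real m + 1))"
    by (rule summableI_nonneg_bounded[where x = 1]) (auto simp: part)
  have g: "g \<in> bergman"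
    by (rule bergmanI_taylor[OF g_hol _ sm]) (simp add: g_def)
  have "(bergman_norm g)\<^sup>2 \<le> 1"
    using suminf_le_const[OF sm part] sums_unique[OF bergman_norm_sums[OF g]] by simp
  then have g1: "bergman_norm g \<le> 1" using power2_le_imp_le[of "bergman_norm g" 1] by simp
  have weak: "(\<lambda>n. bergman_inner (f (r n)) e) \<longlonglongrightarrow> bergman_inner g e" if e: "e \<in> bergman" for e
  proof (rule LIMSEQ_I)
    fix \<epsilon> :: real assume \<epsilon>: "0 < \<epsilon>"
    have "eventually (\<lambda>N. bergman_norm (\<lambda>z. e z - bergman_partial e N z) < \<epsilon> / 4) sequentially"
      using order_tendstoD(2)[OF bergman_partial_tendsto[OF e], of "\<epsilon> / 4"] \<epsilon> by simp
    then obtain N where N: "bergman_norm (\<lambda>z. e z - bergman_partial e N z) < \<epsilon> / 4"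
      by (auto simp: eventually_sequentially)
    \<comment> \<open>A polynomial within \<epsilon>/4 of \<open>e\<close>; each of the three errors
      below is then at most \<epsilon>/4.\<close>
    define p where "p = bergman_partial e N"
    have p: "p \<in> bergman" by (simp add: p_def)
    have ip: "bergman_inner h p = (\<Sum>m<N. cnj (taylor_coeff e m) * (taylor_coeff h m / (of_nat m + 1)))" if "h \<in> bergman" for h
      unfolding p_def bergman_partial_def using that
      by (subst bergman_inner_sum_right) (auto simp: bergman_inner_monomial)
    have "(\<lambda>n. bergman_inner (f (r n)) p) \<longlonglongrightarrow> bergman_inner g p"
      unfolding ip[OF f(1)] ip[OF g] by (intro tendsto_intros cl of_nat_plus_one_neq_zero)
    then obtain n0 where n0: "\<And>n. n \<ge> n0 \<Longrightarrow> cmod (bergman_inner (f (r n)) p - bergman_inner g p) < \<epsilon> / 4"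
      using LIMSEQ_D[of _ _ "\<epsilon> / 4"] \<epsilon> by (metis divide_pos_pos zero_less_numeral)
    have d: "cmod (bergman_inner h e - bergman_inner h p) \<le> \<epsilon> / 4" if "h \<in> bergman" "bergman_norm h \<le> 1" for h
    proof -
      have "bergman_inner h e - bergman_inner h p = bergman_inner h (\<lambda>z. e z - p z)"
        using bergman_inner_lincomb_right[OF e p that(1), of 1 "-1"] by simp
      then have "cmod (bergman_inner h e - bergman_inner h p) \<le> bergman_norm h * bergman_norm (\<lambda>z. e z - p z)"
        using bergman_Cauchy_Schwarz[OF that(1) bergman_diff[OF e p]] by simp
      also have "\<dots> \<le> 1 * (\<epsilon> / 4)" using N that(2) \<epsilon> by (intro mult_mono) (auto simp: p_def)
      finally show ?thesis by simp
    qed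
    show "\<exists>no. \<forall>n\<ge>no. norm (bergman_inner (f (r n)) e - bergman_inner g e) < \<epsilon>"
    proof (intro exI allI impI)
      fix n assume "n \<ge> n0"
      let ?x = "bergman_inner (f (r n)) e - bergman_inner (f (r n)) p"
      let ?y = "bergman_inner (f (r n)) p - bergman_inner g p"
      let ?z = "bergman_inner g e - bergman_inner g p"
      have "norm (?x + ?y - ?z) \<le> norm ?x + norm ?y + norm ?z"
        using norm_triangle_ineq4[of "?x + ?y" ?z] norm_triangle_ineq[of ?x ?y] by linarith
      moreover have "?x + ?y - ?z = bergman_inner (f (r n)) e - bergman_inner g e" by simp
      ultimately have "norm (bergman_inner (f (r n)) e - bergman_inner g e) \<le> norm ?x + norm ?y + norm ?z" by simp
      also have "\<dots> < \<epsilon>" using d[OF f, of "r n"] d[OF g g1] n0[OF \<open>n \<ge> n0\<close>] \<epsilon> by linarith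
      finally show "norm (bergman_inner (f (r n)) e - bergman_inner g e) < \<epsilon>" .
    qed
  qed
  show ?thesis using that[OF g g1 r dl weak] .
qed

text \<open>Reduces to series over \<open>nat\<close>: \<open>E\<close> is enumerated and the family
  extended by zero off its indices. The common bound \<open>K\<close> of all finite absolute sums
  supplies both pointwise absolute convergence and summability of the integrated norms.\<close>

lemma has_sum_integral_countable:
  fixes \<phi> :: "'e \<Rightarrow> 'a \<Rightarrow> complex"
  assumes E: "countable E"
    and \<phi>: "\<And>e. e \<in> E \<Longrightarrow> integrable N (\<phi> e)"
    and K: "integrable N K" "\<And>F w. finite F \<Longrightarrow> F \<subseteq> E \<Longrightarrow> w \<in> space N \<Longrightarrow> (\<Sum>e\<in>F. cmod (\<phi> e w)) \<le> K w"
    and S: "\<And>w. w \<in> space N \<Longrightarrow> ((\<lambda>e. \<phi> e w) has_sum S w) E"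
  shows "((\<lambda>e. \<integral>w. \<phi> e w \<partial>N) has_sum (\<integral>w. S w \<partial>N)) E"
proof -
  define I where "I = to_nat_on E ` E"
  define \<psi> where "\<psi> n w = (if n \<in> I then \<phi> (from_nat_into E n) w else 0)" for n w
  have inj: "inj_on (to_nat_on E) E" using E by (rule inj_on_to_nat_on)
  have fE: "from_nat_into E (to_nat_on E e) = e" if "e \<in> E" for e using E that by simp
  have fI: "from_nat_into E n \<in> E" if "n \<in> I" for n using that fE by (auto simp: I_def)
  have transfer: "(g has_sum x) E \<longleftrightarrow> ((\<lambda>n. if n \<in> I then g (from_nat_into E n) else 0) has_sum x) UNIV" for g :: "'e \<Rightarrow> complex" and x
  proof -
    have "(g has_sum x) E \<longleftrightarrow> ((g \<circ> from_nat_into E) \<circ> to_nat_on E has_sum x) E"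
      by (intro has_sum_cong) (simp add: fE)
    also have "\<dots> \<longleftrightarrow> (g \<circ> from_nat_into E has_sum x) I"
      unfolding I_def by (rule has_sum_reindex[OF inj, symmetric])
    also have "\<dots> \<longleftrightarrow> ((\<lambda>n. if n \<in> I then g (from_nat_into E n) else 0) has_sum x) UNIV"
      by (intro has_sum_cong_neutral) auto
    finally show ?thesis .
  qed
  have int: "integrable N (\<psi> n)" for n
    unfolding \<psi>_def[abs_def] using \<phi>[OF fI] by (cases "n \<in> I") auto
  have psum: "(\<Sum>n<m. cmod (\<psi> n w)) \<le> K w" if w: "w \<in> space N" for m w
  proof -
    have inj': "inj_on (from_nat_into E) ({..<m} \<inter> I)"
      by (intro inj_onI) (use fE in \<open>auto simp: I_def\<close>)
    have "(\<Sum>n<m. cmod (\<psi> n w)) = (\<Sum>n\<in>{..<m} \<inter> I. cmod (\<phi> (from_nat_into E n) w))"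
      by (intro sum.mono_neutral_cong_right) (auto simp: \<psi>_def)
    also have "\<dots> = (\<Sum>e\<in>from_nat_into E ` ({..<m} \<inter> I). cmod (\<phi> e w))"
      by (simp add: sum.reindex[OF inj'])
    also have "\<dots> \<le> K w" using fI w by (intro K(2)) auto
    finally show ?thesis .
  qed
  have sN: "summable (\<lambda>n. norm (\<psi> n w))" if "w \<in> space N" for w
    by (rule summableI_nonneg_bounded[where x = "K w"]) (use psum[OF that] in auto)
  have sI: "summable (\<lambda>n. \<integral>w. norm (\<psi> n w) \<partial>N)"
  proof (rule summableI_nonneg_bounded[where x = "\<integral>w. K w \<partial>N"])
    fix m
    have "(\<Sum>n<m. \<integral>w. norm (\<psi> n w) \<partial>N) = (\<integral>w. (\<Sum>n<m. norm (\<psi> n w)) \<partial>N)"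
      by (rule Bochner_Integration.integral_sum[symmetric]) (simp add: int)
    also have "\<dots> \<le> (\<integral>w. K w \<partial>N)"
      by (intro integral_mono K(1) psum Bochner_Integration.integrable_sum integrable_norm int)
    finally show "(\<Sum>n<m. \<integral>w. norm (\<psi> n w) \<partial>N) \<le> (\<integral>w. K w \<partial>N)" .
  qed simp
  have "(\<lambda>n. \<integral>w. \<psi> n w \<partial>N) sums (\<integral>w. (\<Sum>n. \<psi> n w) \<partial>N)"
    by (rule sums_integral[OF int AE_I2[OF sN] sI])
  moreover have "(\<Sum>n. \<psi> n w) = S w" if "w \<in> space N" for w
  proof -
    have "((\<lambda>n. \<psi> n w) has_sum S w) UNIV" using S[OF that] unfolding transfer \<psi>_def .
    then show ?thesis by (simp add: has_sum_imp_sums sums_unique[symmetric])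
  qed
  ultimately have "(\<lambda>n. \<integral>w. \<psi> n w \<partial>N) sums (\<integral>w. S w \<partial>N)"
    by (simp cong: Bochner_Integration.integral_cong)
  moreover have "summable (\<lambda>n. norm (\<integral>w. \<psi> n w \<partial>N))"
    by (rule summable_comparison_test'[OF sI]) (simp add: integral_norm_bound)
  ultimately have "((\<lambda>n. \<integral>w. \<psi> n w \<partial>N) has_sum (\<integral>w. S w \<partial>N)) UNIV"
    by (intro norm_summable_imp_has_sum)
  also have "(\<lambda>n. \<integral>w. \<psi> n w \<partial>N) = (\<lambda>n. if n \<in> I then \<integral>w. \<phi> (from_nat_into E n) w \<partial>N else 0)"
    by (auto simp: \<psi>_def)
  finally show ?thesis unfolding transfer .
qed

text \<open>This is the form of the adjoint, which therefore also arises from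
  \<open>form_operator\<close>.\<close>

lemma bounded_form_adjoint:
  assumes B: "bounded_form B" shows "bounded_form (\<lambda>f g. cnj (B g f))"
proof -
  obtain C where C: "C \<ge> 0" "\<And>f g. f \<in> bergman \<Longrightarrow> g \<in> bergman \<Longrightarrow> cmod (B f g) \<le> C * bergman_norm f * bergman_norm g"
    using B unfolding bounded_form_def by blast
  have l: "B (\<lambda>z. a * f z + b * g z) h = a * B f h + b * B g h"
    "B h (\<lambda>z. a * f z + b * g z) = cnj a * B h f + cnj b * B h g"
    if "f \<in> bergman" "g \<in> bergman" "h \<in> bergman" for f g h a b
    using B that unfolding bounded_form_def by blast+
  show ?thesis unfolding bounded_form_def
  proof (intro conjI ballI allI exI[of _ C])
    fix f g assume "f \<in> bergman" "g \<in> bergman"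
    then show "cmod (cnj (B g f)) \<le> C * bergman_norm f * bergman_norm g"
      using C(2)[of g f] by (simp add: mult_ac)
  qed (simp_all add: l C(1))
qed

section \<open>Toeplitz forms with a weight\<close>

lemma form_operator_inner:
  "bounded_form B \<Longrightarrow> f \<in> bergman \<Longrightarrow> g \<in> bergman \<Longrightarrow> bergman_inner (form_operator B f) g = B f g"
  by (rule form_operator_Riesz) blast+

text \<open>Separates the operator theory from complex measures: what remains of \<mu> is a positive
  measure \<open>N\<close> and a density \<open>h\<close>, into which the sign (-1)^(\<alpha> +
  \<beta>) is absorbed on instantiation.\<close>

locale weighted_toeplitz =
  fixes N :: "complex measure" and h :: "complex \<Rightarrow> complex" and \<alpha> \<beta> :: nat
    and B :: "(complex \<Rightarrow> complex) \<Rightarrow> (complex \<Rightarrow> complex) \<Rightarrow> complex"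
  assumes sets_N: "sets N = sets disk_borel"
    and h_measurable: "h \<in> borel_measurable N"
    and weight: "integrable N (\<lambda>w. complex_of_real (1 / (1 - (cmod w)\<^sup>2) ^ (\<alpha> + \<beta> + 2)) * h w)"
    and B_eq: "\<And>f g. f \<in> bergman \<Longrightarrow> g \<in> bergman \<Longrightarrow>
        B f g = (\<integral>w. (deriv ^^ \<alpha>) f w * cnj ((deriv ^^ \<beta>) g w) * h w \<partial>N)"
begin

abbreviation "T \<equiv> form_operator B"
abbreviation "Tadj \<equiv> form_operator (\<lambda>f g. cnj (B g f))"

lemma space_N: "space N = unit_disk"
  using sets_eq_imp_space_eq[OF sets_N] by simp

text \<open>Majorant of the integrand of \<open>B\<close> on unit vectors. It also majorizes finite
  sums over pairs of orthonormal families, because \<open>deriv_bound\<close> controls square sums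
  of derivatives just as well.\<close>

definition dominator :: "complex \<Rightarrow> real" where
  "dominator w = deriv_bound \<alpha> w * deriv_bound \<beta> w * cmod (h w)"

text \<open>This one number bounds the form and all finite sums of singular values.\<close>

definition trace_bound :: real where
  "trace_bound = (\<integral>w. dominator w \<partial>N)"

lemma dominator_nonneg: "w \<in> unit_disk \<Longrightarrow> 0 \<le> dominator w"
  unfolding dominator_def by (intro mult_nonneg_nonneg deriv_bound_nonneg norm_ge_zero)

lemma integrable_dominator: "integrable N dominator"
proof -
  let ?c = "fact \<alpha> * 4 ^ (\<alpha> + 1) * (fact \<beta> * 4 ^ (\<beta> + 1)) :: real"
  have "integrable N (\<lambda>w. ?c * cmod (complex_of_real (1 / (1 - (cmod w)\<^sup>2) ^ (\<alpha> + \<beta> + 2)) * h w))"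
    by (intro integrable_mult_right integrable_norm weight)
  also have "?this \<longleftrightarrow> integrable N dominator"
  proof (intro Bochner_Integration.integrable_cong refl)
    fix w assume "w \<in> space N"
    then have "0 < 1 - (cmod w)\<^sup>2" using disk_one_minus_pos space_N by blast
    then have "cmod (complex_of_real (1 / (1 - (cmod w)\<^sup>2) ^ (\<alpha> + \<beta> + 2)) * h w) =
        1 / (1 - (cmod w)\<^sup>2) ^ (\<alpha> + \<beta> + 2) * cmod (h w)"
      unfolding norm_mult norm_of_real by simp
    then show "?c * cmod (complex_of_real (1 / (1 - (cmod w)\<^sup>2) ^ (\<alpha> + \<beta> + 2)) * h w) = dominator w"
      unfolding dominator_def deriv_bound_mult by (simp only: mult.assoc)
  qed
  finally show ?thesis .
qed

lemma trace_bound_nonneg: "0 \<le> trace_bound"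
  unfolding trace_bound_def
  by (rule Bochner_Integration.integral_nonneg_AE, rule AE_I2) (simp add: space_N dominator_nonneg)

lemma deriv_measurable:
  assumes "f \<in> bergman" shows "(deriv ^^ n) f \<in> borel_measurable N"
  using holomorphic_higher_deriv[OF bergman_holomorphic[OF assms] open_ball]
  by (intro borel_measurable_disk_continuous sets_N holomorphic_on_imp_continuous_on)

lemma integrand_measurable:
  assumes "f \<in> bergman" "g \<in> bergman"
  shows "(\<lambda>w. (deriv ^^ \<alpha>) f w * cnj ((deriv ^^ \<beta>) g w) * h w) \<in> borel_measurable N"
  using deriv_measurable[OF assms(1)] borel_measurable_cnj[OF deriv_measurable[OF assms(2)]] h_measurable
  by simp

lemma integrand_bound:
  assumes "f \<in> bergman" "g \<in> bergman" "w \<in> unit_disk"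
  shows "cmod ((deriv ^^ \<alpha>) f w * cnj ((deriv ^^ \<beta>) g w) * h w) \<le> bergman_norm f * bergman_norm g * dominator w"
proof -
  have "cmod ((deriv ^^ \<alpha>) f w) * cmod ((deriv ^^ \<beta>) g w) * cmod (h w) \<le>
      (deriv_bound \<alpha> w * bergman_norm f) * (deriv_bound \<beta> w * bergman_norm g) * cmod (h w)"
    using bergman_deriv_le[OF assms(1,3)] bergman_deriv_le[OF assms(2,3)] deriv_bound_nonneg[OF assms(3)]
    by (intro mult_right_mono mult_mono) auto
  then show ?thesis by (simp add: norm_mult dominator_def mult_ac)
qed

lemma integrand_integrable:
  assumes "f \<in> bergman" "g \<in> bergman"
  shows "integrable N (\<lambda>w. (deriv ^^ \<alpha>) f w * cnj ((deriv ^^ \<beta>) g w) * h w)"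
proof (rule Bochner_Integration.integrable_bound)
  show "integrable N (\<lambda>w. bergman_norm f * bergman_norm g * dominator w)"
    by (intro integrable_mult_right integrable_dominator)
  show "AE w in N. norm ((deriv ^^ \<alpha>) f w * cnj ((deriv ^^ \<beta>) g w) * h w) \<le> norm (bergman_norm f * bergman_norm g * dominator w)"
    using integrand_bound[OF assms] order_trans[OF _ abs_ge_self] by (intro AE_I2) (auto simp: space_N)
qed (rule integrand_measurable[OF assms])

lemma bounded_form_B: "bounded_form B"
  unfolding bounded_form_def
proof (intro conjI ballI allI exI[of _ trace_bound])
  fix f g u a b assume fg: "f \<in> bergman" "g \<in> bergman" "u \<in> bergman"
  note fgl = bergman_lincomb[OF fg(1,2)]
  let ?I = "\<lambda>f g w. (deriv ^^ \<alpha>) f w * cnj ((deriv ^^ \<beta>) g w) * h w"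
  have "B (\<lambda>z. a * f z + b * g z) u = (\<integral>w. a * ?I f u w + b * ?I g u w \<partial>N)"
    unfolding B_eq[OF fgl fg(3)]
    by (intro Bochner_Integration.integral_cong refl)
       (simp only: space_N bergman_deriv_lincomb[OF fg(1,2)] algebra_simps)
  also have "\<dots> = a * (\<integral>w. ?I f u w \<partial>N) + b * (\<integral>w. ?I g u w \<partial>N)"
    using integrand_integrable[OF fg(1,3)] integrand_integrable[OF fg(2,3)] by simp
  finally show "B (\<lambda>z. a * f z + b * g z) u = a * B f u + b * B g u"
    by (simp only: B_eq[OF fg(1,3)] B_eq[OF fg(2,3)])
  have "B u (\<lambda>z. a * f z + b * g z) = (\<integral>w. cnj a * ?I u f w + cnj b * ?I u g w \<partial>N)"
    unfolding B_eq[OF fg(3) fgl]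
    by (intro Bochner_Integration.integral_cong refl)
       (simp only: space_N bergman_deriv_lincomb[OF fg(1,2)] algebra_simps complex_cnj_add complex_cnj_mult)
  also have "\<dots> = cnj a * (\<integral>w. ?I u f w \<partial>N) + cnj b * (\<integral>w. ?I u g w \<partial>N)"
    using integrand_integrable[OF fg(3,1)] integrand_integrable[OF fg(3,2)] by simp
  finally show "B u (\<lambda>z. a * f z + b * g z) = cnj a * B u f + cnj b * B u g"
    by (simp only: B_eq[OF fg(3,1)] B_eq[OF fg(3,2)])
next
  fix f g assume fg: "f \<in> bergman" "g \<in> bergman"
  have "cmod (B f g) \<le> (\<integral>w. bergman_norm f * bergman_norm g * dominator w \<partial>N)"
    unfolding B_eq[OF fg]
    by (rule Bochner_Integration.integral_norm_bound_integral[OF integrand_integrable[OF fg] _ integrand_bound[OF fg]])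
       (auto simp: space_N intro: integrable_dominator)
  then show "cmod (B f g) \<le> trace_bound * bergman_norm f * bergman_norm g"
    by (simp add: trace_bound_def mult_ac)
qed (rule trace_bound_nonneg)

lemma T_in [simp]: "f \<in> bergman \<Longrightarrow> T f \<in> bergman"
  by (rule form_operator_Riesz[OF bounded_form_B]) blast

lemma T_inner: "f \<in> bergman \<Longrightarrow> g \<in> bergman \<Longrightarrow> bergman_inner (T f) g = B f g"
  by (rule form_operator_Riesz[OF bounded_form_B]) blast

lemma T_bounded: obtains C where "0 \<le> C" "\<And>f. f \<in> bergman \<Longrightarrow> bergman_norm (T f) \<le> C * bergman_norm f"
  by (rule form_operator_Riesz[OF bounded_form_B]) blast

lemma T_lincomb:
  assumes "f \<in> bergman" "g \<in> bergman"
  shows "T (\<lambda>z. a * f z + b * g z) = (\<lambda>z. a * T f z + b * T g z)"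
  using bergman_operator_form_operator[OF bounded_form_B] assms unfolding bergman_operator_def by blast

lemma Tadj_in [simp]: "f \<in> bergman \<Longrightarrow> Tadj f \<in> bergman"
  by (rule form_operator_Riesz[OF bounded_form_adjoint[OF bounded_form_B]]) blast

lemma Tadj_inner: 
  assumes "f \<in> bergman" "g \<in> bergman"
  shows "bergman_inner (Tadj f) g = bergman_inner f (T g)"
proof -
  have "bergman_inner (Tadj f) g = cnj (B g f)"
    by (rule form_operator_Riesz[OF bounded_form_adjoint[OF bounded_form_B]]) (use assms in blast)
  then show ?thesis using T_inner[OF assms(2,1)] by (simp add: bergman_inner_commute[of f])
qed

text \<open>In \<open>B f (T f)\<close> only the factor coming from \<open>T f\<close> is estimated,
  and its norm is cancelled. The derivative of \<open>f\<close> stays under the integral, so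
  pointwise convergence of derivatives can control norms of images.\<close>

lemma T_norm_le_integral:
  assumes f: "f \<in> bergman"
  shows "bergman_norm (T f) \<le> (\<integral>w. cmod ((deriv ^^ \<alpha>) f w) * deriv_bound \<beta> w * cmod (h w) \<partial>N)" (is "_ \<le> ?J")
    and "integrable N (\<lambda>w. cmod ((deriv ^^ \<alpha>) f w) * deriv_bound \<beta> w * cmod (h w))"
proof -
  have dbm: "deriv_bound \<beta> \<in> borel_measurable N"
    unfolding deriv_bound_def[abs_def]
    by (intro borel_measurable_disk_continuous sets_N continuous_intros) (auto simp: abs_square_eq_1)
  show int: "integrable N (\<lambda>w. cmod ((deriv ^^ \<alpha>) f w) * deriv_bound \<beta> w * cmod (h w))"
  proof (rule Bochner_Integration.integrable_bound)
    show "integrable N (\<lambda>w. bergman_norm f * dominator w)"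
      by (intro integrable_mult_right integrable_dominator)
    show "(\<lambda>w. cmod ((deriv ^^ \<alpha>) f w) * deriv_bound \<beta> w * cmod (h w)) \<in> borel_measurable N"
      using deriv_measurable[OF f] dbm h_measurable by simp
    have 1: "cmod ((deriv ^^ \<alpha>) f w) * deriv_bound \<beta> w * cmod (h w) \<le> bergman_norm f * dominator w"
      and 2: "0 \<le> cmod ((deriv ^^ \<alpha>) f w) * deriv_bound \<beta> w * cmod (h w)" if w: "w \<in> unit_disk" for w
    proof -
      have "cmod ((deriv ^^ \<alpha>) f w) * (deriv_bound \<beta> w * cmod (h w)) \<le> (deriv_bound \<alpha> w * bergman_norm f) * (deriv_bound \<beta> w * cmod (h w))"
        using deriv_bound_nonneg[OF w] by (intro mult_right_mono bergman_deriv_le[OF f w] mult_nonneg_nonneg) auto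
      then show "cmod ((deriv ^^ \<alpha>) f w) * deriv_bound \<beta> w * cmod (h w) \<le> bergman_norm f * dominator w"
        by (simp add: dominator_def mult_ac)
      show "0 \<le> cmod ((deriv ^^ \<alpha>) f w) * deriv_bound \<beta> w * cmod (h w)"
        using deriv_bound_nonneg[OF w] by simp
    qed
    show "AE w in N. norm (cmod ((deriv ^^ \<alpha>) f w) * deriv_bound \<beta> w * cmod (h w)) \<le> norm (bergman_norm f * dominator w)"
    proof (rule AE_I2)
      fix w assume "w \<in> space N"
      then have "w \<in> unit_disk" by (simp add: space_N)
      note this[THEN 1] this[THEN 2]
      then show "norm (cmod ((deriv ^^ \<alpha>) f w) * deriv_bound \<beta> w * cmod (h w)) \<le> norm (bergman_norm f * dominator w)"
        unfolding real_norm_def by linarith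
    qed
  qed
  have "(bergman_norm (T f))\<^sup>2 = cmod (B f (T f))"
    using bergman_inner_self[of "T f"] T_inner[OF f T_in[OF f]] by (simp add: norm_power)
  also have "\<dots> \<le> (\<integral>w. bergman_norm (T f) * (cmod ((deriv ^^ \<alpha>) f w) * deriv_bound \<beta> w * cmod (h w)) \<partial>N)"
    unfolding B_eq[OF f T_in[OF f]]
  proof (rule Bochner_Integration.integral_norm_bound_integral)
    show "integrable N (\<lambda>w. (deriv ^^ \<alpha>) f w * cnj ((deriv ^^ \<beta>) (T f) w) * h w)"
      by (intro integrand_integrable f T_in)
    show "integrable N (\<lambda>w. bergman_norm (T f) * (cmod ((deriv ^^ \<alpha>) f w) * deriv_bound \<beta> w * cmod (h w)))"
      by (intro integrable_mult_right int)
    fix w assume "w \<in> space N"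
    then have w: "w \<in> unit_disk" by (simp add: space_N)
    have "cmod ((deriv ^^ \<alpha>) f w) * cmod (h w) * cmod ((deriv ^^ \<beta>) (T f) w) \<le>
        cmod ((deriv ^^ \<alpha>) f w) * cmod (h w) * (deriv_bound \<beta> w * bergman_norm (T f))"
      by (intro mult_left_mono bergman_deriv_le[OF T_in[OF f] w]) auto
    then show "norm ((deriv ^^ \<alpha>) f w * cnj ((deriv ^^ \<beta>) (T f) w) * h w) \<le>
        bergman_norm (T f) * (cmod ((deriv ^^ \<alpha>) f w) * deriv_bound \<beta> w * cmod (h w))"
      by (simp add: norm_mult mult_ac)
  qed
  also have "\<dots> = bergman_norm (T f) * ?J" by simp
  finally have *: "bergman_norm (T f) * bergman_norm (T f) \<le> bergman_norm (T f) * ?J" by (simp add: power2_eq_square)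
  have "0 \<le> ?J"
    by (rule Bochner_Integration.integral_nonneg_AE, rule AE_I2) (simp add: space_N deriv_bound_nonneg)
  with * show "bergman_norm (T f) \<le> ?J"
    using bergman_norm_nonneg[of "T f"] by (cases "bergman_norm (T f) = 0") auto
qed

text \<open>Dominated convergence for the differences f_n - g, whose norms are at most 2; hence the
  majorant \<open>2 * dominator\<close>.\<close>

lemma T_norm_tendsto:
  assumes f: "\<And>n. f n \<in> bergman" "\<And>n. bergman_norm (f n) \<le> 1" and g: "g \<in> bergman" "bergman_norm g \<le> 1"
    and lim: "\<And>w. w \<in> unit_disk \<Longrightarrow> (\<lambda>n. (deriv ^^ \<alpha>) (f n) w) \<longlonglongrightarrow> (deriv ^^ \<alpha>) g w"
  shows "(\<lambda>n. bergman_norm (T (f n))) \<longlonglongrightarrow> bergman_norm (T g)"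
proof -
  define d where "d n = (\<lambda>z. f n z - g z)" for n
  have d: "d n \<in> bergman" for n unfolding d_def by (intro bergman_diff f g)
  have dn: "bergman_norm (d n) \<le> 2" for n
    using bergman_norm_triangle[OF f(1)[of n] bergman_scale[OF g(1), of "-1"]] f(2)[of n] g(2)
      bergman_norm_scale[of "-1" g] by (simp add: d_def)
  have Td: "T (d n) = (\<lambda>z. T (f n) z - T g z)" for n
    using T_lincomb[OF f(1)[of n] g(1), of 1 "-1"] by (simp add: d_def)
  have dd: "(deriv ^^ \<alpha>) (d n) w = (deriv ^^ \<alpha>) (f n) w - (deriv ^^ \<alpha>) g w" if "w \<in> unit_disk" for n w
    using bergman_deriv_lincomb[OF f(1)[of n] g(1) that, of \<alpha> 1 "-1"] by (simp add: d_def)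
  have "(\<lambda>n. \<integral>w. cmod ((deriv ^^ \<alpha>) (d n) w) * deriv_bound \<beta> w * cmod (h w) \<partial>N) \<longlonglongrightarrow> (\<integral>w. 0 \<partial>N)"
  proof (rule integral_dominated_convergence)
    show "integrable N (\<lambda>w. 2 * dominator w)" by (intro integrable_mult_right integrable_dominator)
    show "(\<lambda>w. cmod ((deriv ^^ \<alpha>) (d n) w) * deriv_bound \<beta> w * cmod (h w)) \<in> borel_measurable N" for n
      using T_norm_le_integral(2)[OF d] by (rule borel_measurable_integrable)
    show "AE w in N. (\<lambda>n. cmod ((deriv ^^ \<alpha>) (d n) w) * deriv_bound \<beta> w * cmod (h w)) \<longlonglongrightarrow> 0"
    proof (rule AE_I2)
      fix w assume "w \<in> space N"
      then have w: "w \<in> unit_disk" by (simp add: space_N)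
      have "(\<lambda>n. cmod ((deriv ^^ \<alpha>) (f n) w - (deriv ^^ \<alpha>) g w) * deriv_bound \<beta> w * cmod (h w)) \<longlonglongrightarrow>
          cmod ((deriv ^^ \<alpha>) g w - (deriv ^^ \<alpha>) g w) * deriv_bound \<beta> w * cmod (h w)"
        by (intro tendsto_intros lim w)
      then show "(\<lambda>n. cmod ((deriv ^^ \<alpha>) (d n) w) * deriv_bound \<beta> w * cmod (h w)) \<longlonglongrightarrow> 0"
        by (simp add: dd[OF w])
    qed
    show "AE w in N. norm (cmod ((deriv ^^ \<alpha>) (d n) w) * deriv_bound \<beta> w * cmod (h w)) \<le> 2 * dominator w" for n
    proof (rule AE_I2)
      fix w assume "w \<in> space N"
      then have w: "w \<in> unit_disk" by (simp add: space_N)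
      have "cmod ((deriv ^^ \<alpha>) (d n) w) \<le> deriv_bound \<alpha> w * 2"
        using bergman_deriv_le[OF d w, of \<alpha> n] mult_left_mono[OF dn deriv_bound_nonneg[OF w], of \<alpha> n] by linarith
      then have "cmod ((deriv ^^ \<alpha>) (d n) w) * (deriv_bound \<beta> w * cmod (h w)) \<le> deriv_bound \<alpha> w * 2 * (deriv_bound \<beta> w * cmod (h w))"
        using deriv_bound_nonneg[OF w] by (intro mult_right_mono) auto
      then show "norm (cmod ((deriv ^^ \<alpha>) (d n) w) * deriv_bound \<beta> w * cmod (h w)) \<le> 2 * dominator w"
        using deriv_bound_nonneg[OF w] by (simp add: dominator_def abs_mult mult_ac)
    qed
  qed simp
  then have J: "(\<lambda>n. \<integral>w. cmod ((deriv ^^ \<alpha>) (d n) w) * deriv_bound \<beta> w * cmod (h w) \<partial>N) \<longlonglongrightarrow> 0" by simp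
  have "(\<lambda>n. bergman_norm (T (f n)) - bergman_norm (T g)) \<longlonglongrightarrow> 0"
  proof (rule Lim_null_comparison[OF _ J])
    have "\<bar>bergman_norm (T (f n)) - bergman_norm (T g)\<bar> \<le> bergman_norm (T (d n))" for n
    proof -
      have "bergman_norm (T (f n)) \<le> bergman_norm (T (d n)) + bergman_norm (T g)"
        using bergman_norm_triangle[OF T_in[OF d[of n]] T_in[OF g(1)]] by (simp add: Td)
      moreover have "bergman_norm (T g) \<le> bergman_norm (T (d n)) + bergman_norm (T (f n))"
        using bergman_norm_triangle[OF bergman_scale[OF T_in[OF d[of n]], of "-1"] T_in[OF f(1)[of n]]]
          bergman_norm_scale[of "-1" "T (d n)"] by (simp add: Td)
      ultimately show ?thesis by linarith
    qed
    then show "eventually (\<lambda>n. norm (bergman_norm (T (f n)) - bergman_norm (T g)) \<le>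
        (\<integral>w. cmod ((deriv ^^ \<alpha>) (d n) w) * deriv_bound \<beta> w * cmod (h w) \<partial>N)) sequentially"
      using T_norm_le_integral(1)[OF d] by (intro always_eventually allI) (metis order_trans real_norm_def)
  qed
  then show ?thesis by (simp add: LIM_zero_iff)
qed

section \<open>Singular vectors by maximization on orthogonal complements\<close>

definition annihilator :: "(complex \<Rightarrow> complex) set \<Rightarrow> (complex \<Rightarrow> complex) set" where
  "annihilator E = {f \<in> bergman. \<forall>e\<in>E. bergman_inner f e = 0}"

lemma annihilator_lincomb:
  "E \<subseteq> bergman \<Longrightarrow> f \<in> annihilator E \<Longrightarrow> g \<in> annihilator E \<Longrightarrow> (\<lambda>z. a * f z + b * g z) \<in> annihilator E"
  unfolding annihilator_def by (auto simp: bergman_lincomb bergman_inner_lincomb subset_iff)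

lemma T_scale: "f \<in> bergman \<Longrightarrow> T (\<lambda>z. a * f z) = (\<lambda>z. a * T f z)"
  using T_lincomb[of f f a 0] by simp

text \<open>A maximizing sequence has a weak limit, which stays in the orthogonal complement, and
  the norms of the images converge along it. The unit ball is used instead of the sphere because
  weak limits may lose norm.\<close>

lemma maximizer_exists:
  assumes E: "E \<subseteq> bergman" and g: "g \<in> annihilator E" "T g \<noteq> (\<lambda>_. 0)"
  obtains f where "f \<in> annihilator E" "bergman_norm f = 1" "0 < bergman_norm (T f)"
    "\<And>u. u \<in> annihilator E \<Longrightarrow> bergman_norm (T u) \<le> bergman_norm (T f) * bergman_norm u"
proof -
  obtain C where C: "0 \<le> C" "\<And>f. f \<in> bergman \<Longrightarrow> bergman_norm (T f) \<le> C * bergman_norm f"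
    by (rule T_bounded, rule that)
  define S where "S = {bergman_norm (T u) | u. u \<in> annihilator E \<and> bergman_norm u \<le> 1}"
  have ab: "u \<in> bergman" if "u \<in> annihilator E" for u using that by (simp add: annihilator_def)
  have bdd: "bdd_above S"
  proof (rule bdd_aboveI[of _ C])
    fix x assume "x \<in> S"
    then obtain u where "u \<in> annihilator E" "bergman_norm u \<le> 1" "x = bergman_norm (T u)" by (auto simp: S_def)
    then show "x \<le> C" using C(2)[OF ab, of u] mult_left_mono[OF _ C(1), of "bergman_norm u" 1] by simp
  qed
  have normalize: "(\<lambda>z. of_real (1 / bergman_norm u) * u z) \<in> annihilator E"
    "bergman_norm (\<lambda>z. of_real (1 / bergman_norm u) * u z) = 1"
    "bergman_norm (T (\<lambda>z. of_real (1 / bergman_norm u) * u z)) = bergman_norm (T u) / bergman_norm u"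
    if u: "u \<in> annihilator E" "bergman_norm u \<noteq> 0" for u
  proof -
    show "(\<lambda>z. of_real (1 / bergman_norm u) * u z) \<in> annihilator E"
      using annihilator_lincomb[OF E u(1) u(1), of "of_real (1 / bergman_norm u)" 0] by simp
    have n: "cmod (of_real (1 / bergman_norm u)) = 1 / bergman_norm u"
      by (simp only: norm_of_real) simp
    show "bergman_norm (\<lambda>z. of_real (1 / bergman_norm u) * u z) = 1"
      unfolding bergman_norm_scale n using u(2) by simp
    show "bergman_norm (T (\<lambda>z. of_real (1 / bergman_norm u) * u z)) = bergman_norm (T u) / bergman_norm u"
      unfolding T_scale[OF ab[OF u(1)]] bergman_norm_scale n by simp
  qed
  \<comment> \<open>Rescaling turns the supremum over the unit ball into a homogeneous
    bound.\<close>
  have up: "bergman_norm (T u) \<le> Sup S * bergman_norm u" if u: "u \<in> annihilator E" for u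
  proof (cases "bergman_norm u = 0")
    case True
    then show ?thesis using C(2)[OF ab[OF u]] bergman_norm_nonneg[of "T u"] by simp
  next
    case False
    then have "bergman_norm (T u) / bergman_norm u \<in> S"
      using normalize[OF u False] unfolding S_def by (intro CollectI) (metis order_refl)
    then have "bergman_norm (T u) / bergman_norm u \<le> Sup S" by (rule cSup_upper[OF _ bdd])
    moreover have "0 < bergman_norm u" using False bergman_norm_nonneg[of u] by linarith
    ultimately show ?thesis by (simp add: pos_divide_le_eq)
  qed
  have Tg: "0 < bergman_norm (T g)"
    using g(2) bergman_norm_zero_iff[OF T_in[OF ab[OF g(1)]]] bergman_norm_nonneg[of "T g"] by linarith
  have Spos: "0 < Sup S"
  proof (rule ccontr)
    assume "\<not> 0 < Sup S"
    then have "Sup S * bergman_norm g \<le> 0" by (simp add: mult_nonpos_nonneg)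
    then show False using up[OF g(1)] Tg by linarith
  qed
  have "S \<noteq> {}"
  proof -
    have "(\<lambda>_. 0) \<in> annihilator E" by (simp add: annihilator_def)
    then have "bergman_norm (T (\<lambda>_. 0)) \<in> S" unfolding S_def by (intro CollectI exI[of _ "\<lambda>_. 0"]) simp
    then show ?thesis by blast
  qed
  have "\<exists>u. u \<in> annihilator E \<and> bergman_norm u \<le> 1 \<and> Sup S - 1 / (real n + 1) < bergman_norm (T u)" for n
  proof -
    have "Sup S - 1 / (real n + 1) < Sup S" by simp
    then obtain x where "x \<in> S" "Sup S - 1 / (real n + 1) < x"
      using less_cSup_iff[OF \<open>S \<noteq> {}\<close> bdd] by blast
    then show ?thesis by (auto simp: S_def)
  qed
  then obtain f where f: "\<And>n. f n \<in> annihilator E" "\<And>n. bergman_norm (f n) \<le> 1"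
    "\<And>n. Sup S - 1 / (real n + 1) < bergman_norm (T (f n))" by metis
  obtain f0 r where f0: "f0 \<in> bergman" "bergman_norm f0 \<le> 1" and r: "strict_mono (r :: nat \<Rightarrow> nat)"
    and dl: "\<And>m w. w \<in> unit_disk \<Longrightarrow> (\<lambda>n. (deriv ^^ m) (f (r n)) w) \<longlonglongrightarrow> (deriv ^^ m) f0 w"
    and weak: "\<And>e. e \<in> bergman \<Longrightarrow> (\<lambda>n. bergman_inner (f (r n)) e) \<longlonglongrightarrow> bergman_inner f0 e"
    by (rule bergman_weak_compactness[of f, OF ab[OF f(1)] f(2)], rule that)
  have "bergman_inner f0 e = 0" if "e \<in> E" for e
  proof -
    have "bergman_inner (f (r n)) e = 0" for n using f(1)[of "r n"] that by (simp add: annihilator_def)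
    then show ?thesis using weak[of e] that E LIMSEQ_const_iff[of 0 "bergman_inner f0 e"] by auto
  qed
  then have f0E: "f0 \<in> annihilator E" using f0 by (simp add: annihilator_def)
  have "(\<lambda>n. bergman_norm (T (f (r n)))) \<longlonglongrightarrow> bergman_norm (T f0)"
    by (rule T_norm_tendsto[OF ab[OF f(1)] f(2) f0 dl])
  moreover have "(\<lambda>n. Sup S - 1 / (real (r n) + 1)) \<longlonglongrightarrow> Sup S"
  proof -
    have "(\<lambda>n. Sup S - 1 / (real n + 1)) \<longlonglongrightarrow> Sup S" by real_asymp
    from LIMSEQ_subseq_LIMSEQ[OF this r] show ?thesis by (simp add: comp_def)
  qed
  ultimately have ge: "Sup S \<le> bergman_norm (T f0)"
    by (intro LIMSEQ_le) (use f(3) in \<open>auto intro: less_imp_le\<close>)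
  have "bergman_norm (T f0) \<le> Sup S * bergman_norm f0" by (rule up[OF f0E])
  \<comment> \<open>A limit of norm below 1 could not reach the positive supremum, by the
    homogeneous bound.\<close>
  then have f01: "bergman_norm f0 = 1"
  proof -
    assume "bergman_norm (T f0) \<le> Sup S * bergman_norm f0"
    with ge have "Sup S * 1 \<le> Sup S * bergman_norm f0" by linarith
    then have "1 \<le> bergman_norm f0" using Spos by simp
    with f0(2) show ?thesis by linarith
  qed
  have eq: "bergman_norm (T f0) = Sup S" using up[OF f0E] ge f01 by simp
  show ?thesis
  proof (rule that[OF f0E f01])
    show "0 < bergman_norm (T f0)" using eq Spos by simp
    show "bergman_norm (T u) \<le> bergman_norm (T f0) * bergman_norm u" if "u \<in> annihilator E" for u
      unfolding eq by (rule up[OF that])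
  qed
qed

text \<open>Weak form of \<open>T\<^sup>*T e = \<parallel>T e\<parallel>\<^sup>2 e\<close>, stated
  without the adjoint; elements of the space killed by \<open>T\<close> qualify.\<close>

definition singular_vector :: "(complex \<Rightarrow> complex) \<Rightarrow> bool" where
  "singular_vector e \<longleftrightarrow> e \<in> bergman \<and>
     (\<forall>u\<in>bergman. bergman_inner (T e) (T u) = of_real ((bergman_norm (T e))\<^sup>2) * bergman_inner e u)"

text \<open>If \<open>T\<close> vanishes on the orthogonal complement, any unit vector of it works.
  Otherwise a maximizer of the norm of the image satisfies the eigenvector equation, by a
  variational argument.\<close>

lemma singular_vector_exists:
  assumes E: "\<And>e. e \<in> E \<Longrightarrow> singular_vector e" and g: "g \<in> annihilator E" "g \<noteq> (\<lambda>_. 0)"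
  obtains f where "f \<in> annihilator E" "bergman_norm f = 1" "singular_vector f"
proof (cases "\<forall>u\<in>annihilator E. T u = (\<lambda>_. 0)")
  case True
  have gb: "g \<in> bergman" using g by (simp add: annihilator_def)
  have Eb: "E \<subseteq> bergman" using E by (auto simp: singular_vector_def)
  define f where "f = (\<lambda>z. of_real (1 / bergman_norm g) * g z)"
  have f: "f \<in> annihilator E" unfolding f_def
    using annihilator_lincomb[OF Eb g(1) g(1), of "of_real (1 / bergman_norm g)" 0] by simp
  have fb: "f \<in> bergman" unfolding f_def by (rule bergman_scale[OF gb])
  have Tf: "T f = (\<lambda>_. 0)" using True f by blast
  have "bergman_norm f = 1"
    unfolding f_def bergman_norm_scale norm_of_real using g(2) bergman_norm_zero_iff[OF gb] by simp
  moreover have "singular_vector f"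
    using fb by (simp add: singular_vector_def Tf)
  ultimately show ?thesis using f that by blast
next
  case False
  then obtain u0 where u0: "u0 \<in> annihilator E" "T u0 \<noteq> (\<lambda>_. 0)" by blast
  have Eb: "E \<subseteq> bergman" using E by (auto simp: singular_vector_def)
  obtain f where f: "f \<in> annihilator E" "bergman_norm f = 1" "0 < bergman_norm (T f)"
    and fmax: "\<And>u. u \<in> annihilator E \<Longrightarrow> bergman_norm (T u) \<le> bergman_norm (T f) * bergman_norm u"
    by (rule maximizer_exists[OF Eb u0], rule that)
  have fb: "f \<in> bergman" using f by (simp add: annihilator_def)
  define L where "L = (bergman_norm (T f))\<^sup>2"
  have L: "L > 0" using f(3) by (simp add: L_def)
  define A where "A = Tadj (T f)"
  have Ab: "A \<in> bergman" using fb by (simp add: A_def)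
  have Ai: "bergman_inner A u = bergman_inner (T f) (T u)" if "u \<in> bergman" for u
    unfolding A_def by (rule Tadj_inner[OF T_in[OF fb] that])
  \<comment> \<open>The defect of the eigenvector equation for \<open>f\<close>. It is orthogonal to
    \<open>E\<close> because \<open>E\<close> consists of eigenvectors, hence is an admissible
    direction for perturbing \<open>f\<close>.\<close>
  define d where "d = (\<lambda>z. A z + of_real (- L) * f z)"
  have db: "d \<in> bergman" unfolding d_def by (intro bergman_add bergman_scale Ab fb)
  have di: "bergman_inner d u = bergman_inner (T f) (T u) - of_real L * bergman_inner f u" if "u \<in> bergman" for u
    using bergman_inner_lincomb[OF Ab fb that, of 1 "of_real (- L)"] Ai[OF that] by (simp add: d_def)
  have dE: "d \<in> annihilator E"
  proof -
    have "bergman_inner d e = 0" if e: "e \<in> E" for e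
    proof -
      have eb: "e \<in> bergman" using e Eb by blast
      have fe: "bergman_inner f e = 0" using f(1) e by (simp add: annihilator_def)
      have "bergman_inner (T e) (T f) = of_real ((bergman_norm (T e))\<^sup>2) * bergman_inner e f"
        using E[OF e] fb by (simp add: singular_vector_def)
      then have "bergman_inner (T f) (T e) = 0"
        using fe by (simp add: bergman_inner_commute[of "T f"] bergman_inner_commute[of e f])
      then show ?thesis using di[OF eb] fe by simp
    qed
    then show ?thesis using db by (simp add: annihilator_def)
  qed
  have "bergman_norm d = 0"
  proof (rule ccontr)
    assume "bergman_norm d \<noteq> 0"
    then have dpos: "0 < (bergman_norm d)\<^sup>2" by simp
    \<comment> \<open>Along f + t d the first-order gain is 2 t |d|^2, while the quadratic term
      offsets at most L t^2 |d|^2; with t = 1 / L this is only half of the gain.\<close>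
    define t where "t = 1 / L"
    let ?u = "\<lambda>z. f z + of_real t * d z"
    have uE: "?u \<in> annihilator E"
      using annihilator_lincomb[OF Eb f(1) dE, of 1 "of_real t"] by simp
    have Tu: "T ?u = (\<lambda>z. T f z + of_real t * T d z)"
      using T_lincomb[OF fb db, of 1 "of_real t"] by simp
    have "(bergman_norm (T ?u))\<^sup>2 \<le> (bergman_norm (T f) * bergman_norm ?u)\<^sup>2"
      by (intro power_mono fmax uE) simp
    then have "(bergman_norm (T ?u))\<^sup>2 \<le> L * (bergman_norm ?u)\<^sup>2" by (simp add: L_def power_mult_distrib)
    moreover have "(bergman_norm (T ?u))\<^sup>2 = L + 2 * t * Re (bergman_inner (T f) (T d)) + t\<^sup>2 * (bergman_norm (T d))\<^sup>2"
      unfolding Tu bergman_norm_square_add[OF T_in[OF fb] T_in[OF db]] by (simp add: L_def)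
    moreover have "(bergman_norm ?u)\<^sup>2 = 1 + 2 * t * Re (bergman_inner f d) + t\<^sup>2 * (bergman_norm d)\<^sup>2"
      unfolding bergman_norm_square_add[OF fb db] by (simp add: f(2))
    moreover have "(bergman_norm d)\<^sup>2 = Re (bergman_inner (T f) (T d)) - L * Re (bergman_inner f d)"
    proof -
      have "complex_of_real ((bergman_norm d)\<^sup>2) = bergman_inner (T f) (T d) - of_real L * bergman_inner f d"
        using di[OF db] bergman_inner_self[of d] by simp
      from arg_cong[OF this, of Re] show ?thesis by simp
    qed
    moreover have "0 \<le> t\<^sup>2 * (bergman_norm (T d))\<^sup>2" by simp
    moreover have "2 * t * D \<le> L * (t\<^sup>2 * D)"
      if "U \<le> L * V" "U = L + 2 * t * X + Q" "V = 1 + 2 * t * Y + t\<^sup>2 * D" "D = X - L * Y" "0 \<le> Q"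
      for D U V X Y Q :: real
    proof -
      have "L * V = L + L * (2 * t * Y) + L * (t\<^sup>2 * D)" unfolding that(3) by (simp add: algebra_simps)
      moreover have "2 * t * D = 2 * t * X - L * (2 * t * Y)" unfolding that(4) by (simp add: algebra_simps)
      ultimately show ?thesis using that(1,2,5) by linarith
    qed
    ultimately have "2 * t * (bergman_norm d)\<^sup>2 \<le> L * (t\<^sup>2 * (bergman_norm d)\<^sup>2)" by blast
    also have "\<dots> = t * (bergman_norm d)\<^sup>2" using L by (simp add: t_def power2_eq_square)
    finally have "2 * t * (bergman_norm d)\<^sup>2 \<le> t * (bergman_norm d)\<^sup>2" .
    moreover have "0 < t * (bergman_norm d)\<^sup>2" using dpos L by (simp add: t_def)
    ultimately show False by linarith
  qed
  then have "d = (\<lambda>_. 0)" using bergman_norm_zero_iff[OF db] by simp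
  then have "singular_vector f"
    using di fb by (simp add: singular_vector_def L_def)
  then show ?thesis using f that by blast
qed

text \<open>Zorn's lemma for orthonormal sets of singular vectors: a maximal one is complete, since
  \<open>singular_vector_exists\<close> would otherwise extend it. The kernel of \<open>T\<close> is
  covered in the same pass.\<close>

lemma singular_basis:
  obtains E where "bergman_onb E" "\<And>e. e \<in> E \<Longrightarrow> singular_vector e"
proof -
  define \<S> where "\<S> = {E. orthonormal E (\<lambda>e. e) \<and> (\<forall>e\<in>E. singular_vector e)}"
  have "\<exists>E\<in>\<S>. \<forall>X\<in>\<S>. E \<subseteq> X \<longrightarrow> X = E"
  proof (rule subset_Zorn')
    fix \<C> assume \<C>: "subset.chain \<S> \<C>"
    have sub: "C \<in> \<S>" if "C \<in> \<C>" for C using \<C> that by (auto simp: subset.chain_def)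
    have common: "\<exists>C\<in>\<C>. a \<in> C \<and> b \<in> C" if "a \<in> \<Union> \<C>" "b \<in> \<Union> \<C>" for a b
      using \<C> that unfolding subset_chain_def by blast
    have "orthonormal (\<Union> \<C>) (\<lambda>e. e)"
      unfolding orthonormal_def
    proof (intro conjI ballI)
      fix a assume "a \<in> \<Union> \<C>"
      then show "a \<in> bergman" using sub by (auto simp: \<S>_def orthonormal_def)
    next
      fix a b assume "a \<in> \<Union> \<C>" "b \<in> \<Union> \<C>"
      then obtain C where "C \<in> \<C>" "a \<in> C" "b \<in> C" using common by blast
      then show "bergman_inner a b = (if a = b then 1 else 0)"
        using sub[of C] by (simp add: \<S>_def orthonormal_def)
    qed
    moreover have "\<forall>e\<in>\<Union> \<C>. singular_vector e" using sub by (auto simp: \<S>_def)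
    ultimately show "\<Union> \<C> \<in> \<S>" by (simp add: \<S>_def)
  qed
  then obtain E where E: "orthonormal E (\<lambda>e. e)" "\<And>e. e \<in> E \<Longrightarrow> singular_vector e"
    and max: "\<And>X. X \<in> \<S> \<Longrightarrow> E \<subseteq> X \<Longrightarrow> X = E" by (auto simp: \<S>_def)
  have "g = (\<lambda>_. 0)" if g: "g \<in> annihilator E" for g
  proof (rule ccontr)
    assume "g \<noteq> (\<lambda>_. 0)"
    then obtain f where f: "f \<in> annihilator E" "bergman_norm f = 1" "singular_vector f"
      using singular_vector_exists[OF E(2) g] by blast
    have fe: "bergman_inner f e = 0" "bergman_inner e f = 0" if "e \<in> E" for e
      using f(1) that by (auto simp: annihilator_def bergman_inner_commute[of e f])
    have "f \<notin> E" using fe(1)[of f] f(2) by (auto simp: bergman_inner_self)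
    then have "orthonormal (insert f E) (\<lambda>e. e)"
      using E(1) f fe by (auto simp: orthonormal_def annihilator_def bergman_inner_self)
    then have "insert f E = E" using E(2) f(3) by (intro max) (auto simp: \<S>_def)
    then have "bergman_inner f f = 0" using fe(1) by blast
    then show False using f(2) by (simp add: bergman_inner_self)
  qed
  then have "bergman_onb E"
    using E(1) unfolding bergman_onb_def orthonormal_def annihilator_def by blast
  then show ?thesis using E(2) that by blast
qed

section \<open>Summable singular values, trace class and trace\<close>

lemma singular_sum_bound:
  assumes F: "finite F" "orthonormal F (\<lambda>e. e)" "\<And>e. e \<in> F \<Longrightarrow> singular_vector e"
  shows "(\<Sum>e\<in>F. bergman_norm (T e)) \<le> trace_bound"
proof -
  define s where "s e = bergman_norm (T e)" for e
  \<comment> \<open>Vectors with \<open>s e = 0\<close> add nothing to the sum and are dropped: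
    there \<open>1 / s e\<close> is 0 and \<open>u e\<close> would not be a unit vector.\<close>
  define G where "G = {e\<in>F. s e \<noteq> 0}"
  define u where "u e = (\<lambda>z. of_real (1 / s e) * T e z)" for e
  have Fb: "e \<in> bergman" if "e \<in> F" for e using F(2) that by (auto simp: orthonormal_def)
  have GF: "G \<subseteq> F" "finite G" using F(1) by (auto simp: G_def)
  have ub: "u e \<in> bergman" if "e \<in> F" for e unfolding u_def by (intro bergman_scale T_in Fb that)
  \<comment> \<open>The eigenvector equation turns orthogonality of the \<open>e\<close> into
    orthogonality of their images.\<close>
  have TT: "bergman_inner (T e) (T e') = of_real ((s e)\<^sup>2) * (if e = e' then 1 else 0)" if "e \<in> F" "e' \<in> F" for e e'
    using F(2,3) that by (simp add: singular_vector_def orthonormal_def s_def)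
  have Gu: "orthonormal G u"
    unfolding orthonormal_def
  proof (intro conjI ballI)
    fix e e' assume e: "e \<in> G" "e' \<in> G"
    then have "bergman_inner (u e) (u e') = of_real (1 / s e) * (of_real (1 / s e') * (of_real ((s e)\<^sup>2) * (if e = e' then 1 else 0)))"
    proof -
      have "e \<in> F" "e' \<in> F" using e GF by auto
      then show ?thesis
        unfolding u_def by (subst bergman_inner_scale, subst bergman_inner_scale_right) (simp only: TT complex_cnj_complex_of_real)
    qed
    then show "bergman_inner (u e) (u e') = (if e = e' then 1 else 0)"
      using e by (simp add: G_def power2_eq_square)
  qed (use ub GF in auto)
  have se: "complex_of_real (s e) = B e (u e)" if "e \<in> G" for e
  proof -
    have eF: "e \<in> F" using that GF by auto
    have "B e (u e) = bergman_inner (T e) (u e)" by (rule T_inner[OF Fb[OF eF] ub[OF eF], symmetric])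
    also have "\<dots> = of_real (1 / s e) * of_real ((s e)\<^sup>2)"
      unfolding u_def bergman_inner_scale_right complex_cnj_complex_of_real TT[OF eF eF] by simp
    finally show ?thesis using that by (simp add: G_def power2_eq_square)
  qed
  let ?I = "\<lambda>e w. (deriv ^^ \<alpha>) e w * cnj ((deriv ^^ \<beta>) (u e) w) * h w"
  have int: "integrable N (?I e)" if "e \<in> G" for e
    using that GF by (intro integrand_integrable Fb ub) auto
  have "complex_of_real (\<Sum>e\<in>G. s e) = (\<Sum>e\<in>G. \<integral>w. ?I e w \<partial>N)"
    using GF by (auto simp: se intro!: sum.cong B_eq Fb ub)
  also have "\<dots> = (\<integral>w. (\<Sum>e\<in>G. ?I e w) \<partial>N)"
    by (rule Bochner_Integration.integral_sum[symmetric]) (rule int)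
  finally have "cmod (complex_of_real (\<Sum>e\<in>G. s e)) = cmod (\<integral>w. (\<Sum>e\<in>G. ?I e w) \<partial>N)" by simp
  also have "\<dots> \<le> (\<integral>w. dominator w \<partial>N)"
  proof (rule Bochner_Integration.integral_norm_bound_integral)
    show "integrable N (\<lambda>w. \<Sum>e\<in>G. ?I e w)" by (intro Bochner_Integration.integrable_sum int)
    show "integrable N dominator" by (rule integrable_dominator)
    fix w assume "w \<in> space N"
    then have w: "w \<in> unit_disk" by (simp add: space_N)
    \<comment> \<open>Pointwise in \<open>w\<close>, Cauchy-Schwarz over \<open>e\<close> meets two
      orthonormal families, so the bound does not involve the number of vectors.\<close>
    have "norm (\<Sum>e\<in>G. ?I e w) \<le> (\<Sum>e\<in>G. cmod ((deriv ^^ \<alpha>) e w) * cmod ((deriv ^^ \<beta>) (u e) w) * cmod (h w))"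
      by (intro sum_norm_le) (simp add: norm_mult)
    also have "\<dots> = (\<Sum>e\<in>G. cmod ((deriv ^^ \<alpha>) e w) * cmod ((deriv ^^ \<beta>) (u e) w)) * cmod (h w)"
      by (rule sum_distrib_right[symmetric])
    also have "\<dots> \<le> deriv_bound \<alpha> w * deriv_bound \<beta> w * cmod (h w)"
      by (intro mult_right_mono sum_mult_le_sqrt deriv_bound_nonneg[OF w] norm_ge_zero
            orthonormal_deriv_bound[OF orthonormal_subset[OF F(2) GF(1)] GF(2) w] orthonormal_deriv_bound[OF Gu GF(2) w])
    finally show "norm (\<Sum>e\<in>G. ?I e w) \<le> dominator w" by (simp add: dominator_def)
  qed
  finally have "\<bar>\<Sum>e\<in>G. s e\<bar> \<le> trace_bound" unfolding norm_of_real trace_bound_def .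
  moreover have "(\<Sum>e\<in>F. s e) = (\<Sum>e\<in>G. s e)"
    using F(1) by (intro sum.mono_neutral_right) (auto simp: G_def)
  ultimately show ?thesis using abs_ge_self[of "\<Sum>e\<in>G. s e"] by (simp add: s_def)
qed

lemma trace_class: "bergman_trace_class T"
proof -
  obtain E where E: "bergman_onb E" "\<And>e. e \<in> E \<Longrightarrow> singular_vector e" by (rule singular_basis) blast
  note o = bergman_onb_orthonormal[OF E(1)]
  have Eb: "e \<in> bergman" if "e \<in> E" for e using o that by (auto simp: orthonormal_def)
  define s where "s e = bergman_norm (T e)" for e
  have s0: "0 \<le> s e" for e by (simp add: s_def)
  have sum: "(\<Sum>e\<in>F. s e) \<le> trace_bound" if "finite F" "F \<subseteq> E" for F
    unfolding s_def using that E(2) by (intro singular_sum_bound orthonormal_subset[OF o]) auto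
  \<comment> \<open>Singletons in the bound on finite sums give the boundedness that the diagonal
    form requires.\<close>
  have sb: "\<bar>s e\<bar> \<le> trace_bound" if "e \<in> E" for e
    using sum[of "{e}"] that s0[of e] by simp
  note bf = diagonal_form_bounded[where s = s, OF o sb]
  define P where "P = form_operator (diagonal_form E s)"
  have Pop: "bergman_operator P" unfolding P_def by (rule bergman_operator_form_operator[OF bf])
  have Pb: "P f \<in> bergman" if "f \<in> bergman" for f
    using Pop that by (simp add: bergman_operator_def)
  have Pi: "bergman_inner (P f) g = diagonal_form E s f g" if "f \<in> bergman" "g \<in> bergman" for f g
    unfolding P_def by (rule form_operator_inner[OF bf that])
  have Pe: "bergman_inner (P f) e = of_real (s e) * bergman_inner f e" if "f \<in> bergman" "e \<in> E" for f e
    using Pi[OF that(1) Eb[OF that(2)]] diagonal_form_basis[OF o that(2)] by simp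
  have pos: "bergman_inner (P f) f \<in> \<real>\<^sub>\<ge>\<^sub>0" if f: "f \<in> bergman" for f
  proof -
    have eqr: "of_real (s e) * (bergman_inner f e * bergman_inner e f) = complex_of_real (s e * (cmod (bergman_inner f e))\<^sup>2)" for e
      unfolding of_real_mult complex_norm_square by (simp add: bergman_inner_commute[of e f])
    then have "bergman_inner (P f) f = (\<Sum>\<^sub>\<infinity>e\<in>E. complex_of_real (s e * (cmod (bergman_inner f e))\<^sup>2))"
      by (simp only: Pi[OF f f] diagonal_form_def)
    also have "\<dots> = complex_of_real (\<Sum>\<^sub>\<infinity>e\<in>E. s e * (cmod (bergman_inner f e))\<^sup>2)"
    proof -
      have "cmod (of_real (s e) * (bergman_inner f e * bergman_inner e f)) = s e * (cmod (bergman_inner f e))\<^sup>2" for e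
        unfolding eqr norm_of_real using s0[of e] by simp
      then have "(\<lambda>e. s e * (cmod (bergman_inner f e))\<^sup>2) summable_on E"
        using diagonal_summable[where s = s, OF o sb f f] by simp
      then have "((\<lambda>e. s e * (cmod (bergman_inner f e))\<^sup>2) has_sum (\<Sum>\<^sub>\<infinity>e\<in>E. s e * (cmod (bergman_inner f e))\<^sup>2)) E"
        by (rule has_sum_infsum)
      then show ?thesis by (intro infsumI) (simp only: has_sum_of_real_iff)
    qed
    finally show ?thesis
      using infsum_nonneg[of E "\<lambda>e. s e * (cmod (bergman_inner f e))\<^sup>2"] s0
      by (simp add: nonneg_Reals_of_real_iff)
  qed
  \<comment> \<open>In the eigenbasis the coefficients of \<open>T\<^sup>*T f\<close> are s_e^2
    times those of \<open>f\<close>. One factor s_e is absorbed into the coefficients of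
    \<open>P f\<close>, the other is the entry of the second application of
    \<open>P\<close>.\<close>
  have sq: "bergman_inner (P (P f)) g = bergman_inner (T f) (T g)" if f: "f \<in> bergman" and g: "g \<in> bergman" for f g
  proof -
    have Ai: "bergman_inner (Tadj (T f)) u = bergman_inner (T f) (T u)" if "u \<in> bergman" for u
      by (rule Tadj_inner[OF T_in[OF f] that])
    have "bergman_inner (Tadj (T f)) e = of_real ((s e)\<^sup>2) * bergman_inner f e" if e: "e \<in> E" for e
    proof -
      have "bergman_inner (T e) (T f) = of_real ((s e)\<^sup>2) * bergman_inner e f"
        using E(2)[OF e] f by (simp add: singular_vector_def s_def)
      then show ?thesis
        using Ai[OF Eb[OF e]] by (simp add: bergman_inner_commute[of "T f"] bergman_inner_commute[of f e])
    qed
    then have eq: "bergman_inner (Tadj (T f)) e * bergman_inner e g =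
        of_real (s e) * (bergman_inner (P f) e * bergman_inner e g)" if "e \<in> E" for e
      using that by (simp add: Pe[OF f] power2_eq_square mult_ac)
    have "bergman_inner (T f) (T g) = (\<Sum>\<^sub>\<infinity>e\<in>E. bergman_inner (Tadj (T f)) e * bergman_inner e g)"
      using infsumI[OF bergman_onb_Parseval[OF E(1) Tadj_in[OF T_in[OF f]] g]] Ai[OF g] by simp
    also have "\<dots> = diagonal_form E s (P f) g"
      unfolding diagonal_form_def by (rule infsum_cong) (rule eq)
    finally show ?thesis using Pi[OF Pb[OF f] g] by simp
  qed
  have "s summable_on E"
  proof (rule nonneg_bdd_above_summable_on)
    show "bdd_above (sum s ` {F. F \<subseteq> E \<and> finite F})"
      by (rule bdd_aboveI2[where M = trace_bound]) (use sum in auto)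
  qed (rule s0)
  then have "(\<lambda>e. complex_of_real (s e)) summable_on E" by (rule summable_on_of_real)
  also have "?this \<longleftrightarrow> (\<lambda>e. bergman_inner (P e) e) summable_on E"
    using o by (intro summable_on_cong) (simp add: Pe Eb orthonormal_def)
  finally have "(\<lambda>e. bergman_inner (P e) e) summable_on E" .
  moreover have "bergman_modulus T P"
    unfolding bergman_modulus_def using Pop pos sq by blast
  ultimately show ?thesis
    unfolding bergman_trace_class_def using E(1) bergman_operator_form_operator[OF bounded_form_B] by blast
qed

text \<open>Summation under the integral is licensed by \<open>dominator\<close>, which bounds the
  finite absolute sums with the same basis in both factors.\<close>

lemma trace_has_sum:
  assumes E: "bergman_onb E"
  shows "((\<lambda>e. bergman_inner (T e) e) has_sum (\<integral>w. (deriv ^^ \<alpha>) (kernel_deriv \<beta> w) w * h w \<partial>N)) E"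
proof -
  note o = bergman_onb_orthonormal[OF E]
  have Eb: "e \<in> bergman" if "e \<in> E" for e using o that by (auto simp: orthonormal_def)
  let ?I = "\<lambda>e w. (deriv ^^ \<alpha>) e w * cnj ((deriv ^^ \<beta>) e w) * h w"
  have "((\<lambda>e. \<integral>w. ?I e w \<partial>N) has_sum (\<integral>w. (deriv ^^ \<alpha>) (kernel_deriv \<beta> w) w * h w \<partial>N)) E"
  proof (rule has_sum_integral_countable[OF bergman_onb_countable[OF E] _ integrable_dominator])
    show "integrable N (?I e)" if "e \<in> E" for e by (intro integrand_integrable Eb that)
    show "((\<lambda>e. ?I e w) has_sum (deriv ^^ \<alpha>) (kernel_deriv \<beta> w) w * h w) E" if "w \<in> space N" for w
      using that by (intro has_sum_cmult_left onb_deriv_has_sum[OF E]) (simp add: space_N)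
    fix F w assume F: "finite F" "F \<subseteq> E" and "w \<in> space N"
    then have w: "w \<in> unit_disk" by (simp add: space_N)
    note oF = orthonormal_deriv_bound[OF orthonormal_subset[OF o F(2)] F(1) w]
    have "(\<Sum>e\<in>F. cmod (?I e w)) = (\<Sum>e\<in>F. cmod ((deriv ^^ \<alpha>) e w) * cmod ((deriv ^^ \<beta>) e w)) * cmod (h w)"
      by (simp add: norm_mult sum_distrib_right)
    also have "\<dots> \<le> deriv_bound \<alpha> w * deriv_bound \<beta> w * cmod (h w)"
      by (intro mult_right_mono sum_mult_le_sqrt deriv_bound_nonneg[OF w] norm_ge_zero oF)
    finally show "(\<Sum>e\<in>F. cmod (?I e w)) \<le> dominator w" by (simp add: dominator_def)
  qed
  also have "?this \<longleftrightarrow> ?thesis"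
    by (intro has_sum_cong) (simp add: T_inner Eb B_eq)
  finally show ?thesis .
qed

lemma trace_eq: "bergman_trace T = (\<integral>w. (deriv ^^ \<alpha>) (kernel_deriv \<beta> w) w * h w \<partial>N)"
proof -
  \<comment> \<open>Uniqueness in the definite description needs at least one basis; with none,
    every number would qualify.\<close>
  obtain E where E: "bergman_onb E" by (rule singular_basis)
  show ?thesis
    unfolding bergman_trace_def
  proof (rule the_equality)
    show "\<forall>E. bergman_onb E \<longrightarrow> ((\<lambda>e. bergman_inner (T e) e) has_sum
        (\<integral>w. (deriv ^^ \<alpha>) (kernel_deriv \<beta> w) w * h w \<partial>N)) E"
      using trace_has_sum by blast
    fix t assume "\<forall>E. bergman_onb E \<longrightarrow> ((\<lambda>e. bergman_inner (T e) e) has_sum t) E"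
    then show "t = (\<integral>w. (deriv ^^ \<alpha>) (kernel_deriv \<beta> w) w * h w \<partial>N)"
      using E trace_has_sum[OF E] has_sum_unique by blast
  qed
qed

end

section \<open>Wirtinger derivatives\<close>

text \<open>The coefficients of a real-linear map of the plane written as a v + b cnj v are read off
  from its values at 1 and i.\<close>

lemma wirtinger_has_derivative:
  assumes "(h has_derivative (\<lambda>v. a * v + b * cnj v)) (at w)"
  shows "wirtinger h w = a" "wirtinger_bar h w = b"
proof -
  have "frechet_derivative h (at w) = (\<lambda>v. a * v + b * cnj v)"
    using assms by (rule frechet_derivative_at[symmetric])
  then show "wirtinger h w = a" "wirtinger_bar h w = b"
    by (simp_all add: wirtinger_def wirtinger_bar_def algebra_simps)
qed

text \<open>\<open>frechet_derivative\<close> is a choice made from the derivative predicate.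
  Functions agreeing on an open set share the predicate, hence the choice, whether or not they are
  differentiable.\<close>

lemma frechet_derivative_cong_open:
  assumes S: "open S" "w \<in> S" and eq: "\<And>x. x \<in> S \<Longrightarrow> f x = g x"
  shows "frechet_derivative f (at w) = frechet_derivative g (at w)"
proof -
  have "(f has_derivative D) (at w) \<longleftrightarrow> (g has_derivative D) (at w)" for D
    using has_derivative_transform_within_open[OF _ S] eq by metis
  then show ?thesis by (simp add: frechet_derivative_def)
qed

lemma wirtinger_funpow_cong:
  assumes S: "open S" and eq: "\<And>x. x \<in> S \<Longrightarrow> f x = g x" and w: "w \<in> S"
  shows "(wirtinger ^^ n) f w = (wirtinger ^^ n) g w"
  using w
proof (induction n arbitrary: w)
  case (Suc n)
  have "frechet_derivative ((wirtinger ^^ n) f) (at w) = frechet_derivative ((wirtinger ^^ n) g) (at w)"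
    by (rule frechet_derivative_cong_open[OF S Suc.prems Suc.IH])
  then show ?case by (simp add: wirtinger_def[of "(wirtinger ^^ n) f"] wirtinger_def[of "(wirtinger ^^ n) g"])
qed (simp add: eq)

lemma wirtinger_bar_cong:
  assumes "open S" "w \<in> S" "\<And>x. x \<in> S \<Longrightarrow> f x = g x"
  shows "wirtinger_bar f w = wirtinger_bar g w"
proof -
  have "frechet_derivative f (at w) = frechet_derivative g (at w)"
    using assms by (rule frechet_derivative_cong_open)
  then show ?thesis by (simp add: wirtinger_bar_def)
qed

section \<open>Explicit derivatives through terms z^p u^q / (1 - z u)^s\<close>

definition kernel_term :: "complex \<Rightarrow> nat \<Rightarrow> nat \<Rightarrow> nat \<Rightarrow> complex \<Rightarrow> complex \<Rightarrow> complex" where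
  "kernel_term c p q s z u = c * z ^ p * u ^ q * inverse (1 - z * u) ^ s"

lemma of_nat_power_pred: "of_nat s * x ^ (s - 1) * (x * x) = of_nat s * (x :: complex) ^ (s + 1)"
  by (cases s) auto

lemma disk_mult_neq_one:
  assumes "z \<in> unit_disk" "u \<in> unit_disk" shows "1 - z * u \<noteq> 0"
proof -
  have "cmod z * cmod u < 1 * 1" using assms by (intro mult_strict_mono') auto
  then have "z * u \<noteq> 1" by (metis mult_1 norm_mult norm_one less_irrefl)
  then show ?thesis by simp
qed

text \<open>Differentiating in \<open>z\<close> produces two terms of the same shape. For
  \<open>p = 0\<close> the truncated exponent is harmless, its coefficient being zero.\<close>

lemma kernel_term_deriv:
  assumes "z \<in> unit_disk" "u \<in> unit_disk"
  shows "((\<lambda>z. kernel_term c p q s z u) has_field_derivative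
    kernel_term (c * of_nat p) (p - 1) q s z u + kernel_term (c * of_nat s) p (q + 1) (s + 1) z u) (at z)"
proof -
  let ?I = "inverse (1 - z * u)"
  have ne: "1 - z * u \<noteq> 0" by (rule disk_mult_neq_one[OF assms])
  have "((\<lambda>z. kernel_term c p q s z u) has_field_derivative
      c * (of_nat p * z ^ (p - 1)) * u ^ q * ?I ^ s + c * z ^ p * u ^ q * (of_nat s * ?I ^ (s - 1) * (?I * ?I) * u)) (at z)"
    unfolding kernel_term_def
    by (rule derivative_eq_intros ne refl | simp)+
  then show ?thesis unfolding of_nat_power_pred by (simp add: kernel_term_def mult_ac)
qed

text \<open>After setting u = cnj w, the coefficient of \<open>v\<close> is exactly the derivative
  in \<open>z\<close> at fixed \<open>u\<close>; this is what matches Wirtinger with complex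
  derivatives.\<close>

lemma kernel_term_has_derivative:
  assumes w: "w \<in> unit_disk"
  shows "((\<lambda>w. kernel_term c p q s w (cnj w)) has_derivative
    (\<lambda>v. (kernel_term (c * of_nat p) (p - 1) q s w (cnj w) + kernel_term (c * of_nat s) p (q + 1) (s + 1) w (cnj w)) * v +
         (kernel_term (c * of_nat q) p (q - 1) s w (cnj w) + kernel_term (c * of_nat s) (p + 1) q (s + 1) w (cnj w)) * cnj v)) (at w)"
proof -
  let ?I = "inverse (1 - w * cnj w)"
  have ne: "1 - w * cnj w \<noteq> 0" using w by (intro disk_mult_neq_one) auto
  have cnj: "(cnj has_derivative cnj) (at w)"
    by (rule bounded_linear_imp_has_derivative[OF bounded_linear_cnj])
  have P: "((\<lambda>w. w ^ p) has_derivative (\<lambda>v. of_nat p * v * w ^ (p - 1))) (at w)"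
    by (rule has_derivative_power[OF has_derivative_ident])
  have Q: "((\<lambda>w. cnj w ^ q) has_derivative (\<lambda>v. of_nat q * cnj v * cnj w ^ (q - 1))) (at w)"
    by (rule has_derivative_power[OF cnj])
  have X: "((\<lambda>w. 1 - w * cnj w) has_derivative (\<lambda>v. 0 - (w * cnj v + v * cnj w))) (at w)"
    by (intro has_derivative_diff has_derivative_const has_derivative_mult has_derivative_ident cnj)
  have S: "((\<lambda>w. inverse (1 - w * cnj w) ^ s) has_derivative
      (\<lambda>v. of_nat s * - (?I * (0 - (w * cnj v + v * cnj w)) * ?I) * ?I ^ (s - 1))) (at w)"
    by (rule has_derivative_power[OF Deriv.has_derivative_inverse[OF ne X]])
  have "((\<lambda>w. kernel_term c p q s w (cnj w)) has_derivative
    (\<lambda>v. c * (of_nat p * v * w ^ (p - 1)) * cnj w ^ q * ?I ^ s + c * w ^ p * (of_nat q * cnj v * cnj w ^ (q - 1)) * ?I ^ s +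
         c * w ^ p * cnj w ^ q * (of_nat s * ?I ^ (s - 1) * (?I * ?I)) * (v * cnj w + w * cnj v))) (at w)"
    unfolding kernel_term_def
    by (rule has_derivative_eq_rhs[OF has_derivative_mult[OF has_derivative_mult[OF has_derivative_mult[OF has_derivative_const P] Q] S]])
       (simp add: fun_eq_iff algebra_simps)
  then show ?thesis unfolding of_nat_power_pred by (simp add: kernel_term_def algebra_simps)
qed

text \<open>Finite sums are needed because one differentiation of a term yields two; the class is
  closed under the derivative in \<open>z\<close>.\<close>

inductive kernel_sum :: "(complex \<Rightarrow> complex \<Rightarrow> complex) \<Rightarrow> bool" where
  "kernel_sum (kernel_term c p q s)"
| "kernel_sum F \<Longrightarrow> kernel_sum G \<Longrightarrow> kernel_sum (\<lambda>z u. F z u + G z u)"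

text \<open>One function \<open>Fz\<close> serves as complex derivative at fixed \<open>u\<close>
  and as Wirtinger derivative along u = cnj w. The conjugate coefficient \<open>Fu\<close> need not
  be a kernel sum: conjugate derivatives are taken beforehand, by an explicit formula.\<close>

lemma kernel_sum_deriv:
  assumes "kernel_sum F"
  shows "\<exists>Fz Fu. kernel_sum Fz \<and>
    (\<forall>z\<in>unit_disk. \<forall>u\<in>unit_disk. ((\<lambda>z. F z u) has_field_derivative Fz z u) (at z)) \<and>
    (\<forall>w\<in>unit_disk. ((\<lambda>w. F w (cnj w)) has_derivative (\<lambda>v. Fz w (cnj w) * v + Fu w * cnj v)) (at w))"
  using assms
proof induction
  case (1 c p q s)
  show ?case
    by (rule exI[of _ "\<lambda>z u. kernel_term (c * of_nat p) (p - 1) q s z u + kernel_term (c * of_nat s) p (q + 1) (s + 1) z u"],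
        rule exI[of _ "\<lambda>w. kernel_term (c * of_nat q) p (q - 1) s w (cnj w) + kernel_term (c * of_nat s) (p + 1) q (s + 1) w (cnj w)"],
        intro conjI ballI kernel_sum.intros kernel_term_deriv kernel_term_has_derivative)
next
  case (2 F G)
  from 2(3) obtain Fz Fu where F: "kernel_sum Fz"
    "\<And>z u. z \<in> unit_disk \<Longrightarrow> u \<in> unit_disk \<Longrightarrow> ((\<lambda>z. F z u) has_field_derivative Fz z u) (at z)"
    "\<And>w. w \<in> unit_disk \<Longrightarrow> ((\<lambda>w. F w (cnj w)) has_derivative (\<lambda>v. Fz w (cnj w) * v + Fu w * cnj v)) (at w)" by blast
  from 2(4) obtain Gz Gu where G: "kernel_sum Gz"
    "\<And>z u. z \<in> unit_disk \<Longrightarrow> u \<in> unit_disk \<Longrightarrow> ((\<lambda>z. G z u) has_field_derivative Gz z u) (at z)"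
    "\<And>w. w \<in> unit_disk \<Longrightarrow> ((\<lambda>w. G w (cnj w)) has_derivative (\<lambda>v. Gz w (cnj w) * v + Gu w * cnj v)) (at w)" by blast
  have "((\<lambda>w. F w (cnj w) + G w (cnj w)) has_derivative
      (\<lambda>v. (Fz w (cnj w) + Gz w (cnj w)) * v + (Fu w + Gu w) * cnj v)) (at w)" if "w \<in> unit_disk" for w
    using has_derivative_add[OF F(3)[OF that] G(3)[OF that]] by (simp add: algebra_simps)
  moreover have "((\<lambda>z. F z u + G z u) has_field_derivative (Fz z u + Gz z u)) (at z)" if "z \<in> unit_disk" "u \<in> unit_disk" for z u
    by (intro DERIV_add F(2) G(2) that)
  ultimately show ?case
    by (intro exI[of _ "\<lambda>z u. Fz z u + Gz z u"] exI[of _ "\<lambda>w. Fu w + Gu w"]) (use F(1) G(1) in \<open>simp add: kernel_sum.intros del: mem_ball\<close>)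
qed

lemma kernel_sum_continuous:
  assumes "kernel_sum F" shows "continuous_on unit_disk (\<lambda>w. F w (cnj w))"
proof -
  obtain Fu Fz where "\<forall>w\<in>unit_disk. ((\<lambda>w. F w (cnj w)) has_derivative (\<lambda>v. Fz w (cnj w) * v + Fu w * cnj v)) (at w)"
    using kernel_sum_deriv[OF assms] by blast
  then show ?thesis
    by (intro continuous_at_imp_continuous_on ballI) (auto intro: has_derivative_continuous)
qed

text \<open>Iterating the common derivative: differentiating after setting u = cnj w, in the
  Wirtinger sense, agrees with differentiating at fixed \<open>u\<close> and then setting u = cnj
  w.\<close>

lemma kernel_sum_higher_deriv:
  assumes "kernel_sum F"
  shows "\<exists>G. kernel_sum G \<and>
    (\<forall>w\<in>unit_disk. (wirtinger ^^ n) (\<lambda>w. F w (cnj w)) w = G w (cnj w)) \<and>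
    (\<forall>z\<in>unit_disk. \<forall>u\<in>unit_disk. (deriv ^^ n) (\<lambda>z. F z u) z = G z u)"
proof (induction n)
  case 0
  then show ?case using assms by auto
next
  case (Suc n)
  then obtain G where G: "kernel_sum G" "\<And>w. w \<in> unit_disk \<Longrightarrow> (wirtinger ^^ n) (\<lambda>w. F w (cnj w)) w = G w (cnj w)"
    "\<And>z u. z \<in> unit_disk \<Longrightarrow> u \<in> unit_disk \<Longrightarrow> (deriv ^^ n) (\<lambda>z. F z u) z = G z u" by blast
  obtain Gz Gu where Gz: "kernel_sum Gz"
    "\<And>z u. z \<in> unit_disk \<Longrightarrow> u \<in> unit_disk \<Longrightarrow> ((\<lambda>z. G z u) has_field_derivative Gz z u) (at z)"
    "\<And>w. w \<in> unit_disk \<Longrightarrow> ((\<lambda>w. G w (cnj w)) has_derivative (\<lambda>v. Gz w (cnj w) * v + Gu w * cnj v)) (at w)"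
    using kernel_sum_deriv[OF G(1)] by blast
  have "(wirtinger ^^ Suc n) (\<lambda>w. F w (cnj w)) w = Gz w (cnj w)" if w: "w \<in> unit_disk" for w
  proof -
    have "wirtinger ((wirtinger ^^ n) (\<lambda>w. F w (cnj w))) w = wirtinger (\<lambda>w. G w (cnj w)) w"
      using wirtinger_funpow_cong[OF open_ball G(2) w, where n = 1] by simp
    then show ?thesis using wirtinger_has_derivative(1)[OF Gz(3)[OF w]] by simp
  qed
  moreover have "(deriv ^^ Suc n) (\<lambda>z. F z u) z = Gz z u" if z: "z \<in> unit_disk" and u: "u \<in> unit_disk" for z u
  proof -
    have "deriv ((deriv ^^ n) (\<lambda>z. F z u)) z = deriv (\<lambda>z. G z u) z"
    proof (rule deriv_cong_ev)
      show "eventually (\<lambda>z. (deriv ^^ n) (\<lambda>z. F z u) z = G z u) (nhds z)"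
        using eventually_nhds_in_open[OF open_ball z] by eventually_elim (rule G(3)[OF _ u])
    qed simp
    then show ?thesis using DERIV_imp_deriv[OF Gz(2)[OF z u]] by simp
  qed
  ultimately show ?case using Gz(1) by blast
qed

text \<open>Each conjugate derivative leaves a single term because the exponent of cnj w stays 0.
  With cnj w frozen and the first variable free, the result is
  \<open>kernel_deriv n w\<close>.\<close>

lemma wirtinger_bar_kernel:
  assumes "w \<in> unit_disk"
  shows "(wirtinger_bar ^^ n) (\<lambda>w. 1 / (1 - w * cnj w)\<^sup>2) w = kernel_term (fact (n + 1)) n 0 (n + 2) w (cnj w)"
  using assms
proof (induction n arbitrary: w)
  case 0
  then show ?case by (simp add: kernel_term_def divide_inverse power_inverse power2_eq_square)
next
  case (Suc n)
  have "wirtinger_bar ((wirtinger_bar ^^ n) (\<lambda>w. 1 / (1 - w * cnj w)\<^sup>2)) w =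
      wirtinger_bar (\<lambda>w. kernel_term (fact (n + 1)) n 0 (n + 2) w (cnj w)) w"
    by (rule wirtinger_bar_cong[OF open_ball Suc.prems Suc.IH])
  also have "\<dots> = kernel_term (fact (n + 1) * of_nat 0) n (0 - 1) (n + 2) w (cnj w) +
      kernel_term (fact (n + 1) * of_nat (n + 2)) (n + 1) 0 (n + 2 + 1) w (cnj w)"
    by (rule wirtinger_has_derivative(2)[OF kernel_term_has_derivative[OF Suc.prems]])
  also have "\<dots> = kernel_term (fact (Suc n + 1)) (Suc n) 0 (Suc n + 2) w (cnj w)"
    by (simp add: kernel_term_def mult_ac)
  finally show ?case by simp
qed

text \<open>\<open>G\<close> is the common value that identifies the trace integrand found by
  Parseval with the one in the symbol pairing.\<close>

lemma wirtinger_kernel: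
  obtains G where "kernel_sum G"
    "\<And>w. w \<in> unit_disk \<Longrightarrow> (wirtinger ^^ \<alpha>) ((wirtinger_bar ^^ \<beta>) (\<lambda>w. 1 / (1 - w * cnj w)\<^sup>2)) w = G w (cnj w)"
    "\<And>w. w \<in> unit_disk \<Longrightarrow> (deriv ^^ \<alpha>) (kernel_deriv \<beta> w) w = G w (cnj w)"
proof -
  let ?F = "kernel_term (fact (\<beta> + 1)) \<beta> 0 (\<beta> + 2)"
  obtain G where G: "kernel_sum G" "\<And>w. w \<in> unit_disk \<Longrightarrow> (wirtinger ^^ \<alpha>) (\<lambda>w. ?F w (cnj w)) w = G w (cnj w)"
    "\<And>z u. z \<in> unit_disk \<Longrightarrow> u \<in> unit_disk \<Longrightarrow> (deriv ^^ \<alpha>) (\<lambda>z. ?F z u) z = G z u"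
    using kernel_sum_higher_deriv[where F = ?F and n = \<alpha>, OF kernel_sum.intros(1)] by blast
  show ?thesis
  proof (rule that[OF G(1)])
    fix w :: complex assume w: "w \<in> unit_disk"
    show "(wirtinger ^^ \<alpha>) ((wirtinger_bar ^^ \<beta>) (\<lambda>w. 1 / (1 - w * cnj w)\<^sup>2)) w = G w (cnj w)"
      using wirtinger_funpow_cong[OF open_ball wirtinger_bar_kernel w] G(2)[OF w] by simp
    have cw: "cnj w \<in> unit_disk" using w by simp
    have "(deriv ^^ \<alpha>) (kernel_deriv \<beta> w) w = (deriv ^^ \<alpha>) (\<lambda>z. ?F z (cnj w)) w"
    proof (rule higher_deriv_cong_ev)
      show "eventually (\<lambda>z. kernel_deriv \<beta> w z = ?F z (cnj w)) (nhds w)"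
        using eventually_nhds_in_open[OF open_ball w]
        by eventually_elim (simp add: kernel_deriv_def kernel_term_def divide_inverse power_inverse)
    qed simp
    then show "(deriv ^^ \<alpha>) (kernel_deriv \<beta> w) w = G w (cnj w)" using G(3)[OF w cw] by simp
  qed
qed

text \<open>The representer is tested on itself. Together with Cauchy-Schwarz this makes the mixed
  Wirtinger derivative at most a multiple of the weight.\<close>

lemma kernel_deriv_norm_le:
  assumes w: "w \<in> unit_disk" shows "bergman_norm (kernel_deriv n w) \<le> deriv_bound n w"
proof -
  note k = kernel_deriv_reproducing[OF w, where n = n]
  have "(bergman_norm (kernel_deriv n w))\<^sup>2 = cmod ((deriv ^^ n) (kernel_deriv n w) w)"
    using bergman_inner_self[of "kernel_deriv n w"] k(2)[OF k(1)] by (simp add: norm_power)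
  also have "\<dots> \<le> deriv_bound n w * bergman_norm (kernel_deriv n w)" by (rule bergman_deriv_le[OF k(1) w])
  finally have "bergman_norm (kernel_deriv n w) * bergman_norm (kernel_deriv n w) \<le> deriv_bound n w * bergman_norm (kernel_deriv n w)"
    by (simp add: power2_eq_square)
  then show ?thesis
    using bergman_norm_nonneg[of "kernel_deriv n w"] deriv_bound_nonneg[OF w, of n]
    by (cases "bergman_norm (kernel_deriv n w) = 0") auto
qed

theorem theorem3p3:
  fixes \<alpha> \<beta> :: nat and \<mu> :: "complex set \<Rightarrow> complex"
  assumes "regular_complex_measure \<mu>"
    and "k_carleson (\<alpha> + \<beta>) \<mu>"
    and "(\<integral>\<^sup>+ w. ennreal (1 / (1 - (cmod w)\<^sup>2) ^ (\<alpha> + \<beta> + 2)) \<partial>total_variation disk_borel \<mu>) < \<infinity>"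
  shows "bergman_trace_class (toeplitz_operator \<alpha> \<beta> \<mu>) \<and>
         bergman_trace (toeplitz_operator \<alpha> \<beta> \<mu>) =
           symbol_pairing \<alpha> \<beta> \<mu> (\<lambda>w. 1 / (1 - w * cnj w)\<^sup>2)"
proof -
  define N where "N = total_variation disk_borel \<mu>"
  define W where "W w = 1 / (1 - (cmod w)\<^sup>2) ^ (\<alpha> + \<beta> + 2)" for w :: complex
  \<comment> \<open>The part of \<open>deriv_bound \<alpha> w * deriv_bound \<beta> w\<close> that
    does not depend on \<open>w\<close>.\<close>
  define c where "c = fact \<alpha> * 4 ^ (\<alpha> + 1) * (fact \<beta> * 4 ^ (\<beta> + 1) :: real)"
  have sN: "sets N = sets disk_borel" "space N = unit_disk" by (simp_all add: N_def)
  have db: "deriv_bound \<alpha> w * deriv_bound \<beta> w = c * W w" for w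
    unfolding c_def W_def by (rule deriv_bound_mult)
  have Wm: "W \<in> borel_measurable disk_borel"
    unfolding W_def[abs_def]
    by (intro borel_measurable_disk_continuous continuous_intros refl) (auto simp: abs_square_eq_1)
  have W1: "1 \<le> W w" if "w \<in> space disk_borel" for w
  proof -
    have "0 < 1 - (cmod w)\<^sup>2" using that by (intro disk_one_minus_pos) simp
    then have "0 < (1 - (cmod w)\<^sup>2) ^ (\<alpha> + \<beta> + 2)" "(1 - (cmod w)\<^sup>2) ^ (\<alpha> + \<beta> + 2) \<le> 1"
      by (rule zero_less_power, intro power_le_one) auto
    then show ?thesis unfolding W_def by (subst le_divide_eq_1_pos)
  qed
  have cm: "complex_measure disk_borel \<mu>" using assms(1) by (simp add: regular_complex_measure_def)
  have Wfin: "(\<integral>\<^sup>+ w. ennreal (W w) \<partial>total_variation disk_borel \<mu>) < \<infinity>"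
    using assms(3) by (simp only: W_def)
  obtain h where h: "h \<in> borel_measurable N" "integrable N (\<lambda>w. complex_of_real (W w) * h w)"
    "\<And>f C. f \<in> borel_measurable N \<Longrightarrow> (\<And>w. w \<in> unit_disk \<Longrightarrow> norm (f w) \<le> C * W w) \<Longrightarrow>
        complex_integral disk_borel \<mu> f = (\<integral>w. f w * h w \<partial>N)"
    using complex_integral_density[OF cm Wfin Wm W1] unfolding N_def[symmetric] space_disk_borel by blast
  \<comment> \<open>The sign of the form is moved into the density.\<close>
  let ?h = "\<lambda>w. (- 1) ^ (\<alpha> + \<beta>) * h w"
  interpret weighted_toeplitz N ?h \<alpha> \<beta> "toeplitz_form \<alpha> \<beta> \<mu>"
  proof
    show "sets N = sets disk_borel" by (rule sN(1))
    show "?h \<in> borel_measurable N" using h(1) by simp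
    have "integrable N (\<lambda>w. (- 1) ^ (\<alpha> + \<beta>) * (complex_of_real (W w) * h w))"
      by (intro integrable_mult_right h(2))
    then show "integrable N (\<lambda>w. complex_of_real (1 / (1 - (cmod w)\<^sup>2) ^ (\<alpha> + \<beta> + 2)) * ?h w)"
      unfolding W_def by (simp only: mult.left_commute)
    fix f g assume fg: "f \<in> bergman" "g \<in> bergman"
    let ?\<phi> = "\<lambda>w. (deriv ^^ \<alpha>) f w * cnj ((deriv ^^ \<beta>) g w)"
    have "complex_integral disk_borel \<mu> ?\<phi> = (\<integral>w. ?\<phi> w * h w \<partial>N)"
    proof (rule h(3))
      have "(deriv ^^ n) f \<in> borel_measurable N" if "f \<in> bergman" for f n
        using holomorphic_higher_deriv[OF bergman_holomorphic[OF that] open_ball]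
        by (intro borel_measurable_disk_continuous sN holomorphic_on_imp_continuous_on)
      then show "?\<phi> \<in> borel_measurable N" using fg borel_measurable_cnj by (intro borel_measurable_times) blast+
      fix w :: complex assume w: "w \<in> unit_disk"
      have "norm (?\<phi> w) \<le> (deriv_bound \<alpha> w * bergman_norm f) * (deriv_bound \<beta> w * bergman_norm g)"
        unfolding norm_mult complex_mod_cnj
        using deriv_bound_nonneg[OF w] by (intro mult_mono bergman_deriv_le fg w) auto
      also have "\<dots> = bergman_norm f * bergman_norm g * (deriv_bound \<alpha> w * deriv_bound \<beta> w)" by (simp add: mult_ac)
      finally show "norm (?\<phi> w) \<le> (bergman_norm f * bergman_norm g * c) * W w" by (simp only: db mult.assoc)
    qed
    then show "toeplitz_form \<alpha> \<beta> \<mu> f g = (\<integral>w. ?\<phi> w * ?h w \<partial>N)"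
      unfolding toeplitz_form_def by (simp add: mult.left_commute)
  qed
  have op: "toeplitz_operator \<alpha> \<beta> \<mu> = form_operator (toeplitz_form \<alpha> \<beta> \<mu>)"
    by (intro ext) (simp add: toeplitz_operator_def form_operator_def)
  obtain G where G: "kernel_sum G"
    "\<And>w. w \<in> unit_disk \<Longrightarrow> (wirtinger ^^ \<alpha>) ((wirtinger_bar ^^ \<beta>) (\<lambda>w. 1 / (1 - w * cnj w)\<^sup>2)) w = G w (cnj w)"
    "\<And>w. w \<in> unit_disk \<Longrightarrow> (deriv ^^ \<alpha>) (kernel_deriv \<beta> w) w = G w (cnj w)"
    by (rule wirtinger_kernel[where \<alpha> = \<alpha> and \<beta> = \<beta>], rule that)
  let ?\<psi> = "(wirtinger ^^ \<alpha>) ((wirtinger_bar ^^ \<beta>) (\<lambda>w. 1 / (1 - w * cnj w)\<^sup>2))"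
  have "complex_integral disk_borel \<mu> ?\<psi> = (\<integral>w. ?\<psi> w * h w \<partial>N)"
  proof (rule h(3))
    have "continuous_on unit_disk ?\<psi>"
      using kernel_sum_continuous[OF G(1)] by (rule continuous_on_eq) (simp only: G(2))
    then show "?\<psi> \<in> borel_measurable N" by (rule borel_measurable_disk_continuous[OF sN(1)])
    fix w :: complex assume w: "w \<in> unit_disk"
    note k = kernel_deriv_reproducing[OF w]
    \<comment> \<open>Written as an inner product of representers, the integrand is bounded by a
      multiple of the weight, as the density formula demands.\<close>
    have "norm (?\<psi> w) = norm (bergman_inner (kernel_deriv \<beta> w) (kernel_deriv \<alpha> w))"
      unfolding k(2)[OF k(1)] G(2)[OF w] G(3)[OF w] ..
    also have "\<dots> \<le> bergman_norm (kernel_deriv \<beta> w) * bergman_norm (kernel_deriv \<alpha> w)"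
      by (intro bergman_Cauchy_Schwarz k)
    also have "\<dots> \<le> deriv_bound \<beta> w * deriv_bound \<alpha> w"
      by (intro mult_mono kernel_deriv_norm_le w deriv_bound_nonneg) auto
    also have "\<dots> = c * W w" using db[of w] by (simp only: mult.commute)
    finally show "norm (?\<psi> w) \<le> c * W w" .
  qed
  also have "\<dots> = (\<integral>w. (deriv ^^ \<alpha>) (kernel_deriv \<beta> w) w * h w \<partial>N)"
    by (intro Bochner_Integration.integral_cong refl) (simp only: sN G(2,3))
  finally have "symbol_pairing \<alpha> \<beta> \<mu> (\<lambda>w. 1 / (1 - w * cnj w)\<^sup>2) =
      (\<integral>w. (deriv ^^ \<alpha>) (kernel_deriv \<beta> w) w * ?h w \<partial>N)"
    unfolding symbol_pairing_def by (simp add: mult.left_commute)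
  then show ?thesis using trace_class trace_eq by (simp add: op)
qed

end
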